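(* A subgroup $\Gamma<\mathrm{PSL}(3,\mathbb R)$ is non-elementary if and only if it is Zariski-dense in $\mathrm{PSL}(3,\mathbb R)$.
   Context: A subgroup $\Gamma<\mathrm{PSL}(3,\mathbb R)$ is elementary if, up to passing to a finite-index subgroup, it stabilises a (possibly degenerate, possibly without real points) conic in $\mathbb{RP}^2$ or in the dual plane $(\mathbb{RP}^2)^*$; equivalently, if some finite-index subgroup of $\Gamma$ fixes a point of $\mathbb P\,\mathrm{Sym}^2\big((\mathbb R^3)^*\big)$ or a point of $\mathbb P\,\mathrm{Sym}^2(\mathbb R^3)$ for the induced action. Otherwise $\Gamma$ is non-elementary. $\mathrm{PSL}(3,\mathbb R)\cong\mathrm{SL}(3,\mathbb R)$ is regarded as a real algebraic group. *)

theory Defs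
  imports "HOL-Analysis.Analysis" "HOL-Algebra.Coset"
begin

definition SL3 :: "(real^3^3) monoid" where
  "SL3 = \<lparr>carrier = {A. det A = 1}, mult = (**), one = mat 1\<rparr>"

lemma SL3_simps [simp]:
  "A \<in> carrier SL3 \<longleftrightarrow> det A = 1"
  "A \<otimes>\<^bsub>SL3\<^esub> B = A ** B"
  "\<one>\<^bsub>SL3\<^esub> = mat 1"
  by (simp_all add: SL3_def)

lemma det_matrix_inv_1:
  fixes A :: "real^'n^'n"
  assumes "det A = 1"
  shows "A ** matrix_inv A = mat 1" "matrix_inv A ** A = mat 1" "det (matrix_inv A) = 1"
proof -
  have "invertible A"
    using assms by (simp add: invertible_det_nz)
  then obtain B where "A ** B = mat 1 \<and> B ** A = mat 1"
    by (auto simp: invertible_def)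
  then have inv: "A ** matrix_inv A = mat 1 \<and> matrix_inv A ** A = mat 1"
    unfolding matrix_inv_def by (rule someI)
  then show "A ** matrix_inv A = mat 1" "matrix_inv A ** A = mat 1"
    by auto
  from inv have "det A * det (matrix_inv A) = 1"
    by (metis det_mul det_I)
  then show "det (matrix_inv A) = 1"
    using assms by simp
qed

lemma group_SL3: "group SL3"
proof (rule groupI)
  fix x assume "x \<in> carrier SL3"
  then show "\<exists>y\<in>carrier SL3. y \<otimes>\<^bsub>SL3\<^esub> x = \<one>\<^bsub>SL3\<^esub>"
    using det_matrix_inv_1[of x] by (intro bexI[of _ "matrix_inv x"]) auto
qed (simp_all add: det_mul matrix_mul_assoc)

lemma inv_SL3: "det A = 1 \<Longrightarrow> inv\<^bsub>SL3\<^esub> A = matrix_inv A"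
  using group.inv_equality[OF group_SL3, of "matrix_inv A" A] det_matrix_inv_1[of A] by simp

text \<open>The group PSL(3,R) is the quotient of SL(3,R) by its scalar matrices. The only real cube root
  of unity is 1, so the quotient map is an isomorphism; PSL(3,R) is represented by \<^const>\<open>SL3\<close>.\<close>

lemma scalars_SL3: "{A \<in> carrier SL3. \<exists>c. A = mat c} = {\<one>\<^bsub>SL3\<^esub>}"
proof -
  have "c = 1" if "det (mat c :: real^3^3) = 1" for c :: real
  proof -
    have "det (mat c :: real^3^3) = c ^ 3"
      by (simp add: det_3 mat_def power3_eq_cube)
    with that have "c ^ 3 = 1 ^ 3" by simp
    then show ?thesis
      using power_eq_iff_eq_base[of 3 c 1] odd_real_root_unique[of 3 c 1] by simp
  qed
  then show ?thesis by auto
qed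

lemma PSL3_iso_SL3: "SL3 Mod {A \<in> carrier SL3. \<exists>c. A = mat c} \<cong> SL3"
  unfolding scalars_SL3 is_iso_def
  using group.trivial_factor_iso[OF group_SL3] by blast


definition sym_matrices :: "(real^'n^'n) set" where
  "sym_matrices = {S. transpose S = S}"

definition proj_points :: "'a::real_vector set \<Rightarrow> 'a set set" where
  "proj_points V = {span {v} |v. v \<in> V \<and> v \<noteq> 0}"

text \<open>A symmetric matrix is read either as the Gram matrix of a quadratic form, an element of
  \<open>Sym\<^sup>2\<close> of the dual space, or as a symmetric tensor, an element of \<open>Sym\<^sup>2\<close> of the space itself.
  The first reading gives the action \<open>(g \<cdot> q)(x) = q(g\<^sup>-\<^sup>1 x)\<close>, the second the linear
  extension of \<open>g \<cdot> (v \<otimes> v) = gv \<otimes> gv\<close>. A real conic, possibly degenerate or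
  without real points, is a point of the projectivisation, i.e. a nonzero form up to a real scalar.\<close>

definition form_act :: "real^'n^'n \<Rightarrow> real^'n^'n \<Rightarrow> real^'n^'n" where
  "form_act g Q = transpose (matrix_inv g) ** Q ** matrix_inv g"

definition tensor_act :: "real^'n^'n \<Rightarrow> real^'n^'n \<Rightarrow> real^'n^'n" where
  "tensor_act g S = g ** S ** transpose g"

lemma form_act_quadratic_form:
  "x \<bullet> (form_act g Q *v x) = (matrix_inv g *v x) \<bullet> (Q *v (matrix_inv g *v x))"
  by (simp add: form_act_def inner_commute[of x] dot_lmul_matrix flip: matrix_vector_mul_assoc)
     (simp add: inner_commute)

definition fixes_conic :: "(real^3^3) set \<Rightarrow> bool" where
  "fixes_conic \<Delta> \<longleftrightarrow> (\<exists>p\<in>proj_points sym_matrices. \<forall>g\<in>\<Delta>. form_act g ` p = p)"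

definition fixes_dual_conic :: "(real^3^3) set \<Rightarrow> bool" where
  "fixes_dual_conic \<Delta> \<longleftrightarrow> (\<exists>p\<in>proj_points sym_matrices. \<forall>g\<in>\<Delta>. tensor_act g ` p = p)"

definition finite_index_subgroup :: "'a set \<Rightarrow> ('a, 'b) monoid_scheme \<Rightarrow> bool" where
  "finite_index_subgroup H G \<longleftrightarrow> subgroup H G \<and> finite (rcosets\<^bsub>G\<^esub> H)"

definition elementary :: "(real^3^3) set \<Rightarrow> bool" where
  "elementary \<Gamma> \<longleftrightarrow>
    (\<exists>\<Delta>. finite_index_subgroup \<Delta> (SL3\<lparr>carrier := \<Gamma>\<rparr>) \<and> (fixes_conic \<Delta> \<or> fixes_dual_conic \<Delta>))"

abbreviation non_elementary :: "(real^3^3) set \<Rightarrow> bool" where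
  "non_elementary \<Gamma> \<equiv> \<not> elementary \<Gamma>"


definition zero_locus :: "('a::euclidean_space \<Rightarrow> real) set \<Rightarrow> 'a set" where
  "zero_locus P = {x. \<forall>p\<in>P. p x = 0}"

definition zariski_topology :: "'a::euclidean_space topology" where
  "zariski_topology = topology (\<lambda>U. \<exists>P. (\<forall>p\<in>P. real_polynomial_function p) \<and> U = - zero_locus P)"

lemma openin_zariski:
  fixes U :: "'a::euclidean_space set"
  shows "openin zariski_topology U \<longleftrightarrow> (\<exists>P. (\<forall>p\<in>P. real_polynomial_function p) \<and> U = - zero_locus P)"
proof -
  let ?C = "\<lambda>P :: ('a \<Rightarrow> real) set. \<forall>p\<in>P. real_polynomial_function p"
  let ?T = "\<lambda>U. \<exists>P. ?C P \<and> U = - zero_locus P"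
  have "istopology ?T"
    unfolding istopology_def
  proof (intro conjI allI impI)
    fix S T assume "?T S" "?T T"
    then obtain P Q where PQ: "?C P" "S = - zero_locus P" "?C Q" "T = - zero_locus Q"
      by blast
    let ?R = "{\<lambda>x. p x * q x |p q. p \<in> P \<and> q \<in> Q}"
    have "?C ?R" using PQ by blast
    moreover have "S \<inter> T = - zero_locus ?R"
      unfolding PQ zero_locus_def by fastforce
    ultimately show "?T (S \<inter> T)" by blast
  next
    fix K assume "\<forall>S\<in>K. ?T S"
    then obtain F where F: "\<And>S. S \<in> K \<Longrightarrow> ?C (F S) \<and> S = - zero_locus (F S)"
      by metis
    have "\<Union>K = (\<Union>S\<in>K. - zero_locus (F S))"
      using F by auto
    also have "\<dots> = - zero_locus (\<Union>S\<in>K. F S)"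
      unfolding zero_locus_def by auto
    finally show "?T (\<Union>K)"
      using F by (intro exI[of _ "\<Union>S\<in>K. F S"]) blast
  qed
  then show ?thesis
    by (simp add: zariski_topology_def)
qed

lemma topspace_zariski [simp]: "topspace zariski_topology = UNIV"
proof -
  have "openin zariski_topology (UNIV :: 'a set)"
    unfolding openin_zariski
    by (rule exI[of _ "{\<lambda>x. 1}"]) (auto simp: zero_locus_def)
  then show ?thesis
    using openin_subset by blast
qed

definition zariski_dense_SL3 :: "(real^3^3) set \<Rightarrow> bool" where
  "zariski_dense_SL3 \<Gamma> \<longleftrightarrow>
    subtopology zariski_topology (carrier SL3) closure_of \<Gamma> = carrier SL3"

end

theory Submission
  imports Defs "HOL-Computational_Algebra.Polynomial"
begin

text \<open>A Zariski-dense \<open>\<Gamma>\<close> is non-elementary: the stabiliser of a conic is Zariski closed, so if a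
  finite-index subgroup fixed a conic, SL(3,R) would be a finite union of cosets of the stabiliser,
  and by pigeonhole the stabiliser would contain a nontrivial transvection in every root direction;
  no nonzero symmetric matrix is fixed by all of these.

  Conversely let \<open>\<Gamma>\<close> be non-elementary and let \<open>L\<close> be the tangent space at 1 of its Zariski closure, a
  Lie algebra normalised by \<open>\<Gamma>\<close>. A group all of whose traces are bounded is bounded or
  reducible, and a bounded group fixes a definite form; hence some \<open>g \<in> \<Gamma>\<close> has \<open>\<bar>tr g\<bar> > 3\<close>. A polynomial
  vanishing on all powers \<open>g\<^sup>n\<close> is an exponential polynomial in \<open>n\<close>, so it vanishes on the real powers
  of the modulus part of \<open>g\<close>, and the logarithm of that part is a nonscalar real diagonalisable element
  of \<open>L\<close>. A common eigenvector of \<open>L\<close> would give finitely many weight spaces permuted by \<open>\<Gamma>\<close>, so \<open>L\<close> acts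
  irreducibly on the space and on its dual. Decomposing \<open>L\<close> into weights, either \<open>L\<close> contains all matrix
  units off the diagonal, and the closure of \<open>\<Gamma>\<close> contains all transvections, or \<open>L\<close> is the orthogonal
  algebra of a unique conic, which \<open>\<Gamma>\<close> then fixes.\<close>

section \<open>The Lie algebra of the Zariski closure\<close>

text \<open>The obstacle is that \<Gamma> may be discrete, so that no tangent vector is visible in
  it: everything about L has to come from polynomial identities on \<Gamma>. Working with the ideal
  of polynomials vanishing on \<Gamma> replaces the theory of algebraic groups and the matrix
  exponential. The way back from L to the closure is taken only along E with E^2 = 0, where 1 + tE
  is polynomial in t.

  The bound 3 is the largest absolute trace of a matrix whose eigenvalues all have modulus 1. As the
  determinant is 1, a larger trace forces unequal moduli, which makes the logarithm nonscalar.

  If the traces stay within the bound but \<Gamma> is unbounded, a limit of normalised elements lies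
  in the radical of the trace form on the span of \<Gamma>. This radical consists of nilpotent
  matrices and yields an invariant subspace. An invariant line or plane is itself a degenerate
  conic, its square, which is why reducibility counts as elementary.

  Uniqueness of the conic preserved by L carries its invariance over to \<Gamma>, which normalises
  L.\<close>

lemma matrix_add_rdistrib: "((A::real^'n^'m) + B) ** C = A ** C + B ** (C::real^'k^'n)"
  by (simp add: matrix_matrix_mult_def vec_eq_iff distrib_right sum.distrib)

lemma matrix_diff_ldistrib: "(A::real^'n^'m) ** (B - C) = A ** B - A ** (C::real^'k^'n)"
  by (simp add: matrix_matrix_mult_def vec_eq_iff right_diff_distrib sum_subtractf)

lemma matrix_diff_rdistrib: "((A::real^'n^'m) - B) ** C = A ** C - B ** (C::real^'k^'n)"
  by (simp add: matrix_matrix_mult_def vec_eq_iff left_diff_distrib sum_subtractf)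

lemma matrix_mul_scaleR_left: "(c *\<^sub>R (A::real^'n^'m)) ** B = c *\<^sub>R (A ** (B::real^'k^'n))"
  by (simp add: matrix_matrix_mult_def vec_eq_iff sum_distrib_left mult.assoc)

lemma matrix_mul_scaleR_right: "(A::real^'n^'m) ** (c *\<^sub>R B) = c *\<^sub>R (A ** (B::real^'k^'n))"
  by (simp add: matrix_matrix_mult_def vec_eq_iff sum_distrib_left mult.left_commute)

lemma matrix_mul_zero_left [simp]: "(0::real^'n^'m) ** (A::real^'k^'n) = 0"
  by (simp add: matrix_matrix_mult_def vec_eq_iff)

lemma matrix_mul_zero_right [simp]: "(A::real^'n^'m) ** (0::real^'k^'n) = 0"
  by (simp add: matrix_matrix_mult_def vec_eq_iff)

lemmas matrix_distribs = matrix_add_ldistrib matrix_add_rdistrib matrix_diff_ldistrib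
  matrix_diff_rdistrib matrix_mul_scaleR_left matrix_mul_scaleR_right

lemma linear_matrix_mul_left: "linear (\<lambda>A::real^'k^'n. (B::real^'n^'m) ** A)"
  by (rule linearI) (simp_all add: matrix_distribs)

lemma linear_matrix_mul_right: "linear (\<lambda>A::real^'n^'m. A ** (B::real^'k^'n))"
  by (rule linearI) (simp_all add: matrix_distribs)

lemma bounded_linear_matrix_mul:
  "bounded_linear (\<lambda>A::real^'k^'n. (B::real^'n^'m) ** A)"
  "bounded_linear (\<lambda>A::real^'n^'m. A ** (C::real^'k^'n))"
  using linear_matrix_mul_left linear_matrix_mul_right linear_conv_bounded_linear by blast+

lemma real_polynomial_function_compose_linear:
  fixes h :: "'a::euclidean_space \<Rightarrow> 'b::euclidean_space"
  assumes "real_polynomial_function f" "bounded_linear h"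
  shows "real_polynomial_function (\<lambda>x. f (h x))"
  using assms(1)
proof induction
  case (linear f)
  then show ?case
    using bounded_linear_compose[OF linear assms(2)] by (intro real_polynomial_function.intros)
qed auto

text \<open>The derivation given by the left-invariant vector field of \<open>X\<close>, whose value
  at \<open>A\<close> is \<open>A ** X\<close>.\<close>

definition mat_deriv :: "real^'n^'n \<Rightarrow> (real^'n^'n \<Rightarrow> real) \<Rightarrow> real^'n^'n \<Rightarrow> real" where
  "mat_deriv X f A = frechet_derivative f (at A) (A ** X)"

lemma polynomial_has_derivative:
  "real_polynomial_function f \<Longrightarrow> (f has_derivative frechet_derivative f (at x)) (at x)"
  using differentiable_at_real_polynomial_function frechet_derivative_works by blast

lemma mat_deriv_linear: "bounded_linear f \<Longrightarrow> mat_deriv X f = (\<lambda>A. f (A ** X))"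
  unfolding mat_deriv_def
  by (rule ext) (metis bounded_linear_imp_has_derivative frechet_derivative_at)

lemma mat_deriv_const: "mat_deriv X (\<lambda>A. c) = (\<lambda>A. 0)"
  by (simp add: mat_deriv_def frechet_derivative_const fun_eq_iff)

lemma mat_deriv_add:
  assumes "real_polynomial_function f" "real_polynomial_function g"
  shows "mat_deriv X (\<lambda>A. f A + g A) = (\<lambda>A. mat_deriv X f A + mat_deriv X g A)"
proof
  fix A
  have "((\<lambda>A. f A + g A) has_derivative
      (\<lambda>V. frechet_derivative f (at A) V + frechet_derivative g (at A) V)) (at A)"
    by (intro has_derivative_add polynomial_has_derivative assms)
  from frechet_derivative_at[OF this, symmetric]
  show "mat_deriv X (\<lambda>A. f A + g A) A = mat_deriv X f A + mat_deriv X g A"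
    by (simp add: mat_deriv_def)
qed

lemma mat_deriv_mult:
  assumes "real_polynomial_function f" "real_polynomial_function g"
  shows "mat_deriv X (\<lambda>A. f A * g A) = (\<lambda>A. f A * mat_deriv X g A + mat_deriv X f A * g A)"
proof
  fix A
  have "((\<lambda>A. f A * g A) has_derivative
      (\<lambda>V. f A * frechet_derivative g (at A) V + frechet_derivative f (at A) V * g A)) (at A)"
    by (intro has_derivative_mult polynomial_has_derivative assms)
  from frechet_derivative_at[OF this, symmetric]
  show "mat_deriv X (\<lambda>A. f A * g A) A = f A * mat_deriv X g A + mat_deriv X f A * g A"
    by (simp add: mat_deriv_def)
qed

lemma polynomial_mat_deriv:
  "real_polynomial_function f \<Longrightarrow> real_polynomial_function (mat_deriv X f)"
proof (induction rule: real_polynomial_function.induct)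
  case (linear f)
  then show ?case
    using bounded_linear_compose[OF linear bounded_linear_matrix_mul(2)]
    by (auto simp: mat_deriv_linear intro: real_polynomial_function.intros)
qed (auto simp: mat_deriv_const mat_deriv_add mat_deriv_mult)

text \<open>Both sides are derivations in \<open>f\<close>, because the mixed first-order terms
  cancel on the right. So the calculation is reduced to linear \<open>f\<close>, where it is
  associativity of the matrix product.\<close>

lemma mat_deriv_commutator:
  assumes "real_polynomial_function f"
  shows "mat_deriv (X ** Y - Y ** X) f A = mat_deriv X (mat_deriv Y f) A - mat_deriv Y (mat_deriv X f) A"
  using assms
proof (induction arbitrary: A)
  case (linear f)
  have "bounded_linear (\<lambda>A. f (A ** Y))" "bounded_linear (\<lambda>A. f (A ** X))"
    using bounded_linear_compose[OF linear bounded_linear_matrix_mul(2)] by auto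
  then show ?case
    using linear
    by (simp add: mat_deriv_linear matrix_diff_ldistrib linear_simps matrix_mul_assoc)
next
  case (const c)
  then show ?case by (simp add: mat_deriv_const)
next
  case (add f g)
  then show ?case
    by (simp add: mat_deriv_add polynomial_mat_deriv)
next
  case (mult f g)
  then show ?case
    by (simp add: mat_deriv_add mat_deriv_mult polynomial_mat_deriv real_polynomial_function.intros
        mult.IH) (simp add: algebra_simps)
qed

definition vanishing_polynomials :: "(real^'n^'n) set \<Rightarrow> (real^'n^'n \<Rightarrow> real) set" where
  "vanishing_polynomials \<Gamma> = {f. real_polynomial_function f \<and> (\<forall>g\<in>\<Gamma>. f g = 0)}"

text \<open>Stated through the vanishing ideal of \<Gamma>, so that the closure and its smooth
  structure never have to be formed.\<close>

definition lie_algebra_of :: "(real^'n^'n) set \<Rightarrow> (real^'n^'n) set" where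
  "lie_algebra_of \<Gamma> = {X. \<forall>f\<in>vanishing_polynomials \<Gamma>. mat_deriv X f (mat 1) = 0}"

lemma mat_deriv_one: "mat_deriv X f (mat 1) = frechet_derivative f (at (mat 1)) X"
  by (simp add: mat_deriv_def)

lemma subspace_lie_algebra_of: "subspace (lie_algebra_of \<Gamma>)"
proof -
  have lin: "linear (frechet_derivative f (at (mat 1)))" if "f \<in> vanishing_polynomials \<Gamma>" for f
    using that linear_frechet_derivative differentiable_at_real_polynomial_function
    unfolding vanishing_polynomials_def by blast
  show ?thesis
    unfolding subspace_def lie_algebra_of_def mat_deriv_one
    using linear_0[OF lin] linear_add[OF lin] linear_cmul[OF lin] by auto
qed

lemma has_derivative_translate:
  assumes "real_polynomial_function f" "bounded_linear h"
  shows "frechet_derivative (\<lambda>A. f (h A)) (at A) V = frechet_derivative f (at (h A)) (h V)"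
proof -
  have "((\<lambda>A. f (h A)) has_derivative (\<lambda>V. frechet_derivative f (at (h A)) (h V))) (at A)"
    by (rule has_derivative_compose[OF bounded_linear_imp_has_derivative[OF assms(2)]
          polynomial_has_derivative[OF assms(1)]])
  then show ?thesis
    by (metis frechet_derivative_at)
qed

text \<open>Left translation by an element of \<Gamma> preserves the vanishing ideal, so tangency at
  1 spreads to tangency at every point of \<Gamma>. Hence elements of the Lie algebra act on the
  ideal and may be applied repeatedly.\<close>

lemma mat_deriv_vanishing:
  assumes mult: "\<And>g h. g \<in> \<Gamma> \<Longrightarrow> h \<in> \<Gamma> \<Longrightarrow> g ** h \<in> \<Gamma>"
    and X: "X \<in> lie_algebra_of \<Gamma>" and f: "f \<in> vanishing_polynomials \<Gamma>"
  shows "mat_deriv X f \<in> vanishing_polynomials \<Gamma>"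
proof -
  have pf: "real_polynomial_function f"
    using f by (simp add: vanishing_polynomials_def)
  have "mat_deriv X f g = 0" if "g \<in> \<Gamma>" for g
  proof -
    have "(\<lambda>A. f (g ** A)) \<in> vanishing_polynomials \<Gamma>"
      using f mult that real_polynomial_function_compose_linear[OF pf bounded_linear_matrix_mul(1)]
      by (auto simp: vanishing_polynomials_def)
    then have "mat_deriv X (\<lambda>A. f (g ** A)) (mat 1) = 0"
      using X by (auto simp: lie_algebra_of_def)
    then show ?thesis
      by (simp add: mat_deriv_def has_derivative_translate[OF pf bounded_linear_matrix_mul(1)])
  qed
  then show ?thesis
    using polynomial_mat_deriv[OF pf] by (simp add: vanishing_polynomials_def)
qed

lemma lie_algebra_of_commutator:
  assumes mult: "\<And>g h. g \<in> \<Gamma> \<Longrightarrow> h \<in> \<Gamma> \<Longrightarrow> g ** h \<in> \<Gamma>" and one: "mat 1 \<in> \<Gamma>"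
    and "X \<in> lie_algebra_of \<Gamma>" "Y \<in> lie_algebra_of \<Gamma>"
  shows "X ** Y - Y ** X \<in> lie_algebra_of \<Gamma>"
proof -
  have "mat_deriv (X ** Y - Y ** X) f (mat 1) = 0" if f: "f \<in> vanishing_polynomials \<Gamma>" for f
    using mat_deriv_vanishing[OF mult assms(3) mat_deriv_vanishing[OF mult assms(4) f]]
      mat_deriv_vanishing[OF mult assms(4) mat_deriv_vanishing[OF mult assms(3) f]] one f
    by (simp add: mat_deriv_commutator vanishing_polynomials_def)
  then show ?thesis
    by (simp add: lie_algebra_of_def)
qed

text \<open>Conjugation by an element of \<Gamma> is a linear substitution that preserves the
  vanishing ideal and fixes the point 1.\<close>

lemma lie_algebra_of_conjugate:
  assumes mult: "\<And>g h. g \<in> \<Gamma> \<Longrightarrow> h \<in> \<Gamma> \<Longrightarrow> g ** h \<in> \<Gamma>"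
    and "g \<in> \<Gamma>" "h \<in> \<Gamma>" "g ** h = mat 1" "X \<in> lie_algebra_of \<Gamma>"
  shows "g ** X ** h \<in> lie_algebra_of \<Gamma>"
proof -
  have "mat_deriv (g ** X ** h) f (mat 1) = 0" if f: "f \<in> vanishing_polynomials \<Gamma>" for f
  proof -
    have pf: "real_polynomial_function f"
      using f by (simp add: vanishing_polynomials_def)
    have bl: "bounded_linear (\<lambda>A. g ** A ** h)"
      using bounded_linear_compose[OF bounded_linear_matrix_mul(2) bounded_linear_matrix_mul(1)] .
    have "(\<lambda>A. f (g ** A ** h)) \<in> vanishing_polynomials \<Gamma>"
      using f assms real_polynomial_function_compose_linear[OF pf bl]
      by (auto simp: vanishing_polynomials_def)
    then have "mat_deriv X (\<lambda>A. f (g ** A ** h)) (mat 1) = 0"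
      using assms by (auto simp: lie_algebra_of_def)
    then show ?thesis
      by (simp add: mat_deriv_def has_derivative_translate[OF pf bl] assms)
  qed
  then show ?thesis
    by (simp add: lie_algebra_of_def)
qed

text \<open>Along the line \<open>A ** (mat 1 + t *\<^sub>R E)\<close> the function \<open>f\<close>
  is a polynomial p in t, and p' comes in the same way from \<open>mat_deriv E f\<close>, which is
  again in the ideal. Induction on the degree gives p' = 0, and p(0) = \<open>f A\<close> = 0. The
  point \<open>A\<close> is only assumed to be a zero of the ideal, so the step can be
  iterated.\<close>

lemma square_zero_in_lie_algebra_imp_unipotent_invariance:
  assumes mult: "\<And>g h. g \<in> \<Gamma> \<Longrightarrow> h \<in> \<Gamma> \<Longrightarrow> g ** h \<in> \<Gamma>"
    and E: "E \<in> lie_algebra_of \<Gamma>" "E ** E = 0"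
    and A: "\<And>f. f \<in> vanishing_polynomials \<Gamma> \<Longrightarrow> f A = 0"
    and f: "f \<in> vanishing_polynomials \<Gamma>"
  shows "f (A ** (mat 1 + t *\<^sub>R E)) = 0"
proof -
  have poly_zero: "p = 0" if "\<And>t. poly p t = f (A ** (mat 1 + t *\<^sub>R E))" "f \<in> vanishing_polynomials \<Gamma>"
    for p f
    using that
  proof (induction "degree p" arbitrary: p f rule: less_induct)
    case less
    have pf: "real_polynomial_function f"
      using less.prems by (simp add: vanishing_polynomials_def)
    have der: "((\<lambda>t. f (A ** (mat 1 + t *\<^sub>R E))) has_real_derivative
        mat_deriv E f (A ** (mat 1 + t *\<^sub>R E))) (at t)" for t
    proof -
      have "((\<lambda>t. A + t *\<^sub>R (A ** E)) has_derivative (\<lambda>s. s *\<^sub>R (A ** E))) (at t)"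
        by (auto intro!: derivative_eq_intros)
      then have path: "((\<lambda>t. A ** (mat 1 + t *\<^sub>R E)) has_derivative (\<lambda>s. s *\<^sub>R (A ** E))) (at t)"
        by (simp add: matrix_distribs)
      have lin: "linear (frechet_derivative f (at x))" for x
        using pf by (simp add: linear_frechet_derivative differentiable_at_real_polynomial_function)
      \<comment> \<open>Since E^2 = 0, the constant velocity \<open>A ** E\<close> of the path is
        the left-invariant vector field at the current point.\<close>
      have "A ** (mat 1 + t *\<^sub>R E) ** E = A ** E"
        by (simp add: matrix_distribs E flip: matrix_mul_assoc)
      then show ?thesis
        using has_derivative_compose[OF path polynomial_has_derivative[OF pf]]
        by (simp add: has_field_derivative_def mat_deriv_def linear_cmul[OF lin] mult.commute[of _ "frechet_derivative f (at x) y" for x y])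
    qed
    have "((\<lambda>t. f (A ** (mat 1 + t *\<^sub>R E))) has_real_derivative poly (pderiv p) t) (at t)" for t
      using poly_DERIV[of p t] less.prems(1) by simp
    then have eq: "poly (pderiv p) t = mat_deriv E f (A ** (mat 1 + t *\<^sub>R E))" for t
      using DERIV_unique der by blast
    have zero: "poly p 0 = 0"
      using less.prems A by simp
    show ?case
    proof (cases "degree p = 0")
      case True
      then show ?thesis
        using zero by (metis poly_pCons pCons_0_0 degree_eq_zeroE mult_zero_left add_0_right)
    next
      case False
      then have "pderiv p = 0"
        using less.hyps[of "pderiv p" "mat_deriv E f"] eq mat_deriv_vanishing[OF mult E(1) less.prems(2)]
        by (simp add: degree_pderiv)
      then show ?thesis
        using False by (simp add: pderiv_eq_0_iff)
    qed
  qed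
  have pf: "real_polynomial_function f"
    using f by (simp add: vanishing_polynomials_def)
  have "polynomial_function (\<lambda>t. A ** (mat 1 + t *\<^sub>R E))"
  proof -
    have "polynomial_function (\<lambda>t. A + t *\<^sub>R (A ** E))"
      by (intro polynomial_function_add polynomial_function_const polynomial_function_bounded_linear
          bounded_linear_scaleR_left)
    then show ?thesis by (simp add: matrix_distribs)
  qed
  from real_polynomial_function_compose[OF this pf]
  obtain a n where an: "(\<lambda>t. f (A ** (mat 1 + t *\<^sub>R E))) = (\<lambda>x. \<Sum>i\<le>n. a i * x^i)"
    unfolding real_polynomial_function_iff_sum o_def by blast
  define p where "p = (\<Sum>i\<le>n. monom (a i) i)"
  have "poly p t = f (A ** (mat 1 + t *\<^sub>R E))" for t
    using fun_cong[OF an, of t] by (simp add: p_def poly_sum poly_monom)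
  then show ?thesis
    using poly_zero f by (metis poly_0)
qed

section \<open>Generation of SL(3,R) by transvections\<close>

definition matrix_unit :: "'n \<Rightarrow> 'n \<Rightarrow> real^'n^'n" where
  "matrix_unit i j = (\<chi> a b. if a = i \<and> b = j then 1 else 0)"

lemma matrix_unit_mult_entry: "(matrix_unit i j ** A) $ a $ b = (if a = i then A $ j $ b else 0)"
  by (simp add: matrix_unit_def matrix_matrix_mult_def if_distrib if_distribR cong: if_cong)

lemma mult_matrix_unit_entry: "(A ** matrix_unit i j) $ a $ b = (if b = j then A $ a $ i else 0)"
  by (simp add: matrix_unit_def matrix_matrix_mult_def if_distrib if_distribR cong: if_cong)

lemma matrix_unit_mult: "matrix_unit i j ** matrix_unit k l = (if j = k then matrix_unit i l else 0)"
  by (simp add: vec_eq_iff matrix_unit_mult_entry) (simp add: matrix_unit_def)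

definition transvection :: "'n \<Rightarrow> 'n \<Rightarrow> real \<Rightarrow> real^'n^'n" where
  "transvection i j t = mat 1 + t *\<^sub>R matrix_unit i j"

lemma transvection_mult_entry:
  "(transvection i j t ** A) $ a $ b = A $ a $ b + (if a = i then t * A $ j $ b else 0)"
  by (simp add: transvection_def matrix_distribs matrix_unit_mult_entry)

lemma mult_transvection_entry:
  "(A ** transvection i j t) $ a $ b = A $ a $ b + (if b = j then t * A $ a $ i else 0)"
  by (simp add: transvection_def matrix_distribs mult_matrix_unit_entry)

lemma transvection_add:
  "i \<noteq> j \<Longrightarrow> transvection i j s ** transvection i j t = transvection i j (s + t)"
  by (simp add: transvection_def matrix_distribs matrix_unit_mult algebra_simps)

lemma transvection_0 [simp]: "transvection i j 0 = mat 1"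
  by (simp add: transvection_def)

lemma det_transvection: 
  fixes i :: 3
  shows "i \<noteq> j \<Longrightarrow> det (transvection i j t) = 1"
  using exhaust_3[of i] exhaust_3[of j]
  by (auto simp: det_3 transvection_def matrix_unit_def mat_def)

text \<open>Gaussian elimination run backwards: \<open>left\<close> and \<open>right\<close> reduce
  the claim for \<open>A\<close> to the claim for \<open>A\<close> times a transvection, whose
  inverse is a transvection too. First the entry (1,1) is made 1, then its row and column are
  cleared, then the remaining 2x2 block is treated.\<close>

lemma SL3_transvection_induct:
  fixes K :: "(real^3^3) set"
  assumes mult: "\<And>A B. A \<in> K \<Longrightarrow> B \<in> K \<Longrightarrow> A ** B \<in> K"
    and unip: "\<And>i j t. i \<noteq> j \<Longrightarrow> transvection i j t \<in> K"
    and "det A = 1"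
  shows "A \<in> K"
proof -
  have one: "mat 1 \<in> K"
    using unip[of 1 2 0] by simp
  have left: "A \<in> K" if "transvection i j t ** A \<in> K" "i \<noteq> j" for A i j t
    using mult[OF unip[OF that(2), of "-t"] that(1)] that(2)
    by (simp add: matrix_mul_assoc transvection_add)
  have right: "A \<in> K" if "A ** transvection i j t \<in> K" "i \<noteq> j" for A i j t
    using mult[OF that(1) unip[OF that(2), of "-t"]] that(2)
    by (simp add: transvection_add flip: matrix_mul_assoc)
  have det_left: "det (transvection i j t ** A) = det A" 
    and det_right: "det (A ** transvection i j t) = det A" if "i \<noteq> j" for A :: "real^3^3" and i j t
    using that by (simp_all add: det_mul det_transvection)
  note entries = transvection_mult_entry mult_transvection_entry
  have block1: "A \<in> K" if "A$1$1 = 1" "A$1$2 = 0" "A$1$3 = 0" "A$2$1 = 0" "A$3$1 = 0" "A$2$2 = 1" "det A = 1"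
    for A :: "real^3^3"
  proof -
    \<comment> \<open>Clearing the entry (2,3) turns the entry (3,3) into the determinant of the
      block, which is 1.\<close>
    have "transvection 3 2 (- A$3$2) ** (A ** transvection 2 3 (- A$2$3)) = mat 1"
      using that by (simp add: vec_eq_iff forall_3 entries mat_def det_3)
    with one have "transvection 3 2 (- A$3$2) ** (A ** transvection 2 3 (- A$2$3)) \<in> K"
      by simp
    from right[OF left[OF this]] show ?thesis
      by simp
  qed
  have block2: "A \<in> K" if "A$1$1 = 1" "A$1$2 = 0" "A$1$3 = 0" "A$2$1 = 0" "A$3$1 = 0" "A$2$3 \<noteq> 0" "det A = 1"
    for A :: "real^3^3"
    by (rule right[of _ 3 2 "(1 - A$2$2) / A$2$3"], rule block1) (use that in \<open>simp_all add: entries det_right\<close>)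
  have block: "A \<in> K" if "A$1$1 = 1" "A$1$2 = 0" "A$1$3 = 0" "A$2$1 = 0" "A$3$1 = 0" "det A = 1"
    for A :: "real^3^3"
  proof (cases "A$2$3 = 0")
    case True
    then have "A$2$2 \<noteq> 0"
      using that by (auto simp: det_3)
    show ?thesis
      by (rule right[of _ 2 3 1], rule block2)
         (use that True \<open>A$2$2 \<noteq> 0\<close> in \<open>simp_all add: entries det_right\<close>)
  qed (use that block2 in blast)
  have pivot: "A \<in> K" if "A$1$1 = 1" "det A = 1" for A :: "real^3^3"
    by (rule left[of 2 1 "- A$2$1"], rule left[of 3 1 "- A$3$1"],
        rule right[of _ 1 2 "- A$1$2"], rule right[of _ 1 3 "- A$1$3"], rule block)
       (use that in \<open>simp_all add: entries det_left det_right\<close>)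
  have second: "A \<in> K" if "A$2$1 \<noteq> 0" "det A = 1" for A :: "real^3^3"
    by (rule left[of 1 2 "(1 - A$1$1) / A$2$1"], rule pivot)
       (use that in \<open>simp_all add: entries det_left\<close>)
  have third: "A \<in> K" if "A$3$1 \<noteq> 0" "det A = 1" for A :: "real^3^3"
    by (rule left[of 1 3 "(1 - A$1$1) / A$3$1"], rule pivot)
       (use that in \<open>simp_all add: entries det_left\<close>)
  show ?thesis
  proof (cases "A$2$1 = 0 \<and> A$3$1 = 0")
    case True
    then have "A$1$1 \<noteq> 0"
      using \<open>det A = 1\<close> by (auto simp: det_3)
    show ?thesis
      by (rule left[of 2 1 1], rule second)
         (use True \<open>det A = 1\<close> \<open>A$1$1 \<noteq> 0\<close> in \<open>simp_all add: entries det_left\<close>)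
  next
    case False
    then show ?thesis
      using second third \<open>det A = 1\<close> by blast
  qed
qed

text \<open>The right multipliers that map the zero set \<open>Z\<close> into itself form a set
  \<open>K\<close> closed under products. It contains all transvections, hence all of SL(3,R), and
  \<open>mat 1\<close> lies in \<open>Z\<close>.\<close>

lemma vanishing_polynomials_SL3:
  fixes \<Gamma> :: "(real^3^3) set"
  assumes mult: "\<And>g h. g \<in> \<Gamma> \<Longrightarrow> h \<in> \<Gamma> \<Longrightarrow> g ** h \<in> \<Gamma>" and one: "mat 1 \<in> \<Gamma>"
    and units: "\<And>i j. i \<noteq> j \<Longrightarrow> matrix_unit i j \<in> lie_algebra_of \<Gamma>"
    and f: "f \<in> vanishing_polynomials \<Gamma>" and "det A = 1"
  shows "f A = 0"
proof -
  define Z where "Z = {A. \<forall>f\<in>vanishing_polynomials \<Gamma>. f A = 0}"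
  define K where "K = {B. \<forall>A\<in>Z. A ** B \<in> Z}"
  have "A ** B \<in> K" if "A \<in> K" "B \<in> K" for A B
    using that by (simp add: K_def matrix_mul_assoc)
  moreover have "transvection i j t \<in> K" if "i \<noteq> j" for i j t
    using square_zero_in_lie_algebra_imp_unipotent_invariance[OF mult units[OF that]] that
    by (auto simp: K_def Z_def transvection_def matrix_unit_mult)
  ultimately have "A \<in> K"
    using \<open>det A = 1\<close> by (rule SL3_transvection_induct)
  moreover have "mat 1 \<in> Z"
    using one by (simp add: Z_def vanishing_polynomials_def)
  ultimately have "A \<in> Z"
    unfolding K_def by force
  then show ?thesis
    using f by (simp add: Z_def)
qed

section \<open>Exponential polynomials\<close>

text \<open>If \<open>F n = \<nu>\<^sup>n p(n)\<close> then \<open>F (n + 1) - \<mu> F n = \<nu>\<^sup>n (twisted_shift \<mu> \<nu> p)(n)\<close>. For \<open>\<mu> = \<nu>\<close> this lowers the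
  degree, for \<open>\<mu> \<noteq> \<nu>\<close> it is injective on polynomials.\<close>

definition twisted_shift :: "'a::comm_ring_1 \<Rightarrow> 'a \<Rightarrow> 'a poly \<Rightarrow> 'a poly" where
  "twisted_shift \<mu> \<nu> p = smult \<nu> (p \<circ>\<^sub>p [:1, 1:]) - smult \<mu> p"

lemma degree_twisted_shift_le:
  fixes p :: "'a::idom poly"
  shows "degree (twisted_shift \<mu> \<nu> p) \<le> degree p"
  unfolding twisted_shift_def
  by (rule order_trans[OF degree_diff_le_max]) (simp add: degree_smult_le degree_pcompose order_trans[OF degree_smult_le])

lemma coeff_twisted_shift:
  fixes p :: "'a::idom poly"
  shows "coeff (twisted_shift \<mu> \<nu> p) (degree p) = (\<nu> - \<mu>) * lead_coeff p"
  using lead_coeff_comp[of "[:1, 1:] :: 'a poly" p]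
  by (simp add: twisted_shift_def degree_pcompose algebra_simps)

lemma twisted_shift_0 [simp]: "twisted_shift \<mu> \<nu> 0 = 0"
  by (simp add: twisted_shift_def)

lemma twisted_shift_eq_0_iff:
  fixes p :: "'a::idom poly"
  assumes "\<mu> \<noteq> \<nu>"
  shows "twisted_shift \<mu> \<nu> p = 0 \<longleftrightarrow> p = 0"
  using coeff_twisted_shift[of \<mu> \<nu> p] assms by auto

lemma twisted_shift_nilpotent:
  fixes p :: "'a::idom poly"
  shows "degree p < k \<Longrightarrow> (twisted_shift \<mu> \<mu> ^^ k) p = 0"
proof (induction k arbitrary: p)
  case (Suc k)
  have zero: "(twisted_shift \<mu> \<mu> ^^ j) 0 = 0" for j
    by (induction j) simp_all
  have "twisted_shift \<mu> \<mu> p = 0 \<or> degree (twisted_shift \<mu> \<mu> p) < degree p"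
    by (rule eq_zero_or_degree_less[OF degree_twisted_shift_le]) (simp add: coeff_twisted_shift)
  with Suc show ?case
    by (auto simp: funpow_Suc_right zero simp del: funpow.simps)
qed simp

text \<open>Annihilator method: applying the shift operator for \<mu>0 one time more than the degree
  of \<open>p \<mu>0\<close> removes that term, while on the other terms it is injective, so the
  induction hypothesis kills them. What remains is one polynomial vanishing at all natural
  numbers.\<close>

lemma exponential_polynomials_independent:
  fixes p :: "'a::field_char_0 \<Rightarrow> 'a poly"
  assumes "finite M" "0 \<notin> M" "\<And>n. (\<Sum>\<mu>\<in>M. \<mu> ^ n * poly (p \<mu>) (of_nat n)) = 0" "\<mu> \<in> M"
  shows "p \<mu> = 0"
  using assms
proof (induction M arbitrary: p \<mu>)
  case (insert \<mu>0 M)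
  define q where "q k \<nu> = (twisted_shift \<mu>0 \<nu> ^^ k) (p \<nu>)" for k \<nu>
  have q0: "(\<Sum>\<nu>\<in>insert \<mu>0 M. \<nu> ^ n * poly (q k \<nu>) (of_nat n)) = 0" for k n
  proof (induction k arbitrary: n)
    case 0
    then show ?case using insert.prems(2) by (simp add: q_def)
  next
    case (Suc k)
    have "\<nu> ^ n * poly (q (Suc k) \<nu>) (of_nat n) =
        \<nu> ^ Suc n * poly (q k \<nu>) (of_nat (Suc n)) - \<mu>0 * (\<nu> ^ n * poly (q k \<nu>) (of_nat n))" for \<nu>
      by (simp add: q_def twisted_shift_def poly_pcompose algebra_simps)
    then show ?case
      using Suc[of n] Suc[of "Suc n"]
      by (simp add: sum_subtractf flip: sum_distrib_left del: sum.insert power_Suc of_nat_Suc)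
  qed
  define k where "k = Suc (degree (p \<mu>0))"
  have "q k \<mu>0 = 0"
    unfolding q_def by (rule twisted_shift_nilpotent) (simp add: k_def)
  then have "(\<Sum>\<nu>\<in>M. \<nu> ^ n * poly (q k \<nu>) (of_nat n)) = 0" for n
    using q0[where k = k and n = n] insert.hyps by simp
  then have "q k \<nu> = 0" if "\<nu> \<in> M" for \<nu>
    using insert.IH[of "q k"] insert.prems(1) that by blast
  moreover have "p \<nu> = 0" if "q k \<nu> = 0" "\<nu> \<noteq> \<mu>0" for \<nu>
  proof -
    have "(twisted_shift \<mu>0 \<nu> ^^ j) r = 0 \<Longrightarrow> r = 0" for j r
      by (induction j) (use that(2) in \<open>simp_all add: twisted_shift_eq_0_iff\<close>)
    then show ?thesis
      using that(1) by (simp add: q_def)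
  qed
  ultimately have M: "p \<nu> = 0" if "\<nu> \<in> M" for \<nu>
    using that insert.hyps by metis
  then have "\<mu>0 ^ n * poly (p \<mu>0) (of_nat n) = 0" for n
    using insert.prems(2)[of n] insert.hyps by simp
  then have "poly (p \<mu>0) (of_nat n) = 0" for n
    using insert.prems(1) by simp
  then have "range of_nat \<subseteq> {x. poly (p \<mu>0) x = 0}"
    by auto
  moreover have "infinite (range (of_nat :: nat \<Rightarrow> 'a))"
    by (simp add: finite_image_iff inj_of_nat)
  ultimately have "p \<mu>0 = 0"
    using poly_roots_finite finite_subset by blast
  with M show ?case
    using insert.prems(3) by auto
qed simp

text \<open>The algebra generated by the functions \<open>(n,t) \<mapsto> n\<close> and \<open>(n,t) \<mapsto> \<mu>\<^sup>n \<bar>\<mu>\<bar>\<^sup>t\<close>: an element is determined by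
  its restriction to \<open>t = 0\<close>.\<close>

definition exp_poly :: "(nat \<Rightarrow> real \<Rightarrow> complex) \<Rightarrow> bool" where
  "exp_poly F \<longleftrightarrow> (\<exists>M p. finite M \<and> 0 \<notin> M \<and>
     (\<forall>n t. F n t = (\<Sum>\<mu>\<in>M. \<mu> ^ n * of_real (cmod \<mu> powr t) * poly (p \<mu>) (of_nat n))))"

lemma exp_poly_term:
  "\<mu> \<noteq> 0 \<Longrightarrow> exp_poly (\<lambda>n t. \<mu> ^ n * of_real (cmod \<mu> powr t) * poly q (of_nat n))"
  unfolding exp_poly_def by (intro exI[of _ "{\<mu>}"] exI[of _ "\<lambda>_. q"]) simp

lemma exp_poly_const: "exp_poly (\<lambda>n t. c)"
  using exp_poly_term[of 1 "[:c:]"] by simp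

lemma exp_poly_add:
  assumes "exp_poly F" "exp_poly G"
  shows "exp_poly (\<lambda>n t. F n t + G n t)"
proof -
  obtain M p where M: "finite M" "0 \<notin> M"
    and F: "\<And>n t. F n t = (\<Sum>\<mu>\<in>M. \<mu> ^ n * of_real (cmod \<mu> powr t) * poly (p \<mu>) (of_nat n))"
    using assms(1) unfolding exp_poly_def by blast
  obtain N q where N: "finite N" "0 \<notin> N"
    and G: "\<And>n t. G n t = (\<Sum>\<mu>\<in>N. \<mu> ^ n * of_real (cmod \<mu> powr t) * poly (q \<mu>) (of_nat n))"
    using assms(2) unfolding exp_poly_def by blast
  let ?p = "\<lambda>\<mu>. if \<mu> \<in> M then p \<mu> else 0" and ?q = "\<lambda>\<mu>. if \<mu> \<in> N then q \<mu> else 0"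
  have "F n t = (\<Sum>\<mu>\<in>M\<union>N. \<mu> ^ n * of_real (cmod \<mu> powr t) * poly (?p \<mu>) (of_nat n))" for n t
    unfolding F by (rule sum.mono_neutral_cong_left) (use M N in auto)
  moreover have "G n t = (\<Sum>\<mu>\<in>M\<union>N. \<mu> ^ n * of_real (cmod \<mu> powr t) * poly (?q \<mu>) (of_nat n))" for n t
    unfolding G by (rule sum.mono_neutral_cong_left) (use M N in auto)
  ultimately have "F n t + G n t =
      (\<Sum>\<mu>\<in>M\<union>N. \<mu> ^ n * of_real (cmod \<mu> powr t) * poly (?p \<mu> + ?q \<mu>) (of_nat n))" for n t
    by (simp only: poly_add distrib_left sum.distrib)
  then show ?thesis
    unfolding exp_poly_def using M N
    by (intro exI[of _ "M \<union> N"] exI[of _ "\<lambda>\<mu>. ?p \<mu> + ?q \<mu>"]) auto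
qed

lemma exp_poly_sum:
  "finite I \<Longrightarrow> (\<And>i. i \<in> I \<Longrightarrow> exp_poly (F i)) \<Longrightarrow> exp_poly (\<lambda>n t. \<Sum>i\<in>I. F i n t)"
  by (induction I rule: finite_induct) (simp_all add: exp_poly_const exp_poly_add)

text \<open>Works because the modulus is multiplicative. Different pairs may give the same frequency
  \<mu>\<nu>, so the product is assembled as a sum of single terms instead of being indexed by the
  set of products.\<close>

lemma exp_poly_mult:
  assumes "exp_poly F" "exp_poly G"
  shows "exp_poly (\<lambda>n t. F n t * G n t)"
proof -
  obtain M p where M: "finite M" "0 \<notin> M"
    and F: "\<And>n t. F n t = (\<Sum>\<mu>\<in>M. \<mu> ^ n * of_real (cmod \<mu> powr t) * poly (p \<mu>) (of_nat n))"
    using assms(1) unfolding exp_poly_def by blast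
  obtain N q where N: "finite N" "0 \<notin> N"
    and G: "\<And>n t. G n t = (\<Sum>\<mu>\<in>N. \<mu> ^ n * of_real (cmod \<mu> powr t) * poly (q \<mu>) (of_nat n))"
    using assms(2) unfolding exp_poly_def by blast
  have "F n t * G n t = (\<Sum>\<mu>\<in>M. \<Sum>\<nu>\<in>N. (\<mu> * \<nu>) ^ n * of_real (cmod (\<mu> * \<nu>) powr t) *
      poly (p \<mu> * q \<nu>) (of_nat n))" for n t
    unfolding F G sum_product
    by (intro sum.cong refl) (simp add: norm_mult powr_mult power_mult_distrib)
  moreover have "exp_poly (\<lambda>n t. \<Sum>\<mu>\<in>M. \<Sum>\<nu>\<in>N. (\<mu> * \<nu>) ^ n * of_real (cmod (\<mu> * \<nu>) powr t) *
      poly (p \<mu> * q \<nu>) (of_nat n))"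
    by (intro exp_poly_sum exp_poly_term M N) (use M N in auto)
  ultimately show ?thesis
    by (simp only: )
qed

lemma exp_poly_eq_0:
  assumes "exp_poly F" "\<And>n. F n 0 = 0"
  shows "F n t = 0"
proof -
  obtain M p where M: "finite M" "0 \<notin> M"
    and F: "\<And>n t. F n t = (\<Sum>\<mu>\<in>M. \<mu> ^ n * of_real (cmod \<mu> powr t) * poly (p \<mu>) (of_nat n))"
    using assms(1) unfolding exp_poly_def by blast
  \<comment> \<open>Here \<open>0 \<notin> M\<close> matters: \<open>0 powr 0\<close> is 0, whereas
    \<open>x powr 0\<close> is 1 for every other \<open>x\<close>.\<close>
  have "(\<Sum>\<mu>\<in>M. \<mu> ^ n * of_real (cmod \<mu> powr 0) * poly (p \<mu>) (of_nat n)) = (\<Sum>\<mu>\<in>M. \<mu> ^ n * poly (p \<mu>) (of_nat n))" for n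
    by (intro sum.cong refl) (use M in auto)
  then have "(\<Sum>\<mu>\<in>M. \<mu> ^ n * poly (p \<mu>) (of_nat n)) = 0" for n
    using assms(2)[of n] unfolding F by simp
  then have "p \<mu> = 0" if "\<mu> \<in> M" for \<mu>
    using exponential_polynomials_independent M that by blast
  then show ?thesis
    by (simp add: F)
qed

lemma exp_poly_polynomial_function:
  fixes G :: "nat \<Rightarrow> real \<Rightarrow> 'a::euclidean_space"
  assumes "real_polynomial_function f" "\<And>b. b \<in> Basis \<Longrightarrow> exp_poly (\<lambda>n t. of_real (G n t \<bullet> b))"
  shows "exp_poly (\<lambda>n t. of_real (f (G n t)))"
  using assms(1)
proof induction
  case (linear f)
  have eq: "of_real (f x) = (\<Sum>b\<in>Basis. of_real (x \<bullet> b) * (of_real (f b) :: complex))" for x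
  proof -
    have "f x = f (\<Sum>b\<in>Basis. (x \<bullet> b) *\<^sub>R b)"
      by (simp add: euclidean_representation)
    also have "\<dots> = (\<Sum>b\<in>Basis. (x \<bullet> b) * f b)"
      using bounded_linear.linear[OF linear] by (simp add: linear_sum linear_cmul)
    finally have "of_real (f x) = (of_real (\<Sum>b\<in>Basis. (x \<bullet> b) * f b) :: complex)"
      by (rule arg_cong)
    then show ?thesis
      by (simp only: of_real_sum of_real_mult)
  qed
  have "exp_poly (\<lambda>n t. \<Sum>b\<in>Basis. of_real (G n t \<bullet> b) * of_real (f b))"
    by (intro exp_poly_sum exp_poly_mult exp_poly_const assms finite_Basis)
  then show ?case
    by (simp only: flip: eq)
qed (simp_all add: exp_poly_const exp_poly_add exp_poly_mult)

text \<open>For \<open>f\<close> in the ideal, the function \<open>f (G n t)\<close> vanishes at t =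
  0 for all n, hence for all t. At n = 0 this says that the curve \<open>G 0\<close> stays in the
  zero set of the ideal. It starts at 1, so its velocity is tangent there.\<close>

lemma exp_poly_in_lie_algebra:
  fixes G :: "nat \<Rightarrow> real \<Rightarrow> real^'n^'n"
  assumes "\<And>i j. exp_poly (\<lambda>n t. of_real (G n t $ i $ j))"
    and "\<And>n. G n 0 \<in> \<Gamma>" and "G 0 0 = mat 1"
    and der: "(G 0 has_vector_derivative H) (at 0)"
  shows "H \<in> lie_algebra_of \<Gamma>"
proof -
  have "mat_deriv H f (mat 1) = 0" if f: "f \<in> vanishing_polynomials \<Gamma>" for f
  proof -
    have pf: "real_polynomial_function f"
      using f by (simp add: vanishing_polynomials_def)
    have "exp_poly (\<lambda>n t. of_real (G n t \<bullet> b))" if "b \<in> Basis" for b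
      using that assms(1) by (auto simp: Basis_vec_def inner_axis)
    then have ep: "exp_poly (\<lambda>n t. of_real (f (G n t)))"
      by (rule exp_poly_polynomial_function[OF pf])
    have "of_real (f (G n 0)) = (0::complex)" for n
      using f assms(2) by (simp add: vanishing_polynomials_def)
    from exp_poly_eq_0[OF ep this, of 0] have "(\<lambda>t. f (G 0 t)) = (\<lambda>t. 0)"
      by (simp add: fun_eq_iff)
    then have zero: "((\<lambda>t. f (G 0 t)) has_derivative (\<lambda>s. 0)) (at 0)"
      by simp
    have "((\<lambda>t. f (G 0 t)) has_derivative (\<lambda>s. frechet_derivative f (at (G 0 0)) (s *\<^sub>R H))) (at 0)"
      by (rule has_derivative_compose[OF der[unfolded has_vector_derivative_def]
            polynomial_has_derivative[OF pf]])
    from fun_cong[OF has_derivative_unique[OF this zero], of 1] show ?thesis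
      by (simp add: mat_deriv_one assms(3))
  qed
  then show ?thesis
    by (simp add: lie_algebra_of_def)
qed

section \<open>Hyperbolic elements\<close>

definition mat3 :: "real \<Rightarrow> real \<Rightarrow> real \<Rightarrow> real \<Rightarrow> real \<Rightarrow> real \<Rightarrow> real \<Rightarrow> real \<Rightarrow> real \<Rightarrow> real^3^3" where
  "mat3 a b c d e f g h i = vector [vector [a, b, c], vector [d, e, f], vector [g, h, i]]"

lemma mat3_entries [simp]:
  "mat3 a b c d e f g h i $ 1 $ 1 = a" "mat3 a b c d e f g h i $ 1 $ 2 = b" "mat3 a b c d e f g h i $ 1 $ 3 = c"
  "mat3 a b c d e f g h i $ 2 $ 1 = d" "mat3 a b c d e f g h i $ 2 $ 2 = e" "mat3 a b c d e f g h i $ 2 $ 3 = f"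
  "mat3 a b c d e f g h i $ 3 $ 1 = g" "mat3 a b c d e f g h i $ 3 $ 2 = h" "mat3 a b c d e f g h i $ 3 $ 3 = i"
  by (simp_all add: mat3_def)

lemma mat3_eqI:
  fixes A B :: "real^3^3"
  assumes "A$1$1 = B$1$1" "A$1$2 = B$1$2" "A$1$3 = B$1$3" "A$2$1 = B$2$1" "A$2$2 = B$2$2" "A$2$3 = B$2$3"
    "A$3$1 = B$3$1" "A$3$2 = B$3$2" "A$3$3 = B$3$3"
  shows "A = B"
  using assms by (simp add: vec_eq_iff forall_3)

lemma matrix_mult_entry_3: "((A::real^3^3) ** B) $ i $ j = A$i$1 * B$1$j + A$i$2 * B$2$j + A$i$3 * B$3$j"
  by (simp add: matrix_matrix_mult_def sum_3)

lemma mat_entry: "mat k $ i $ j = (if i = j then k else 0)"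
  by (simp add: mat_def)

lemma transpose_entry: "transpose A $ i $ j = A $ j $ i"
  by (simp add: transpose_def)

lemmas entries_3 = matrix_mult_entry_3 mat_entry transpose_entry

abbreviation diag3 :: "real \<Rightarrow> real \<Rightarrow> real \<Rightarrow> real^3^3" where
  "diag3 a b c \<equiv> mat3 a 0 0 0 b 0 0 0 c"

text \<open>Both characteristic roots have the same modulus \<rho>, so the single factor
  \<open>\<rho> powr t\<close> is the right modulus factor for each term of the explicit solution. A
  double root contributes a term linear in n.\<close>

lemma exp_poly_recurrence:
  fixes x :: "nat \<Rightarrow> complex"
  assumes rec: "\<And>n. x (Suc (Suc n)) = (\<beta>1 + \<beta>2) * x (Suc n) - \<beta>1 * \<beta>2 * x n"
    and norm: "cmod \<beta>1 = \<rho>" "cmod \<beta>2 = \<rho>" "\<rho> > 0"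
  shows "exp_poly (\<lambda>n t. x n * of_real (\<rho> powr t))"
proof (cases "\<beta>1 = \<beta>2")
  case False
  define c1 c2 where "c1 = (x 1 - \<beta>2 * x 0) / (\<beta>1 - \<beta>2)" and "c2 = (\<beta>1 * x 0 - x 1) / (\<beta>1 - \<beta>2)"
  have x0: "x 0 = c1 + c2" and x1: "x 1 = \<beta>1 * c1 + \<beta>2 * c2"
  proof -
    have "(\<beta>1 - \<beta>2) * c1 = x 1 - \<beta>2 * x 0" "(\<beta>1 - \<beta>2) * c2 = \<beta>1 * x 0 - x 1"
      using False by (simp_all add: c1_def c2_def)
    then have "(\<beta>1 - \<beta>2) * x 0 = (\<beta>1 - \<beta>2) * (c1 + c2)" "(\<beta>1 - \<beta>2) * x 1 = (\<beta>1 - \<beta>2) * (\<beta>1 * c1 + \<beta>2 * c2)"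
      by algebra+
    then show "x 0 = c1 + c2" "x 1 = \<beta>1 * c1 + \<beta>2 * c2"
      using False by simp_all
  qed
  have "x n = c1 * \<beta>1 ^ n + c2 * \<beta>2 ^ n \<and> x (Suc n) = c1 * \<beta>1 ^ Suc n + c2 * \<beta>2 ^ Suc n" for n
    by (induction n) (use x0 x1 in \<open>simp_all add: rec algebra_simps\<close>)
  then have "(\<lambda>n t. x n * of_real (\<rho> powr t)) = (\<lambda>n t. \<beta>1 ^ n * of_real (cmod \<beta>1 powr t) * poly [:c1:] (of_nat n)
      + \<beta>2 ^ n * of_real (cmod \<beta>2 powr t) * poly [:c2:] (of_nat n))"
    by (simp add: norm algebra_simps)
  moreover have "\<beta>1 \<noteq> 0" "\<beta>2 \<noteq> 0"
    using norm by auto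
  ultimately show ?thesis
    by (simp only: exp_poly_add exp_poly_term not_False_eq_True)
next
  case True
  define c where "c = x 1 / \<beta>1 - x 0"
  have "\<beta>1 \<noteq> 0"
    using norm by auto
  then have x1: "x 1 = \<beta>1 * (x 0 + c)"
    by (simp add: c_def)
  have "x n = \<beta>1 ^ n * (x 0 + of_nat n * c) \<and> x (Suc n) = \<beta>1 ^ Suc n * (x 0 + of_nat (Suc n) * c)" for n
    by (induction n) (use x1 in \<open>simp_all add: rec True[symmetric] algebra_simps\<close>)
  then have eq: "x n = \<beta>1 ^ n * (x 0 + of_nat n * c)" for n
    by blast
  have "x n * of_real (\<rho> powr t) = \<beta>1 ^ n * of_real (cmod \<beta>1 powr t) * poly [:x 0, c:] (of_nat n)" for n t
    by (subst eq) (simp add: norm)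
  then show ?thesis
    using exp_poly_term[OF \<open>\<beta>1 \<noteq> 0\<close>] by presburger
qed

lemma exp_poly_real_power:
  "a \<noteq> 0 \<Longrightarrow> exp_poly (\<lambda>n t. of_real (a ^ n * \<bar>a\<bar> powr t))"
  using exp_poly_term[of "of_real a" "[:1:]"] by simp

lemma exp_poly_conjugate:
  fixes K :: "nat \<Rightarrow> real \<Rightarrow> real^'n^'n"
  assumes "\<And>i j. exp_poly (\<lambda>n t. of_real (K n t $ i $ j))"
  shows "exp_poly (\<lambda>n t. of_real ((P ** K n t ** Q) $ i $ j))"
proof -
  have "exp_poly (\<lambda>n t. \<Sum>l\<in>UNIV. (\<Sum>k\<in>UNIV. of_real (P$i$k) * of_real (K n t $ k $ l)) * of_real (Q$l$j))"
    by (intro exp_poly_sum exp_poly_mult exp_poly_const assms finite)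
  then show ?thesis
    by (simp add: matrix_matrix_mult_def)
qed

text \<open>\<open>K n 0\<close> will be the n-th power of a matrix in normal form, and
  \<open>K 0 t\<close> the t-th power of its modulus part, whose derivative at t = 0 is the
  logarithm.\<close>

lemma log_in_lie_algebra:
  fixes K :: "nat \<Rightarrow> real \<Rightarrow> real^3^3"
  assumes "\<And>i j. exp_poly (\<lambda>n t. of_real (K n t $ i $ j))"
    and "\<And>n. P ** K n 0 ** Q \<in> \<Gamma>" and "P ** Q = mat 1"
    and K0: "\<And>t. K 0 t = diag3 (x powr t) (y powr t) (z powr t)" and pos: "x > 0" "y > 0" "z > 0"
  shows "P ** diag3 (ln x) (ln y) (ln z) ** Q \<in> lie_algebra_of \<Gamma>"
proof (rule exp_poly_in_lie_algebra[where G = "\<lambda>n t. P ** K n t ** Q"])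
  have diag: "diag3 a b c = a *\<^sub>R matrix_unit 1 1 + b *\<^sub>R matrix_unit 2 2 + c *\<^sub>R matrix_unit 3 3" for a b c
    by (rule mat3_eqI) (simp_all add: matrix_unit_def)
  show "P ** K 0 0 ** Q = mat 1"
  proof -
    have "K 0 0 = mat 1"
      using pos unfolding K0 by (intro mat3_eqI) (simp_all add: mat_entry)
    then show ?thesis
      using assms(3) by simp
  qed
  have powr: "((\<lambda>t. w powr t) has_real_derivative ln w) (at 0)" if "w > 0" for w
    by (rule derivative_eq_intros refl | use that in simp)+
  have "((\<lambda>t. K 0 t) has_vector_derivative diag3 (ln x) (ln y) (ln z)) (at 0)"
    unfolding K0 diag by (rule derivative_eq_intros powr pos refl | simp)+
  moreover have "bounded_linear (\<lambda>A. P ** A ** Q)"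
    using bounded_linear_compose[OF bounded_linear_matrix_mul(2) bounded_linear_matrix_mul(1)] .
  ultimately show "((\<lambda>t. P ** K 0 t ** Q) has_vector_derivative P ** diag3 (ln x) (ln y) (ln z) ** Q) (at 0)"
    by (rule bounded_linear.has_vector_derivative[rotated])
qed (use assms(2) exp_poly_conjugate[OF assms(1)] in auto)

definition matpow :: "real^'n^'n \<Rightarrow> nat \<Rightarrow> real^'n^'n" where
  "matpow A n = (((**) A) ^^ n) (mat 1)"

lemma matpow_0 [simp]: "matpow A 0 = mat 1" and matpow_Suc [simp]: "matpow A (Suc n) = A ** matpow A n"
  by (simp_all add: matpow_def)

lemma matpow_conjugate:
  assumes "P ** Q = mat 1" "A ** P = P ** B"
  shows "matpow A n = P ** matpow B n ** Q"
proof (induction n)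
  case (Suc n)
  then show ?case
    using assms by (simp add: matrix_mul_assoc)
qed (use assms in simp)

text \<open>The case where the 2x2 block has complex conjugate or coinciding eigenvalues. Both have
  modulus \<rho>, so the modulus part is diagonal with entries \<bar>e\<bar>, \<rho>, \<rho>, even
  if the block itself is not diagonalisable.\<close>

lemma block_log_in_lie_algebra:
  assumes PQ: "P ** Q = mat 1" and pow: "\<And>n. P ** matpow M n ** Q \<in> \<Gamma>"
    and M: "M = mat3 e 0 0 0 a b 0 c d" and det: "e * (a * d - b * c) = 1"
    and disc: "(a + d)\<^sup>2 \<le> 4 * (a * d - b * c)" and tr: "\<bar>e + a + d\<bar> > 3"
  shows "\<exists>x y. x \<noteq> y \<and> P ** diag3 x y y ** Q \<in> lie_algebra_of \<Gamma>"
proof -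
  define \<delta> \<tau> \<rho> where "\<delta> = a * d - b * c" and "\<tau> = a + d" and "\<rho> = sqrt \<delta>"
  have "e \<noteq> 0" "\<delta> \<noteq> 0"
    using det by (auto simp: \<delta>_def)
  moreover have "\<delta> \<ge> 0"
    using order_trans[OF zero_le_power2 disc] by (simp add: \<delta>_def)
  ultimately have "\<delta> > 0" and \<rho>: "\<rho> > 0" "\<rho>\<^sup>2 = \<delta>"
    by (simp_all add: \<rho>_def)
  define \<beta>1 \<beta>2 where "\<beta>1 = Complex (\<tau> / 2) (sqrt (4 * \<delta> - \<tau>\<^sup>2) / 2)"
    and "\<beta>2 = Complex (\<tau> / 2) (- sqrt (4 * \<delta> - \<tau>\<^sup>2) / 2)"
  have disc': "4 * \<delta> - \<tau>\<^sup>2 \<ge> 0"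
    using disc by (simp add: \<delta>_def \<tau>_def)
  have sum: "\<beta>1 + \<beta>2 = of_real \<tau>" and prod: "\<beta>1 * \<beta>2 = of_real \<delta>"
    using disc' by (simp_all add: \<beta>1_def \<beta>2_def complex_eq_iff power2_eq_square field_simps)
  have norm: "cmod \<beta>1 = \<rho>" "cmod \<beta>2 = \<rho>"
    using disc' by (simp_all add: \<beta>1_def \<beta>2_def cmod_def \<rho>_def power_divide field_simps)
  have exp: "exp_poly (\<lambda>n t. of_real (x n * \<rho> powr t))"
    if "\<And>n. x (Suc (Suc n)) = \<tau> * x (Suc n) - \<delta> * x n" for x :: "nat \<Rightarrow> real"
  proof -
    have "complex_of_real (x (Suc (Suc n))) = (\<beta>1 + \<beta>2) * of_real (x (Suc n)) - \<beta>1 * \<beta>2 * of_real (x n)" for n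
      unfolding sum prod that by simp
    from exp_poly_recurrence[of "\<lambda>n. of_real (x n)", OF this norm \<rho>(1)] show ?thesis
      by simp
  qed
  have M11: "matpow M n $ 1 $ 1 = e ^ n \<and> matpow M n $ 1 $ 2 = 0 \<and> matpow M n $ 1 $ 3 = 0 \<and>
      matpow M n $ 2 $ 1 = 0 \<and> matpow M n $ 3 $ 1 = 0" for n
    by (induction n) (simp_all add: matrix_mult_entry_3 mat_entry M)
  define K where "K n t = mat3 (e ^ n * \<bar>e\<bar> powr t) 0 0
      0 (matpow M n $ 2 $ 2 * \<rho> powr t) (matpow M n $ 2 $ 3 * \<rho> powr t)
      0 (matpow M n $ 3 $ 2 * \<rho> powr t) (matpow M n $ 3 $ 3 * \<rho> powr t)" for n t
  have "P ** diag3 (ln \<bar>e\<bar>) (ln \<rho>) (ln \<rho>) ** Q \<in> lie_algebra_of \<Gamma>"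
  proof (rule log_in_lie_algebra[where K = K])
    \<comment> \<open>By Cayley-Hamilton for the block, the entries of its powers satisfy the
      recurrence with coefficients \<tau> and -\<delta>.\<close>
    have rec: "exp_poly (\<lambda>n t. of_real (matpow M n $ i $ j * \<rho> powr t))" if "i \<noteq> 1" "j \<noteq> 1" for i j
      by (rule exp) (use that exhaust_3[of i] exhaust_3[of j] in
          \<open>auto simp: matrix_mult_entry_3 M \<tau>_def \<delta>_def algebra_simps\<close>)
    show "exp_poly (\<lambda>n t. of_real (K n t $ i $ j))" for i j
      using exhaust_3[of i] exhaust_3[of j] rec[of 2 2] rec[of 2 3] rec[of 3 2] rec[of 3 3]
        exp_poly_real_power[OF \<open>e \<noteq> 0\<close>] exp_poly_const[of 0]
      by (auto simp: K_def)
    have "K n 0 = matpow M n" for n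
      using M11[of n] \<open>e \<noteq> 0\<close> \<rho> by (intro mat3_eqI) (simp_all add: K_def)
    then show "P ** K n 0 ** Q \<in> \<Gamma>" for n
      using pow by simp
    show "K 0 t = diag3 (\<bar>e\<bar> powr t) (\<rho> powr t) (\<rho> powr t)" for t
      by (simp add: K_def mat_entry)
  qed (use PQ \<rho> \<open>e \<noteq> 0\<close> in auto)
  \<comment> \<open>Equal moduli with product 1 would all be 1, and the trace would be at most 3 in
    absolute value.\<close>
  moreover have "ln \<bar>e\<bar> \<noteq> ln \<rho>"
  proof
    assume "ln \<bar>e\<bar> = ln \<rho>"
    then have eq: "\<bar>e\<bar> = \<rho>"
      using \<rho> \<open>e \<noteq> 0\<close> by simp
    have "\<bar>e\<bar> * \<delta> = 1"
      using det \<open>\<delta> > 0\<close> unfolding \<delta>_def by (metis abs_mult abs_1 abs_of_pos)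
    then have "\<rho> ^ 3 = 1 ^ 3"
      using eq \<rho>(2) by (simp add: power3_eq_cube power2_eq_square mult.commute)
    then have one: "\<rho> = 1"
      by (rule power_eq_imp_eq_base) (use \<rho> in auto)
    then have "\<tau>\<^sup>2 \<le> 2\<^sup>2"
      using \<rho> disc' by simp
    then have "\<bar>\<tau>\<bar> \<le> 2"
      using abs_le_square_iff[of \<tau> 2] by simp
    then show False
      using tr eq one by (simp add: \<tau>_def)
  qed
  ultimately show ?thesis
    by blast
qed

text \<open>Eigenvalues may be negative: their signs stay in the integer powers, and only the moduli
  receive the real exponent t.\<close>

lemma diagonal_log_in_lie_algebra:
  assumes PQ: "P ** Q = mat 1" and pow: "\<And>n. P ** matpow (diag3 x y z) n ** Q \<in> \<Gamma>"
    and nz: "x \<noteq> 0" "y \<noteq> 0" "z \<noteq> 0"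
  shows "P ** diag3 (ln \<bar>x\<bar>) (ln \<bar>y\<bar>) (ln \<bar>z\<bar>) ** Q \<in> lie_algebra_of \<Gamma>"
proof -
  define K where "K n t = diag3 (x ^ n * \<bar>x\<bar> powr t) (y ^ n * \<bar>y\<bar> powr t) (z ^ n * \<bar>z\<bar> powr t)" for n t
  have pow_diag: "matpow (diag3 x y z) n = diag3 (x ^ n) (y ^ n) (z ^ n)" for n
    by (induction n) (auto intro!: mat3_eqI simp: matrix_mult_entry_3 mat_entry)
  show ?thesis
  proof (rule log_in_lie_algebra[where K = K])
    show "exp_poly (\<lambda>n t. of_real (K n t $ i $ j))" for i j
      using exhaust_3[of i] exhaust_3[of j] exp_poly_real_power nz exp_poly_const[of 0]
      by (auto simp: K_def)
    show "P ** K n 0 ** Q \<in> \<Gamma>" for n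
      using pow[of n] nz by (simp add: K_def pow_diag)
    show "K 0 t = diag3 (\<bar>x\<bar> powr t) (\<bar>y\<bar> powr t) (\<bar>z\<bar> powr t)" for t
      by (simp add: K_def)
  qed (use PQ nz in auto)
qed

section \<open>Splitting off a simple real eigenvalue\<close>

definition principal_minors :: "real^3^3 \<Rightarrow> real" where
  "principal_minors A = A$1$1 * A$2$2 - A$1$2 * A$2$1 + A$1$1 * A$3$3 - A$1$3 * A$3$1
     + A$2$2 * A$3$3 - A$2$3 * A$3$2"

lemma trace_3: "trace (A::real^3^3) = A$1$1 + A$2$2 + A$3$3"
  by (simp add: trace_def sum_3)

lemma charpoly_3:
  fixes A :: "real^3^3"
  shows "det (x *\<^sub>R mat 1 - A) = x ^ 3 - trace A * x\<^sup>2 + principal_minors A * x - det A"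
  by (simp add: det_3 trace_3 mat_def principal_minors_def power2_eq_square power3_eq_cube algebra_simps)

text \<open>An odd-degree polynomial has a real root e. If e is not simple, then e, e, b with b = t
  - 2e are the roots, and b is simple unless b = e. In that case e^3 = 1, so e = 1 and t = 3, which
  the bound on t excludes. Simplicity is expressed by the derivative.\<close>

lemma cubic_simple_root:
  fixes t s :: real
  assumes "\<bar>t\<bar> > 3"
  obtains x where "x ^ 3 - t * x\<^sup>2 + s * x - 1 = 0" "3 * x\<^sup>2 - 2 * t * x + s \<noteq> 0"
proof -
  let ?f = "\<lambda>x. x ^ 3 - t * x\<^sup>2 + s * x - 1"
  \<comment> \<open>Chosen so that the leading term dominates at \<open>B\<close>: B^3 is exactly
    B^2 + \<bar>t\<bar> B^2 + \<bar>s\<bar> B^2.\<close>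
  define B where "B = 1 + \<bar>t\<bar> + \<bar>s\<bar>"
  have "B \<ge> 1"
    by (simp add: B_def)
  have "t * B\<^sup>2 \<le> \<bar>t\<bar> * B\<^sup>2"
    by (intro mult_right_mono) auto
  moreover have "- s * B \<le> \<bar>s\<bar> * B\<^sup>2"
    using \<open>B \<ge> 1\<close> by (intro mult_mono) (auto simp: power2_eq_square)
  moreover have "B ^ 3 = B\<^sup>2 + \<bar>t\<bar> * B\<^sup>2 + \<bar>s\<bar> * B\<^sup>2"
    by (simp add: B_def power2_eq_square power3_eq_cube algebra_simps)
  moreover have "B\<^sup>2 \<ge> 1"
    using \<open>B \<ge> 1\<close> by simp
  ultimately have "?f B \<ge> 0"
    by linarith
  moreover have "continuous_on {0..B} ?f"
    by (intro continuous_intros)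
  ultimately obtain e where e: "?f e = 0"
    using IVT'[of ?f 0 0 B] \<open>B \<ge> 1\<close> by auto
  show thesis
  proof (cases "3 * e\<^sup>2 - 2 * t * e + s = 0")
    case False
    with e that show thesis by blast
  next
    case True
    define b where "b = t - 2 * e"
    have t: "t = b + 2 * e" and s: "s = e\<^sup>2 + 2 * e * b"
      using True by (simp_all add: b_def power2_eq_square algebra_simps)
    have eb: "e\<^sup>2 * b = 1"
      using e unfolding t s by algebra
    have "?f b = 0"
      using eb unfolding t s by algebra
    moreover have "3 * b\<^sup>2 - 2 * t * b + s = (b - e)\<^sup>2"
      unfolding t s by algebra
    moreover have "b \<noteq> e"
    proof
      assume "b = e"
      then have "e ^ 3 = 1"
        using eb by (simp add: power2_eq_square power3_eq_cube)
      then have "e = 1"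
        using odd_real_root_unique[of 3 e 1] by simp
      then show False
        using assms t \<open>b = e\<close> by simp
    qed
    ultimately show thesis
      using that[of b] by simp
  qed
qed

lemma det_0_imp_kernel:
  fixes A :: "real^'n^'n"
  assumes "det A = 0"
  shows "\<exists>v. v \<noteq> 0 \<and> A *v v = 0"
proof -
  have "rank A \<noteq> CARD('n)"
    using assms det_eq_0_rank[of A] by simp
  then show ?thesis
    by (simp add: matrix_nonfull_linear_equations_eq)
qed

text \<open>Simplicity of the eigenvalue e makes its eigenline a direct summand. In a basis starting
  with the eigenvector the matrix is block triangular, and the derivative of the characteristic
  polynomial at e is the characteristic polynomial \<Delta> of the 2x2 block at e. Since \<Delta> is
  nonzero, a shear removes the remaining entries of the first row.\<close>

lemma block_diagonalization:
  fixes g :: "real^3^3"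
  assumes "det g = 1" "\<bar>trace g\<bar> > 3"
  obtains P Q e a b c d where "P ** Q = mat 1" "Q ** P = mat 1" "g ** P = P ** mat3 e 0 0 0 a b 0 c d"
    "e * (a * d - b * c) = 1" "e + a + d = trace g" "(a - e) * (d - e) - b * c \<noteq> 0"
proof -
  obtain e where e: "e ^ 3 - trace g * e\<^sup>2 + principal_minors g * e - 1 = 0"
    and simple: "3 * e\<^sup>2 - 2 * trace g * e + principal_minors g \<noteq> 0"
    using cubic_simple_root assms(2) by blast
  have "det (e *\<^sub>R mat 1 - g) = 0"
    using e by (simp add: charpoly_3 assms)
  then obtain w where w: "w \<noteq> 0" "(e *\<^sub>R mat 1 - g) *v w = 0"
    using det_0_imp_kernel by blast
  define v where "v = w /\<^sub>R norm w"
  have v: "norm v = 1" "g *v v = e *\<^sub>R v"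
  proof -
    show "norm v = 1"
      using w by (simp add: v_def)
    have "g *v w = e *\<^sub>R w"
      using w(2) by (simp add: matrix_vector_mult_diff_rdistrib scaleR_matrix_vector_assoc[symmetric])
    then show "g *v v = e *\<^sub>R v"
      by (simp add: v_def matrix_vector_mult_scaleR)
  qed
  \<comment> \<open>An orthogonal matrix completes \<open>v\<close> to a basis and comes with its
    inverse.\<close>
  obtain R :: "real^3^3" where R: "orthogonal_matrix R" "R *v axis 1 1 = v"
    using orthogonal_matrix_exists_basis[OF v(1)] by blast
  have RR: "transpose R ** R = mat 1" "R ** transpose R = mat 1"
    using R(1) by (auto simp: orthogonal_matrix_def)
  define M where "M = transpose R ** g ** R"
  have gR: "g ** R = R ** M"
    by (simp add: M_def matrix_mul_assoc RR)
  have "transpose R *v v = (transpose R ** R) *v axis 1 1"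
    using R(2) by (simp only: flip: matrix_vector_mul_assoc)
  then have "transpose R *v v = axis 1 1"
    by (simp add: RR)
  moreover have "M *v axis 1 1 = transpose R *v (g *v (R *v axis 1 1))"
    by (simp only: M_def matrix_vector_mul_assoc matrix_mul_assoc)
  ultimately have "M *v axis 1 1 = e *\<^sub>R axis 1 1"
    by (simp add: R(2) v(2) matrix_vector_mult_scaleR)
  then have "column 1 M = e *\<^sub>R axis 1 1"
    by (simp add: matrix_vector_mult_basis)
  then have col: "M$1$1 = e" "M$2$1 = 0" "M$3$1 = 0"
    by (simp_all add: vec_eq_iff forall_3 column_def axis_def)
  have "det (x *\<^sub>R mat 1 - M) = det (x *\<^sub>R mat 1 - g)" for x
  proof -
    have "x *\<^sub>R mat 1 - M = transpose R ** (x *\<^sub>R mat 1 - g) ** R"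
      by (simp add: M_def matrix_distribs RR)
    moreover have "det (transpose R) * det R = 1"
      using RR(1) by (metis det_mul det_I)
    ultimately show ?thesis
      by (simp add: det_mul)
  qed
  \<comment> \<open>Three values of the characteristic polynomial determine its three lower
    coefficients.\<close>
  from this[of 0] this[of 1] this[of "-1"]
  have inv: "det M = 1" "trace M = trace g" "principal_minors M = principal_minors g"
    using assms(1) unfolding charpoly_3 by simp_all
  define a b c d r1 r2 where "a = M$2$2" and "b = M$2$3" and "c = M$3$2" and "d = M$3$3" and "r1 = M$1$2" and "r2 = M$1$3"
  have M: "M = mat3 e r1 r2 0 a b 0 c d"
    by (rule mat3_eqI) (simp_all add: a_def b_def c_def d_def r1_def r2_def col)
  have tr: "e + a + d = trace g" and det: "e * (a * d - b * c) = 1"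
    and pm: "e * a + e * d + a * d - b * c = principal_minors g"
    using inv by (simp_all add: M trace_3 det_3 principal_minors_def algebra_simps)
  define \<Delta> where "\<Delta> = (a - e) * (d - e) - b * c"
  have "3 * e\<^sup>2 - 2 * trace g * e + principal_minors g = \<Delta>"
    unfolding \<Delta>_def tr[symmetric] pm[symmetric] by algebra
  then have "\<Delta> \<noteq> 0"
    using simple by simp
  \<comment> \<open>Cramer's rule for the row vector (c1, c2) whose product with the block minus e
    is (r1, r2).\<close>
  define c1 c2 where "c1 = (r1 * (d - e) - r2 * c) / \<Delta>" and "c2 = (r2 * (a - e) - r1 * b) / \<Delta>"
  have c: "\<Delta> * c1 = r1 * (d - e) - r2 * c" "\<Delta> * c2 = r2 * (a - e) - r1 * b"
    using \<open>\<Delta> \<noteq> 0\<close> by (simp_all add: c1_def c2_def)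
  have "\<Delta> * (r1 + e * c1) = \<Delta> * (c1 * a + c2 * c)" "\<Delta> * (r2 + e * c2) = \<Delta> * (c1 * b + c2 * d)"
    using c unfolding \<Delta>_def by algebra+
  then have kill: "r1 + e * c1 = c1 * a + c2 * c" "r2 + e * c2 = c1 * b + c2 * d"
    using \<open>\<Delta> \<noteq> 0\<close> by simp_all
  define N N' where "N = mat3 1 c1 c2 0 1 0 0 0 1" and "N' = mat3 1 (-c1) (-c2) 0 1 0 0 0 1"
  have NN: "N ** N' = mat 1" "N' ** N = mat 1"
    by (rule mat3_eqI; simp add: N_def N'_def entries_3)+
  have MN: "M ** N = N ** mat3 e 0 0 0 a b 0 c d"
    by (rule mat3_eqI) (use kill in \<open>simp_all add: N_def M entries_3 algebra_simps\<close>)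
  show thesis
  proof
    have "R ** N ** (N' ** transpose R) = R ** (N ** N') ** transpose R"
      by (simp add: matrix_mul_assoc)
    then show "R ** N ** (N' ** transpose R) = mat 1"
      by (simp add: NN RR)
    have "N' ** transpose R ** (R ** N) = N' ** (transpose R ** R) ** N"
      by (simp add: matrix_mul_assoc)
    then show "N' ** transpose R ** (R ** N) = mat 1"
      by (simp add: NN RR)
    show "g ** (R ** N) = R ** N ** mat3 e 0 0 0 a b 0 c d"
      using MN by (metis gR matrix_mul_assoc)
  qed (use tr det \<open>\<Delta> \<noteq> 0\<close> \<Delta>_def in auto)
qed

lemma eigenvectors_2x2:
  fixes a b c d :: real
  assumes "(a + d)\<^sup>2 > 4 * (a * d - b * c)"
  obtains p q r s x y where "p * s - q * r \<noteq> 0" "a * p + b * r = x * p" "c * p + d * r = x * r"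
    "a * q + b * s = y * q" "c * q + d * s = y * s" "x + y = a + d" "x * y = a * d - b * c"
proof -
  define w where "w = sqrt ((a + d)\<^sup>2 - 4 * (a * d - b * c))"
  have w: "w\<^sup>2 = (a + d)\<^sup>2 - 4 * (a * d - b * c)" "w > 0"
    using assms by (simp_all add: w_def)
  define x y where "x = (a + d + w) / 2" and "y = (a + d - w) / 2"
  have w_eq: "w = 2 * x - (a + d)" and y_eq: "y = a + d - x"
    by (simp_all add: x_def y_def field_simps)
  have root: "x\<^sup>2 - (a + d) * x + (a * d - b * c) = 0"
    using w(1) unfolding w_eq by algebra
  have sum: "x + y = a + d"
    by (simp add: y_eq)
  have prod: "x * y = a * d - b * c"
    using root unfolding y_eq by algebra
  have ne: "x \<noteq> y"
    using w(2) by (simp add: x_def y_def)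
  show thesis
  proof (cases "b = 0")
    case False
    show thesis
    \<comment> \<open>Variables are instantiated in their order of occurrence p, s, q, r: the
      eigenvectors are (b, x - a) and (b, y - a).\<close>
    proof (rule that[of b "y - a" b "x - a" x y])
      show "b * (y - a) - b * (x - a) \<noteq> 0"
        using False ne by (simp add: algebra_simps)
      show "c * b + d * (x - a) = x * (x - a)" "c * b + d * (y - a) = y * (y - a)"
        using root unfolding y_eq by algebra+
    qed (use sum prod in \<open>simp_all add: algebra_simps\<close>)
  next
    case True
    have "(a - d)\<^sup>2 > 0"
      using assms True by (simp add: power2_eq_square algebra_simps)
    then show thesis
      using True by (intro that[of "a - d" 1 0 c a d]) (auto simp: algebra_simps)
  qed
qed

text \<open>The discriminant of the 2x2 block decides which real powers are used: a common modulus
  \<rho> if it is not positive, separate moduli of two distinct real eigenvalues otherwise. In both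
  cases the trace bound excludes that all moduli agree.\<close>

lemma hyperbolic_imp_diagonalizable_in_lie_algebra:
  fixes \<Gamma> :: "(real^3^3) set"
  assumes mult: "\<And>g h. g \<in> \<Gamma> \<Longrightarrow> h \<in> \<Gamma> \<Longrightarrow> g ** h \<in> \<Gamma>" and one: "mat 1 \<in> \<Gamma>"
    and det: "det g = 1" and g: "g \<in> \<Gamma>" "\<bar>trace g\<bar> > 3"
  obtains P Q x y z where "P ** Q = mat 1" "Q ** P = mat 1" "\<not> (x = y \<and> y = z)"
    "P ** diag3 x y z ** Q \<in> lie_algebra_of \<Gamma>"
proof -
  obtain P Q e a b c d where PQ: "P ** Q = mat 1" "Q ** P = mat 1"
    and gP: "g ** P = P ** mat3 e 0 0 0 a b 0 c d"
    and block: "e * (a * d - b * c) = 1" "e + a + d = trace g"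
    using block_diagonalization[OF det g(2)] by metis
  have pow: "matpow g n \<in> \<Gamma>" for n
    by (induction n) (simp_all add: mult one g)
  show thesis
  proof (cases "(a + d)\<^sup>2 \<le> 4 * (a * d - b * c)")
    case True
    have "P ** matpow (mat3 e 0 0 0 a b 0 c d) n ** Q \<in> \<Gamma>" for n
      using pow[of n] matpow_conjugate[OF PQ(1) gP] by simp
    then show thesis
      using block_log_in_lie_algebra[OF PQ(1) _ refl block(1) True] block(2) g(2) that PQ by metis
  next
    case False
    then obtain p q r s x y where *: "p * s - q * r \<noteq> 0" "a * p + b * r = x * p" "c * p + d * r = x * r"
      "a * q + b * s = y * q" "c * q + d * s = y * s" and xy: "x + y = a + d" "x * y = a * d - b * c"
      using eigenvectors_2x2[of a d b c] by (metis not_le)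
    define D where "D = p * s - q * r"
    define R R' where "R = mat3 1 0 0 0 p q 0 r s" and "R' = mat3 1 0 0 0 (s/D) (-q/D) 0 (-r/D) (p/D)"
    have "D \<noteq> 0"
      using * by (simp add: D_def)
    have div: "p * (s / D) - q * r / D = 1" "s * p / D - q * r / D = 1" "s * (p / D) - r * q / D = 1"
      using \<open>D \<noteq> 0\<close> by (simp_all add: D_def mult.commute flip: diff_divide_distrib)
    have "R ** R' = mat 1" "R' ** R = mat 1"
      using div by (auto intro!: mat3_eqI simp: R_def R'_def entries_3 algebra_simps)
    then have PR: "P ** R ** (R' ** Q) = mat 1" "R' ** Q ** (P ** R) = mat 1"
      using PQ by (metis matrix_mul_assoc matrix_mul_rid)+
    have "mat3 e 0 0 0 a b 0 c d ** R = R ** diag3 e x y"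
      using * by (intro mat3_eqI) (simp_all add: R_def entries_3 algebra_simps)
    then have gPR: "g ** (P ** R) = P ** R ** diag3 e x y"
      by (metis gP matrix_mul_assoc)
    have "P ** R ** matpow (diag3 e x y) n ** (R' ** Q) \<in> \<Gamma>" for n
      using pow[of n] matpow_conjugate[OF PR(1) gPR] by simp
    moreover have exy: "e * (x * y) = 1"
      using block(1) xy by simp
    then have nz: "e \<noteq> 0" "x \<noteq> 0" "y \<noteq> 0"
      by auto
    ultimately have "P ** R ** diag3 (ln \<bar>e\<bar>) (ln \<bar>x\<bar>) (ln \<bar>y\<bar>) ** (R' ** Q) \<in> lie_algebra_of \<Gamma>"
      by (intro diagonal_log_in_lie_algebra PR)
    moreover have "\<not> (ln \<bar>e\<bar> = ln \<bar>x\<bar> \<and> ln \<bar>x\<bar> = ln \<bar>y\<bar>)"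
    proof
      assume "ln \<bar>e\<bar> = ln \<bar>x\<bar> \<and> ln \<bar>x\<bar> = ln \<bar>y\<bar>"
      then have eq: "\<bar>x\<bar> = \<bar>e\<bar>" "\<bar>y\<bar> = \<bar>e\<bar>"
        using nz by simp_all
      have "\<bar>e\<bar> * (\<bar>x\<bar> * \<bar>y\<bar>) = 1"
        using exy by (metis abs_mult abs_1)
      then have "\<bar>e\<bar> ^ 3 = 1 ^ 3"
        unfolding eq by (simp add: power3_eq_cube)
      then have "\<bar>e\<bar> = 1"
        by (rule power_eq_imp_eq_base) auto
      then show False
        using eq g(2) block(2) xy(1) by linarith
    qed
    ultimately show thesis
      using that PR by blast
  qed
qed

lemma
  assumes "subgroup \<Gamma> SL3"
  shows SL3_subgroup_det: "g \<in> \<Gamma> \<Longrightarrow> det g = 1"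
    and SL3_subgroup_mult: "g \<in> \<Gamma> \<Longrightarrow> h \<in> \<Gamma> \<Longrightarrow> g ** h \<in> \<Gamma>"
    and SL3_subgroup_one: "mat 1 \<in> \<Gamma>"
    and SL3_subgroup_inv: "g \<in> \<Gamma> \<Longrightarrow> matrix_inv g \<in> \<Gamma>"
proof -
  show det: "det g = 1" if "g \<in> \<Gamma>" for g
    using subgroup.mem_carrier[OF assms that] by simp
  show "g \<in> \<Gamma> \<Longrightarrow> h \<in> \<Gamma> \<Longrightarrow> g ** h \<in> \<Gamma>" "mat 1 \<in> \<Gamma>"
    using subgroup.m_closed[OF assms] subgroup.one_closed[OF assms] by auto
  show "g \<in> \<Gamma> \<Longrightarrow> matrix_inv g \<in> \<Gamma>"
    using subgroup.m_inv_closed[OF assms, of g] det[of g] by (simp add: inv_SL3)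
qed

section \<open>Elementary groups\<close>

lemma image_span_singleton_eq:
  assumes "linear f" "f v = c *\<^sub>R v" "c \<noteq> 0"
  shows "f ` span {v} = span {v}"
proof -
  have "f ` span {v} = span {c *\<^sub>R v}"
    using span_linear_image[OF assms(1), of "{v}"] assms(2) by simp
  also have "\<dots> = span {v}"
    using assms(3) by (simp add: span_eq span_base span_scale)
      (metis scaleR_one span_base span_scale singletonI left_inverse scaleR_scaleR)
  finally show ?thesis .
qed

lemma mem_span_singleton: "w \<in> span {v} \<longleftrightarrow> (\<exists>c. w = c *\<^sub>R v)"
  by (auto simp: span_singleton)

lemma transpose_matrix_inv_1:
  fixes g :: "real^'n^'n"
  assumes "det g = 1"
  shows "transpose (matrix_inv g) ** transpose g = mat 1" "transpose g ** transpose (matrix_inv g) = mat 1"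
  by (simp_all add: det_matrix_inv_1[OF assms] transpose_mat flip: matrix_transpose_mul)

lemma linear_congruence: "linear (\<lambda>S::real^'n^'n. A ** S ** B)"
  by (rule linearI) (simp_all add: matrix_distribs)

lemma congruence_cancel:
  assumes "A' ** A = mat 1" "B ** B' = mat 1" "A ** S ** B = (T::real^'n^'n)"
  shows "S = A' ** T ** B'"
proof -
  have "A' ** T ** B' = A' ** A ** S ** (B ** B')"
    by (simp add: assms(3)[symmetric] matrix_mul_assoc)
  then show ?thesis
    using assms by simp
qed

text \<open>Invertibility of \<open>g\<close> rules out the scalar 0, so mapping a spanning vector
  into the line already means mapping the line onto itself.\<close>

lemma fixes_dual_conic_iff:
  assumes "\<forall>g\<in>\<Delta>. det g = 1"
  shows "fixes_dual_conic \<Delta> \<longleftrightarrow>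
    (\<exists>S. S \<noteq> 0 \<and> transpose S = S \<and> (\<forall>g\<in>\<Delta>. g ** S ** transpose g \<in> span {S}))" (is "?L \<longleftrightarrow> ?R")
proof
  assume ?L
  then obtain S where S: "S \<noteq> 0" "transpose S = S" "\<forall>g\<in>\<Delta>. tensor_act g ` span {S} = span {S}"
    unfolding fixes_dual_conic_def proj_points_def sym_matrices_def by blast
  then have "g ** S ** transpose g \<in> span {S}" if "g \<in> \<Delta>" for g
    using that span_base[of S "{S}"] unfolding tensor_act_def by blast
  with S show ?R
    by blast
next
  assume ?R
  then obtain S where S: "S \<noteq> 0" "transpose S = S" "\<forall>g\<in>\<Delta>. g ** S ** transpose g \<in> span {S}"
    by blast
  have "tensor_act g ` span {S} = span {S}" if "g \<in> \<Delta>" for g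
  proof -
    obtain c where c: "g ** S ** transpose g = c *\<^sub>R S"
      using bspec[OF S(3) \<open>g \<in> \<Delta>\<close>] unfolding mem_span_singleton by blast
    have "S = matrix_inv g ** (c *\<^sub>R S) ** transpose (matrix_inv g)"
      by (rule congruence_cancel[OF det_matrix_inv_1(2)[OF bspec[OF assms that]] transpose_matrix_inv_1(2)[OF bspec[OF assms that]] c])
    then have "c \<noteq> 0"
      using S(1) by auto
    then show ?thesis
      unfolding tensor_act_def by (rule image_span_singleton_eq[OF linear_congruence c])
  qed
  moreover have "span {S} \<in> proj_points sym_matrices"
    using S(1,2) unfolding proj_points_def sym_matrices_def by blast
  ultimately show ?L
    unfolding fixes_dual_conic_def by blast
qed

text \<open>\<open>form_act\<close> contains the inverse of \<open>g\<close>. A line is fixed by an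
  operator iff it is fixed by the inverse operator, which here is polynomial in
  \<open>g\<close>.\<close>

lemma fixes_conic_iff:
  assumes "\<forall>g\<in>\<Delta>. det g = 1"
  shows "fixes_conic \<Delta> \<longleftrightarrow>
    (\<exists>S. S \<noteq> 0 \<and> transpose S = S \<and> (\<forall>g\<in>\<Delta>. transpose g ** S ** g \<in> span {S}))" (is "?L \<longleftrightarrow> ?R")
proof
  assume ?L
  then obtain S where S: "S \<noteq> 0" "transpose S = S" "\<forall>g\<in>\<Delta>. form_act g ` span {S} = span {S}"
    unfolding fixes_conic_def proj_points_def sym_matrices_def by blast
  have "transpose g ** S ** g \<in> span {S}" if "g \<in> \<Delta>" for g
  proof -
    have "S \<in> form_act g ` span {S}"
      using S that span_base[of S "{S}"] by blast
    then obtain T where T: "T \<in> span {S}" "transpose (matrix_inv g) ** T ** matrix_inv g = S"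
      unfolding form_act_def by blast
    have "T = transpose g ** S ** g"
      by (rule congruence_cancel[OF transpose_matrix_inv_1(2)[OF bspec[OF assms that]] det_matrix_inv_1(2)[OF bspec[OF assms that]] T(2)])
    then show ?thesis
      using T(1) by simp
  qed
  with S show ?R
    by blast
next
  assume ?R
  then obtain S where S: "S \<noteq> 0" "transpose S = S" "\<forall>g\<in>\<Delta>. transpose g ** S ** g \<in> span {S}"
    by blast
  have "form_act g ` span {S} = span {S}" if "g \<in> \<Delta>" for g
  proof -
    obtain c where c: "transpose g ** S ** g = c *\<^sub>R S"
      using bspec[OF S(3) \<open>g \<in> \<Delta>\<close>] unfolding mem_span_singleton by blast
    have eq: "S = transpose (matrix_inv g) ** (c *\<^sub>R S) ** matrix_inv g"
      by (rule congruence_cancel[OF transpose_matrix_inv_1(1)[OF bspec[OF assms that]] det_matrix_inv_1(1)[OF bspec[OF assms that]] c])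
    then have "c \<noteq> 0"
      using S(1) by auto
    have "S = c *\<^sub>R (transpose (matrix_inv g) ** S ** matrix_inv g)"
      using eq by (simp add: matrix_distribs)
    then have "inverse c *\<^sub>R S = transpose (matrix_inv g) ** S ** matrix_inv g"
      using \<open>c \<noteq> 0\<close> by (metis scaleR_scaleR left_inverse scaleR_one)
    then show ?thesis
      unfolding form_act_def using \<open>c \<noteq> 0\<close>
      by (intro image_span_singleton_eq[OF linear_congruence, of _ _ _ "inverse c"]) auto
  qed
  moreover have "span {S} \<in> proj_points sym_matrices"
    using S(1,2) unfolding proj_points_def sym_matrices_def by blast
  ultimately show ?L
    unfolding fixes_conic_def by blast
qed

text \<open>Orbit-stabiliser: the orbit parametrises the cosets of the stabiliser, so a finite orbit
  gives finite index.\<close>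

lemma finite_index_stabilizer:
  assumes "group G"
    and act: "\<And>g h y. g \<in> carrier G \<Longrightarrow> h \<in> carrier G \<Longrightarrow> act (g \<otimes>\<^bsub>G\<^esub> h) y = act g (act h y)"
    and one: "\<And>y. act \<one>\<^bsub>G\<^esub> y = y"
    and fin: "finite ((\<lambda>g. act g x) ` carrier G)"
  shows "finite_index_subgroup {g \<in> carrier G. act g x = x} G"
proof -
  interpret group G by fact
  define H where "H = {g \<in> carrier G. act g x = x}"
  have inv: "act (inv\<^bsub>G\<^esub> g) (act g y) = y" "act g (act (inv\<^bsub>G\<^esub> g) y) = y" if "g \<in> carrier G" for g y
    using act[of "inv\<^bsub>G\<^esub> g" g y] act[of g "inv\<^bsub>G\<^esub> g" y] that one by auto
  have H: "subgroup H G"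
  proof
    show "inv\<^bsub>G\<^esub> g \<in> H" if "g \<in> H" for g
      using that inv(1)[of g x] by (simp add: H_def)
  qed (auto simp: H_def act one)
  \<comment> \<open>A right coset of the stabiliser is determined by the image of \<open>x\<close>
    under the inverse of a representative, hence the inverse here.\<close>
  define r where "r y = (SOME g. g \<in> carrier G \<and> act (inv\<^bsub>G\<^esub> g) x = y)" for y
  have "rcosets\<^bsub>G\<^esub> H \<subseteq> (\<lambda>y. H #>\<^bsub>G\<^esub> r y) ` (\<lambda>g. act g x) ` carrier G"
  proof
    fix R assume "R \<in> rcosets\<^bsub>G\<^esub> H"
    then obtain g where g: "g \<in> carrier G" "R = H #>\<^bsub>G\<^esub> g"
      unfolding RCOSETS_def by blast
    define y where "y = act (inv\<^bsub>G\<^esub> g) x"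
    have r: "r y \<in> carrier G" "act (inv\<^bsub>G\<^esub> r y) x = y"
      using someI[of "\<lambda>g. g \<in> carrier G \<and> act (inv\<^bsub>G\<^esub> g) x = y" g] g(1) y_def unfolding r_def by auto
    have "g \<otimes>\<^bsub>G\<^esub> inv\<^bsub>G\<^esub> r y \<in> H"
      using g r inv(2)[of g x] by (simp add: H_def act y_def)
    moreover have "g = g \<otimes>\<^bsub>G\<^esub> inv\<^bsub>G\<^esub> r y \<otimes>\<^bsub>G\<^esub> r y"
      using g r by (simp add: m_assoc)
    ultimately have "g \<in> H #>\<^bsub>G\<^esub> r y"
      unfolding r_coset_def by blast
    then have "R = H #>\<^bsub>G\<^esub> r y"
      using repr_independence[OF _ r(1) H] g(2) by simp
    then show "R \<in> (\<lambda>y. H #>\<^bsub>G\<^esub> r y) ` (\<lambda>g. act g x) ` carrier G"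
      unfolding y_def using g(1) by blast
  qed
  then show ?thesis
    unfolding finite_index_subgroup_def H_def[symmetric]
    using H fin finite_subset by blast
qed

lemma finite_index_subgroup_self:
  assumes "group G"
  shows "finite_index_subgroup (carrier G) G"
proof -
  \<comment> \<open>The whole group is the stabiliser of an arbitrary point under the trivial
    action.\<close>
  have "finite_index_subgroup {g \<in> carrier G. (\<lambda>g y. y) g undefined = undefined} G"
    by (rule finite_index_stabilizer[OF assms]) (auto simp: image_constant_conv)
  then show ?thesis
    by simp
qed

lemma group_restrict_SL3: "subgroup \<Gamma> SL3 \<Longrightarrow> group (SL3\<lparr>carrier := \<Gamma>\<rparr>)"
  using subgroup.subgroup_is_group group_SL3 by blast

lemma finite_index_subgroup_SL3:
  assumes "subgroup \<Gamma> SL3" "finite_index_subgroup \<Delta> (SL3\<lparr>carrier := \<Gamma>\<rparr>)"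
  shows "subgroup \<Delta> SL3" "\<Delta> \<subseteq> \<Gamma>"
proof -
  have "subgroup \<Delta> (SL3\<lparr>carrier := \<Gamma>\<rparr>)"
    using assms(2) by (simp add: finite_index_subgroup_def)
  then show "subgroup \<Delta> SL3" "\<Delta> \<subseteq> \<Gamma>"
    using group.incl_subgroup[OF group_SL3 assms(1)] subgroup.subset by fastforce+
qed

section \<open>Degenerate conics from invariant subspaces\<close>

definition outer :: "real^'n \<Rightarrow> real^'n^'n" where
  "outer v = (\<chi> i j. v $ i * v $ j)"

lemma outer_congruence: "A ** outer v ** transpose A = outer (A *v v)"
proof -
  have "(A ** outer v) $ i $ j = (A *v v) $ i * v $ j" for i j
    by (simp add: matrix_matrix_mult_def matrix_vector_mult_def outer_def sum_distrib_right mult.assoc)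
  then have "(A ** outer v ** transpose A) $ i $ j = (\<Sum>k\<in>UNIV. (A *v v) $ i * v $ k * A $ j $ k)" for i j
    by (subst matrix_matrix_mult_def) (simp add: transpose_def)
  also have "(\<Sum>k\<in>UNIV. (A *v v) $ i * v $ k * A $ j $ k) = (A *v v) $ i * (A *v v) $ j" for i j
    by (simp add: matrix_vector_mult_def[of A v] sum_distrib_left mult_ac)
  finally show ?thesis
    by (simp add: vec_eq_iff outer_def)
qed

lemma outer_scaleR: "outer (c *\<^sub>R v) = c\<^sup>2 *\<^sub>R outer v"
  by (simp add: vec_eq_iff outer_def power2_eq_square)

lemma outer_eq_0_iff: "outer v = 0 \<longleftrightarrow> v = 0"
  by (auto simp: vec_eq_iff outer_def)

lemma transpose_outer: "transpose (outer v) = outer v"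
  by (simp add: vec_eq_iff outer_def transpose_def)

text \<open>The rank-one symmetric matrix \<open>outer v\<close> is the square of \<open>v\<close>:
  read as a tensor it is a doubled point, read as a form a doubled line. Both count as degenerate
  conics.\<close>

lemma invariant_line_imp_elementary:
  assumes \<Gamma>: "subgroup \<Gamma> SL3" and \<Delta>: "finite_index_subgroup \<Delta> (SL3\<lparr>carrier := \<Gamma>\<rparr>)"
    and "v \<noteq> 0" "(\<forall>g\<in>\<Delta>. g *v v \<in> span {v}) \<or> (\<forall>g\<in>\<Delta>. transpose g *v v \<in> span {v})"
  shows "elementary \<Gamma>"
proof -
  have det: "\<forall>g\<in>\<Delta>. det g = 1"
    using SL3_subgroup_det[OF finite_index_subgroup_SL3(1)[OF \<Gamma> \<Delta>]] by blast
  have *: "A ** outer v ** transpose A \<in> span {outer v}" if "A *v v \<in> span {v}" for A :: "real^3^3"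
    using that by (auto simp: mem_span_singleton outer_congruence outer_scaleR)
  have "fixes_conic \<Delta> \<or> fixes_dual_conic \<Delta>"
    using assms(4)
  proof
    assume "\<forall>g\<in>\<Delta>. g *v v \<in> span {v}"
    then have "\<forall>g\<in>\<Delta>. g ** outer v ** transpose g \<in> span {outer v}"
      using * by blast
    then have "fixes_dual_conic \<Delta>"
      unfolding fixes_dual_conic_iff[OF det]
      using \<open>v \<noteq> 0\<close> by (intro exI[of _ "outer v"]) (simp add: outer_eq_0_iff transpose_outer)
    then show ?thesis ..
  next
    assume "\<forall>g\<in>\<Delta>. transpose g *v v \<in> span {v}"
    then have "\<forall>g\<in>\<Delta>. transpose g ** outer v ** g \<in> span {outer v}"
      using *[of "transpose g" for g, unfolded transpose_transpose] by blast
    then have "fixes_conic \<Delta>"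
      unfolding fixes_conic_iff[OF det]
      using \<open>v \<noteq> 0\<close> by (intro exI[of _ "outer v"]) (simp add: outer_eq_0_iff transpose_outer)
    then show ?thesis ..
  qed
  then show ?thesis
    unfolding elementary_def using \<Delta> by blast
qed

lemma proper_subspace_R3:
  fixes V :: "(real^3) set"
  assumes "subspace V" "V \<noteq> {0}" "V \<noteq> UNIV"
  obtains v where "v \<noteq> 0" "V = span {v} \<or> {y. \<forall>x\<in>V. orthogonal x y} = span {v}"
proof -
  have line: "\<exists>v. v \<noteq> 0 \<and> W = span {v}" if "subspace W" "dim W = 1" for W :: "(real^3) set"
  proof -
    obtain B where B: "B \<subseteq> W" "independent B" "W \<subseteq> span B" "card B = 1"
      using basis_exists[of W] \<open>dim W = 1\<close> by auto
    then obtain v where "B = {v}"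
      using card_1_singletonE by blast
    with B that show ?thesis
      by (metis dependent_zero insertI1 span_minimal subset_antisym)
  qed
  have "dim V \<noteq> 0"
    using assms by (simp add: dim_eq_0) (use subspace_0 in blast)
  moreover have "dim V \<noteq> 3"
    using assms dim_eq_full[of V] by (auto simp: span_eq_iff[THEN iffD2])
  moreover have "dim V \<le> 3"
    using dim_subset_UNIV_cart[of V] by simp
  ultimately consider "dim V = 1" | "dim V = 2"
    by linarith
  then show thesis
  proof cases
    case 1
    with line[OF assms(1)] that show thesis by blast
  next
    case 2
    have "subspace {y. \<forall>x\<in>V. orthogonal x y}"
      by (auto simp: subspace_def orthogonal_clauses)
    moreover have "dim {y. \<forall>x\<in>V. orthogonal x y} = 1"
      using dim_subspace_orthogonal_to_vectors[OF assms(1) subspace_UNIV subset_UNIV] 2 by simp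
    ultimately show thesis
      using line[of "{y. \<forall>x\<in>V. orthogonal x y}"] that by blast
  qed
qed

text \<open>A proper nonzero subspace of R^3 is a line or the orthogonal complement of a line, and
  the normal of an invariant plane is an eigenvector of the transposes.\<close>

lemma invariant_subspace_imp_elementary:
  assumes \<Gamma>: "subgroup \<Gamma> SL3" and \<Delta>: "finite_index_subgroup \<Delta> (SL3\<lparr>carrier := \<Gamma>\<rparr>)"
    and V: "subspace V" "V \<noteq> {0}" "V \<noteq> UNIV"
    and inv: "(\<forall>g\<in>\<Delta>. \<forall>x\<in>V. g *v x \<in> V) \<or> (\<forall>g\<in>\<Delta>. \<forall>x\<in>V. transpose g *v x \<in> V)"
  shows "elementary \<Gamma>"
proof -
  obtain n where n: "n \<noteq> 0" "V = span {n} \<or> {y. \<forall>x\<in>V. orthogonal x y} = span {n}"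
    using proper_subspace_R3[OF V] .
  have perp: "transpose A *v n \<in> span {n}"
    if "{y. \<forall>x\<in>V. orthogonal x y} = span {n}" "\<forall>x\<in>V. A *v x \<in> V" for A :: "real^3^3"
  proof -
    have "n \<in> {y. \<forall>x\<in>V. orthogonal x y}"
      unfolding that(1) by (simp add: span_base)
    then have "transpose A *v n \<in> {y. \<forall>x\<in>V. orthogonal x y}"
      using that(2) by (auto simp: orthogonal_def dot_lmul_matrix[symmetric] inner_commute)
        (metis dot_lmul_matrix inner_commute transpose_matrix_vector)
    then show ?thesis
      unfolding that(1) .
  qed
  from n(2) inv have "(\<forall>g\<in>\<Delta>. g *v n \<in> span {n}) \<or> (\<forall>g\<in>\<Delta>. transpose g *v n \<in> span {n})"
  proof (elim disjE)
    assume "{y. \<forall>x\<in>V. orthogonal x y} = span {n}" "\<forall>g\<in>\<Delta>. \<forall>x\<in>V. transpose g *v x \<in> V"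
    then show ?thesis
      using perp[of "transpose g" for g, unfolded transpose_transpose] by blast
  qed (use perp span_base[of n "{n}"] in blast)+
  with n(1) show ?thesis
    by (rule invariant_line_imp_elementary[OF \<Gamma> \<Delta>])
qed

section \<open>Weight spaces\<close>

text \<open>To show that the coefficient of \<open>v j\<close> vanishes, take \<open>X\<close> with
  different weights at j and at the new index k, and apply X - \<kappa> k X to the relation. The
  term at k disappears, and the induction hypothesis applies to what is left.\<close>

lemma separated_eigenvectors_independent:
  fixes v :: "'i \<Rightarrow> real^'n" and \<kappa> :: "'i \<Rightarrow> real^'n^'n \<Rightarrow> real"
  assumes "finite I" "\<And>i. i \<in> I \<Longrightarrow> v i \<noteq> 0" "\<And>i X. i \<in> I \<Longrightarrow> X \<in> L \<Longrightarrow> X *v v i = \<kappa> i X *\<^sub>R v i"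
    and "\<And>i j. i \<in> I \<Longrightarrow> j \<in> I \<Longrightarrow> i \<noteq> j \<Longrightarrow> \<exists>X\<in>L. \<kappa> i X \<noteq> \<kappa> j X"
    and "(\<Sum>i\<in>I. a i *\<^sub>R v i) = 0" "i \<in> I"
  shows "a i = 0"
  using assms
proof (induction I arbitrary: a i rule: finite_induct)
  case (insert k I)
  have zero: "a j = 0" if j: "j \<in> I" for j
  proof -
    obtain X where X: "X \<in> L" "\<kappa> j X \<noteq> \<kappa> k X"
      using insert.prems(3)[of j k] insert.hyps j by auto
    have "0 = X *v (\<Sum>i\<in>insert k I. a i *\<^sub>R v i) - \<kappa> k X *\<^sub>R (\<Sum>i\<in>insert k I. a i *\<^sub>R v i)"
      by (simp only: insert.prems(4)) simp
    also have "\<dots> = (\<Sum>i\<in>insert k I. a i *\<^sub>R (X *v v i)) - (\<Sum>i\<in>insert k I. (\<kappa> k X * a i) *\<^sub>R v i)"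
      by (simp only: linear_sum[OF matrix_vector_mul_linear] matrix_vector_mult_scaleR
          scaleR_sum_right scaleR_scaleR)
    also have "\<dots> = (\<Sum>i\<in>insert k I. (a i * (\<kappa> i X - \<kappa> k X)) *\<^sub>R v i)"
      unfolding sum_subtractf[symmetric]
      by (intro sum.cong refl) (simp add: insert.prems(2) X algebra_simps)
    also have "\<dots> = (\<Sum>i\<in>I. (a i * (\<kappa> i X - \<kappa> k X)) *\<^sub>R v i)"
      using insert.hyps by simp
    finally have "(\<Sum>i\<in>I. (a i * (\<kappa> i X - \<kappa> k X)) *\<^sub>R v i) = 0"
      by simp
    from insert.IH[OF _ _ _ this j] have "a j * (\<kappa> j X - \<kappa> k X) = 0"
      using insert.prems by blast
    then show ?thesis
      using X(2) by simp
  qed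
  then have "(\<Sum>i\<in>I. a i *\<^sub>R v i) = 0"
    by simp
  then have "a k *\<^sub>R v k = 0"
    using insert.prems(4) insert.hyps by simp
  then show ?case
    using zero insert.prems by auto
qed simp

lemma separated_eigenvectors_card:
  fixes v :: "'i \<Rightarrow> real^'n" and \<kappa> :: "'i \<Rightarrow> real^'n^'n \<Rightarrow> real"
  assumes "finite I" and v: "\<And>i. i \<in> I \<Longrightarrow> v i \<noteq> 0" "\<And>i X. i \<in> I \<Longrightarrow> X \<in> L \<Longrightarrow> X *v v i = \<kappa> i X *\<^sub>R v i"
    and sep: "\<And>i j. i \<in> I \<Longrightarrow> j \<in> I \<Longrightarrow> i \<noteq> j \<Longrightarrow> \<exists>X\<in>L. \<kappa> i X \<noteq> \<kappa> j X"
  shows "card I \<le> CARD('n)"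
proof -
  have inj: "inj_on v I"
  proof (rule inj_onI, rule ccontr)
    fix i j assume ij: "i \<in> I" "j \<in> I" "v i = v j" "i \<noteq> j"
    then obtain X where X: "X \<in> L" "\<kappa> i X \<noteq> \<kappa> j X"
      using sep by blast
    then have "\<kappa> i X *\<^sub>R v i = \<kappa> j X *\<^sub>R v i"
      using v(2) ij by metis
    then show False
      using v(1) ij X by simp
  qed
  have "independent (v ` I)"
  proof
    assume "dependent (v ` I)"
    then obtain u w where u: "w \<in> v ` I" "u w \<noteq> 0" "(\<Sum>w\<in>v ` I. u w *\<^sub>R w) = 0"
      using \<open>finite I\<close> dependent_finite[of "v ` I"] by auto
    have "(\<Sum>i\<in>I. u (v i) *\<^sub>R v i) = 0"
      using u(3) by (simp add: sum.reindex[OF inj])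
    then have "u (v i) = 0" if "i \<in> I" for i
      using separated_eigenvectors_independent[of I v L \<kappa> "\<lambda>i. u (v i)" i] assms that by blast
    then show False
      using u by auto
  qed
  then have "card (v ` I) \<le> CARD('n)"
    using independent_bound by fastforce
  then show ?thesis
    by (simp add: card_image inj)
qed

definition weight_space :: "(real^'n^'n) set \<Rightarrow> (real^'n^'n \<Rightarrow> real) \<Rightarrow> (real^'n) set" where
  "weight_space L \<kappa> = {w. \<forall>X\<in>L. X *v w = \<kappa> X *\<^sub>R w}"

lemma subspace_weight_space: "subspace (weight_space L \<kappa>)"
  by (auto simp: subspace_def weight_space_def matrix_vector_right_distrib matrix_vector_mult_scaleR
      scaleR_add_right mult.commute)

text \<open>Spaces are counted rather than weights, because functions \<kappa> differing only
  outside \<open>L\<close> define the same space. Distinct nonzero weight spaces have weights that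
  differ on \<open>L\<close>, so at most the dimension many exist.\<close>

lemma finite_weight_spaces:
  fixes L :: "(real^'n^'n) set"
  shows "finite {W. W \<noteq> {0} \<and> (\<exists>\<kappa>. W = weight_space L \<kappa>)}" (is "finite ?W")
proof (rule ccontr)
  assume "infinite ?W"
  then obtain I where I: "finite I" "card I = Suc CARD('n)" "I \<subseteq> ?W"
    using infinite_arbitrarily_large[of ?W "Suc CARD('n)"] by blast
  have "\<exists>\<kappa> w. W = weight_space L \<kappa> \<and> w \<in> W \<and> w \<noteq> 0" if "W \<in> I" for W
  proof -
    obtain \<kappa> where \<kappa>: "W = weight_space L \<kappa>" "W \<noteq> {0}"
      using I(3) \<open>W \<in> I\<close> by blast
    then have "0 \<in> W"
      using subspace_0[OF subspace_weight_space] by simp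
    with \<kappa> show ?thesis
      by blast
  qed
  then have "\<forall>W\<in>I. \<exists>\<kappa> w. W = weight_space L \<kappa> \<and> w \<in> W \<and> w \<noteq> 0"
    by blast
  then obtain \<kappa> v where "\<forall>W\<in>I. W = weight_space L (\<kappa> W) \<and> v W \<in> W \<and> v W \<noteq> 0"
    by metis
  then have W: "W = weight_space L (\<kappa> W)" "v W \<in> W" "v W \<noteq> 0" if "W \<in> I" for W
    using that by blast+
  have "card I \<le> CARD('n)"
  proof (rule separated_eigenvectors_card[of I v L \<kappa>])
    show "X *v v W = \<kappa> W X *\<^sub>R v W" if "W \<in> I" "X \<in> L" for W X
      using W(1,2)[OF that(1)] that(2) unfolding weight_space_def by auto
    show "\<exists>X\<in>L. \<kappa> W X \<noteq> \<kappa> W' X" if "W \<in> I" "W' \<in> I" "W \<noteq> W'" for W W'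
    proof (rule ccontr)
      assume "\<not> ?thesis"
      then have "weight_space L (\<kappa> W) = weight_space L (\<kappa> W')"
        unfolding weight_space_def by auto
      then show False
        using W(1)[OF that(1)] W(1)[OF that(2)] that(3) by simp
    qed
  qed (use I W in auto)
  then show False
    using I by simp
qed

lemma weight_space_conjugate:
  assumes "A ** B = mat 1" "B ** A = mat 1"
    and "\<And>X. X \<in> L \<Longrightarrow> A ** X ** B \<in> L" "\<And>X. X \<in> L \<Longrightarrow> B ** X ** A \<in> L"
  shows "(\<lambda>w. A *v w) ` weight_space L \<kappa> = weight_space L (\<lambda>X. \<kappa> (B ** X ** A))"
proof (intro subset_antisym subsetI)
  fix u assume "u \<in> (\<lambda>w. A *v w) ` weight_space L \<kappa>"
  then obtain w where w: "w \<in> weight_space L \<kappa>" "u = A *v w"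
    by blast
  have "X *v u = \<kappa> (B ** X ** A) *\<^sub>R u" if "X \<in> L" for X
  proof -
    have "(B ** X ** A) *v w = \<kappa> (B ** X ** A) *\<^sub>R w"
      using w assms(4)[OF that] by (simp add: weight_space_def)
    then have "A *v ((B ** X ** A) *v w) = \<kappa> (B ** X ** A) *\<^sub>R u"
      by (simp add: w(2) matrix_vector_mult_scaleR)
    moreover have "A *v ((B ** X ** A) *v w) = X *v u"
      unfolding w(2) matrix_vector_mul_assoc matrix_mul_assoc assms(1) by simp
    ultimately show ?thesis
      by simp
  qed
  then show "u \<in> weight_space L (\<lambda>X. \<kappa> (B ** X ** A))"
    by (simp add: weight_space_def)
next
  fix u assume u: "u \<in> weight_space L (\<lambda>X. \<kappa> (B ** X ** A))"
  have "X *v (B *v u) = \<kappa> X *\<^sub>R (B *v u)" if "X \<in> L" for X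
  proof -
    have eq: "B ** (A ** X ** B) ** A = X"
      by (metis assms(2) matrix_mul_assoc matrix_mul_lid matrix_mul_rid)
    have "\<forall>Y\<in>L. Y *v u = \<kappa> (B ** Y ** A) *\<^sub>R u"
      using u by (simp only: weight_space_def mem_Collect_eq)
    from bspec[OF this assms(3)[OF that]] have "(A ** X ** B) *v u = \<kappa> X *\<^sub>R u"
      by (simp only: eq)
    then have "B *v ((A ** X ** B) *v u) = \<kappa> X *\<^sub>R (B *v u)"
      by (simp add: matrix_vector_mult_scaleR)
    moreover have "B *v ((A ** X ** B) *v u) = X *v (B *v u)"
      unfolding matrix_vector_mul_assoc matrix_mul_assoc assms(2) by simp
    ultimately show ?thesis
      by simp
  qed
  then have "B *v u \<in> weight_space L \<kappa>"
    by (simp add: weight_space_def)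
  moreover have "u = A *v (B *v u)"
    by (simp add: matrix_vector_mul_assoc assms(1))
  ultimately show "u \<in> (\<lambda>w. A *v w) ` weight_space L \<kappa>"
    by blast
qed

lemma matrix_inv_eqI:
  fixes A B :: "real^'n^'n"
  assumes "A ** B = mat 1" "B ** A = mat 1"
  shows "matrix_inv A = B"
proof -
  have "A ** matrix_inv A = mat 1 \<and> matrix_inv A ** A = mat 1"
    unfolding matrix_inv_def by (rule someI[of _ B]) (use assms in simp)
  then show ?thesis
    using assms(2) by (metis matrix_mul_assoc matrix_mul_lid matrix_mul_rid)
qed

text \<open>A Clifford-type argument: the group permutes the finitely many weight spaces of the
  algebra it normalises, so the one containing \<open>v\<close> has a stabiliser of finite index.
  The nonscalar \<open>D\<close> keeps this space proper. The representation \<rho> is a parameter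
  so that the contragredient is covered as well.\<close>

lemma common_eigenvector_imp_stabilized_subspace:
  fixes \<rho> :: "'g \<Rightarrow> real^'n^'n"
  assumes G: "group G" and mult: "\<And>g h. g \<in> carrier G \<Longrightarrow> h \<in> carrier G \<Longrightarrow> \<rho> (g \<otimes>\<^bsub>G\<^esub> h) = \<rho> g ** \<rho> h"
    and one: "\<rho> \<one>\<^bsub>G\<^esub> = mat 1"
    and conj: "\<And>g X. g \<in> carrier G \<Longrightarrow> X \<in> L \<Longrightarrow> \<rho> g ** X ** \<rho> (inv\<^bsub>G\<^esub> g) \<in> L"
    and v: "v \<noteq> 0" "\<forall>X\<in>L. \<exists>c. X *v v = c *\<^sub>R v"
    and D: "D \<in> L" "\<And>c. D \<noteq> mat c"
  obtains V \<Delta> where "subspace V" "V \<noteq> {0}" "V \<noteq> UNIV" "finite_index_subgroup \<Delta> G"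
    "\<And>g x. g \<in> \<Delta> \<Longrightarrow> x \<in> V \<Longrightarrow> \<rho> g *v x \<in> V"
proof -
  interpret group G by fact
  have inv: "\<rho> g ** \<rho> (inv\<^bsub>G\<^esub> g) = mat 1" "\<rho> (inv\<^bsub>G\<^esub> g) ** \<rho> g = mat 1" if "g \<in> carrier G" for g
    using that mult[of g "inv\<^bsub>G\<^esub> g"] mult[of "inv\<^bsub>G\<^esub> g" g] one by auto
  have conj': "\<rho> (inv\<^bsub>G\<^esub> g) ** X ** \<rho> g \<in> L" if "g \<in> carrier G" "X \<in> L" for g X
    using conj[of "inv\<^bsub>G\<^esub> g" X] that by simp
  define \<kappa> where "\<kappa> X = (SOME c. X *v v = c *\<^sub>R v)" for X
  define V where "V = weight_space L \<kappa>"
  have "v \<in> V"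
    unfolding V_def weight_space_def \<kappa>_def using v(2) by (auto intro: someI_ex)
  have fin: "finite ((\<lambda>g. (\<lambda>w. \<rho> g *v w) ` V) ` carrier G)"
  proof (rule finite_subset[OF _ finite_weight_spaces[of L]], safe)
    fix g assume g: "g \<in> carrier G"
    show "\<exists>\<kappa>. (\<lambda>w. \<rho> g *v w) ` V = weight_space L \<kappa>"
      unfolding V_def using weight_space_conjugate[OF inv[OF g] conj[OF g] conj'[OF g]] by blast
    assume "(\<lambda>w. \<rho> g *v w) ` V = {0}"
    then have "\<rho> g *v v = 0"
      using \<open>v \<in> V\<close> by blast
    then have "(\<rho> (inv\<^bsub>G\<^esub> g) ** \<rho> g) *v v = 0"
      by (simp add: matrix_vector_mul_assoc[symmetric])
    then show False
      using inv[OF g] v(1) by simp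
  qed
  show thesis
  proof
    show "subspace V"
      by (simp add: V_def subspace_weight_space)
    show "V \<noteq> {0}"
      using \<open>v \<in> V\<close> v by blast
    show "V \<noteq> UNIV"
    proof
      assume "V = UNIV"
      then have "D *v w = \<kappa> D *\<^sub>R w" for w
        using D unfolding V_def weight_space_def by auto
      then have "D *v w = mat (\<kappa> D) *v w" for w
        by (simp add: vec_eq_iff matrix_vector_mult_def mat_def if_distrib if_distribR cong: if_cong)
      then show False
        using D(2) by (meson matrix_eq)
    qed
    show "finite_index_subgroup {g \<in> carrier G. (\<lambda>w. \<rho> g *v w) ` V = V} G"
      by (rule finite_index_stabilizer[where act = "\<lambda>g V. (\<lambda>w. \<rho> g *v w) ` V", OF G _ _ fin])
        (simp_all add: mult one image_image matrix_vector_mul_assoc)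
    show "\<rho> g *v x \<in> V" if "g \<in> {g \<in> carrier G. (\<lambda>w. \<rho> g *v w) ` V = V}" "x \<in> V" for g x
      using that by blast
  qed
qed

lemma non_elementary_no_common_eigenvector:
  assumes \<Gamma>: "subgroup \<Gamma> SL3" and ne: "non_elementary \<Gamma>"
    and conj: "\<And>g X. g \<in> \<Gamma> \<Longrightarrow> X \<in> L \<Longrightarrow> g ** X ** matrix_inv g \<in> L"
    and D: "D \<in> L" "\<And>c. D \<noteq> mat c" and v: "v \<noteq> 0"
  shows "\<exists>X\<in>L. \<forall>c. X *v v \<noteq> c *\<^sub>R v" "\<exists>X\<in>L. \<forall>c. transpose X *v v \<noteq> c *\<^sub>R v"
proof -
  let ?G = "SL3\<lparr>carrier := \<Gamma>\<rparr>"
  note G = group_restrict_SL3[OF \<Gamma>]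
  have inv: "inv\<^bsub>?G\<^esub> g = matrix_inv g" if "g \<in> \<Gamma>" for g
    using group.m_inv_consistent[OF group_SL3 \<Gamma> that] inv_SL3 SL3_subgroup_det[OF \<Gamma> that] by simp
  note inv1 = det_matrix_inv_1[OF SL3_subgroup_det[OF \<Gamma>]]
  show "\<exists>X\<in>L. \<forall>c. X *v v \<noteq> c *\<^sub>R v"
  proof (rule ccontr)
    assume "\<not> ?thesis"
    then have "\<forall>X\<in>L. \<exists>c. X *v v = c *\<^sub>R v"
      by blast
    with v obtain V \<Delta> where "subspace V" "V \<noteq> {0}" "V \<noteq> UNIV" "finite_index_subgroup \<Delta> ?G"
      "\<And>g x. g \<in> \<Delta> \<Longrightarrow> x \<in> V \<Longrightarrow> g *v x \<in> V"
      using common_eigenvector_imp_stabilized_subspace[OF G, of "\<lambda>g. g" L v D] D conj inv by auto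
    then show False
      using invariant_subspace_imp_elementary[OF \<Gamma>] ne by blast
  qed
  show "\<exists>X\<in>L. \<forall>c. transpose X *v v \<noteq> c *\<^sub>R v"
  proof (rule ccontr)
    assume "\<not> ?thesis"
    then have *: "\<forall>X\<in>transpose ` L. \<exists>c. X *v v = c *\<^sub>R v"
      by blast
    \<comment> \<open>The contragredient representation, under which the group normalises the
      transposed algebra.\<close>
    define \<rho> where "\<rho> g = transpose (matrix_inv g)" for g :: "real^3^3"
    have inv_inv: "matrix_inv (matrix_inv g) = g" if "g \<in> \<Gamma>" for g
      using matrix_inv_eqI[of "matrix_inv g" g] inv1[OF that] by simp
    have mult: "\<rho> (g ** h) = \<rho> g ** \<rho> h" if "g \<in> \<Gamma>" "h \<in> \<Gamma>" for g h
    proof -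
      have "g ** h ** (matrix_inv h ** matrix_inv g) = g ** (h ** matrix_inv h) ** matrix_inv g"
        "matrix_inv h ** matrix_inv g ** (g ** h) = matrix_inv h ** (matrix_inv g ** g) ** h"
        by (simp_all add: matrix_mul_assoc)
      then have "matrix_inv (g ** h) = matrix_inv h ** matrix_inv g"
        using inv1[OF that(1)] inv1[OF that(2)] by (intro matrix_inv_eqI) simp_all
      then show ?thesis
        by (simp add: \<rho>_def matrix_transpose_mul)
    qed
    have one: "\<rho> (mat 1) = mat 1"
      by (simp add: \<rho>_def matrix_inv_eqI[of "mat 1" "mat 1"])
    have conj_T: "\<rho> g ** X ** \<rho> (matrix_inv g) \<in> transpose ` L" if "g \<in> \<Gamma>" "X \<in> transpose ` L" for g X
    proof -
      obtain Y where Y: "Y \<in> L" "X = transpose Y"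
        using \<open>X \<in> transpose ` L\<close> by blast
      have "\<rho> g ** X ** \<rho> (matrix_inv g) = transpose (g ** Y ** matrix_inv g)"
        using inv_inv[OF that(1)] by (simp add: Y \<rho>_def matrix_transpose_mul matrix_mul_assoc)
      then show ?thesis
        using conj[OF that(1) Y(1)] by blast
    qed
    have D_T: "transpose D \<noteq> mat c" for c
      using D(2) by (metis transpose_mat transpose_transpose)
    have G_mult: "\<rho> (g \<otimes>\<^bsub>?G\<^esub> h) = \<rho> g ** \<rho> h" if "g \<in> carrier ?G" "h \<in> carrier ?G" for g h
      using that mult by simp
    have G_one: "\<rho> \<one>\<^bsub>?G\<^esub> = mat 1"
      using one by simp
    have G_conj: "\<rho> g ** X ** \<rho> (inv\<^bsub>?G\<^esub> g) \<in> transpose ` L" if "g \<in> carrier ?G" "X \<in> transpose ` L" for g X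
      using that conj_T inv by simp
    have "\<exists>V \<Delta>. subspace V \<and> V \<noteq> {0} \<and> V \<noteq> UNIV \<and> finite_index_subgroup \<Delta> ?G \<and>
        (\<forall>g\<in>\<Delta>. \<forall>x\<in>V. \<rho> g *v x \<in> V)"
      by (rule common_eigenvector_imp_stabilized_subspace[OF G G_mult G_one G_conj v *
            imageI[OF D(1)] D_T]) blast+
    then obtain V \<Delta> where V: "subspace V" "V \<noteq> {0}" "V \<noteq> UNIV" "finite_index_subgroup \<Delta> ?G"
      and \<Delta>: "\<And>g x. g \<in> \<Delta> \<Longrightarrow> x \<in> V \<Longrightarrow> \<rho> g *v x \<in> V"
      by blast
    have "transpose g *v x \<in> V" if "g \<in> \<Delta>" "x \<in> V" for g x
    proof -
      have "matrix_inv g \<in> \<Delta>" "g \<in> \<Gamma>"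
        using SL3_subgroup_inv finite_index_subgroup_SL3[OF \<Gamma> V(4)] that(1) by blast+
      then show ?thesis
        using \<Delta>[of "matrix_inv g" x] that(2) inv_inv by (simp add: \<rho>_def)
    qed
    then show False
      using invariant_subspace_imp_elementary[OF \<Gamma> V(4) V(1-3)] ne by blast
  qed
qed

section \<open>Groups with bounded traces\<close>

text \<open>The supremum \<open>N\<close> of the norm over an orbit is an invariant norm which is strictly convex by the
  parallelogram law, so its minimiser on \<open>C\<close> is unique and therefore fixed.\<close>

lemma bounded_linear_group_fixed_point:
  fixes \<T> :: "('a::real_inner \<Rightarrow> 'a) set"
  assumes lin: "\<And>T. T \<in> \<T> \<Longrightarrow> linear T"
    and comp: "\<And>S T. S \<in> \<T> \<Longrightarrow> T \<in> \<T> \<Longrightarrow> S \<circ> T \<in> \<T>"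
    and inverse: "\<And>T. T \<in> \<T> \<Longrightarrow> \<exists>S\<in>\<T>. (\<forall>x. S (T x) = x) \<and> (\<forall>x. T (S x) = x)"
    and bound: "\<And>T x. T \<in> \<T> \<Longrightarrow> norm (T x) \<le> K * norm x"
    and C: "compact C" "convex C" "C \<noteq> {}" "\<And>T x. T \<in> \<T> \<Longrightarrow> x \<in> C \<Longrightarrow> T x \<in> C"
  shows "\<exists>x\<in>C. \<forall>T\<in>\<T>. T x = x"
proof (cases "\<T> = {}")
  case False
  define N where "N x = (SUP T\<in>\<T>. norm (T x))" for x :: 'a
  have bdd: "bdd_above ((\<lambda>T. norm (T x)) ` \<T>)" for x
    using bound by (intro bdd_aboveI2)
  have N_ge: "norm (T x) \<le> N x" if "T \<in> \<T>" for T x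
    unfolding N_def by (rule cSUP_upper[OF that bdd])
  have N_le: "N x \<le> c" if "\<And>T. T \<in> \<T> \<Longrightarrow> norm (T x) \<le> c" for x c
    unfolding N_def using False that by (intro cSUP_least)
  have N_lip: "N x \<le> N y + K * norm (x - y)" for x y
  proof (rule N_le)
    fix T assume T: "T \<in> \<T>"
    have "T x = T y + T (x - y)"
      using linear_diff[OF lin[OF T]] by simp
    then have "norm (T x) \<le> norm (T y) + norm (T (x - y))"
      using norm_triangle_ineq by metis
    then show "norm (T x) \<le> N y + K * norm (x - y)"
      using N_ge[OF T, of y] bound[OF T, of "x - y"] by linarith
  qed
  have "continuous_on C N"
  proof (rule continuous_on_subset[OF _ subset_UNIV], rule uniformly_continuous_imp_continuous,
      rule lipschitz_on_uniformly_continuous)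
    show "\<bar>K\<bar>-lipschitz_on UNIV N"
    proof (rule lipschitz_onI)
      fix x y :: 'a
      have "K * norm (x - y) \<le> \<bar>K\<bar> * norm (x - y)"
        by (intro mult_right_mono) auto
      then show "dist (N x) (N y) \<le> \<bar>K\<bar> * dist x y"
        using N_lip[of x y] N_lip[of y x] by (simp add: dist_norm norm_minus_commute abs_le_iff)
    qed simp
  qed
  then obtain s where s: "s \<in> C" "\<And>x. x \<in> C \<Longrightarrow> N s \<le> N x"
    using continuous_attains_inf[OF C(1,3)] by blast
  have unique: "x = s" if x: "x \<in> C" "N x \<le> N s" for x
  proof (rule ccontr)
    assume "x \<noteq> s"
    define y where "y = (1/2) *\<^sub>R x + (1/2) *\<^sub>R s"
    have "y \<in> C"
      unfolding y_def using convexD[OF C(2) x(1) s(1), of "1/2" "1/2"] by simp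
    \<comment> \<open>A lower bound, uniform over the group, for the norms of the images of
      \<open>x - s\<close>; it comes from the bound \<open>K\<close> for the inverse operators. The
      summand 1 keeps the denominator positive.\<close>
    define \<delta> where "\<delta> = norm (x - s) / (\<bar>K\<bar> + 1)"
    have "\<delta> > 0"
      using \<open>x \<noteq> s\<close> by (simp add: \<delta>_def add_nonneg_pos)
    have low: "norm (T (x - s)) \<ge> \<delta>" if T: "T \<in> \<T>" for T
    proof -
      obtain S where S: "S \<in> \<T>" "S (T (x - s)) = x - s"
        using inverse[OF T] by blast
      have "norm (x - s) \<le> K * norm (T (x - s))"
        using bound[OF S(1), of "T (x - s)"] S(2) by simp
      also have "\<dots> \<le> (\<bar>K\<bar> + 1) * norm (T (x - s))"
        by (intro mult_right_mono) auto
      finally show ?thesis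
        by (simp add: \<delta>_def divide_le_eq mult.commute add_nonneg_pos)
    qed
    have "norm (T y) \<le> sqrt ((N s)\<^sup>2 - \<delta>\<^sup>2 / 4)" if T: "T \<in> \<T>" for T
    proof -
      define a b where "a = T x" and "b = T s"
      have Ty: "T y = (1/2) *\<^sub>R a + (1/2) *\<^sub>R b"
        by (simp add: y_def a_def b_def linear_add[OF lin[OF T]] linear_cmul[OF lin[OF T]])
      have "(norm (T y))\<^sup>2 = ((norm a)\<^sup>2 + (norm b)\<^sup>2) / 2 - (norm (a - b))\<^sup>2 / 4"
        unfolding Ty power2_norm_eq_inner by (simp add: inner_simps inner_commute[of b a]) (simp add: field_simps)
      moreover have "(norm a)\<^sup>2 \<le> (N s)\<^sup>2" "(norm b)\<^sup>2 \<le> (N s)\<^sup>2"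
        unfolding a_def b_def using N_ge[OF T, of x] N_ge[OF T, of s] x(2) by (auto intro!: power_mono)
      moreover have "\<delta>\<^sup>2 \<le> (norm (a - b))\<^sup>2"
        using low[OF T] \<open>\<delta> > 0\<close> unfolding a_def b_def linear_diff[OF lin[OF T], symmetric]
        by (intro power_mono) auto
      moreover have "p \<le> n - d / 4" if "p = (q + r) / 2 - u / 4" "q \<le> n" "r \<le> n" "d \<le> u"
        for p q r u n d :: real
        using that by (simp add: field_simps)
      ultimately have "(norm (T y))\<^sup>2 \<le> (N s)\<^sup>2 - \<delta>\<^sup>2 / 4"
        by metis
      then show ?thesis
        by (rule real_le_rsqrt)
    qed
    then have "N y \<le> sqrt ((N s)\<^sup>2 - \<delta>\<^sup>2 / 4)"
      by (rule N_le)
    also have "\<dots> < sqrt ((N s)\<^sup>2)"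
      by (rule real_sqrt_less_mono) (use \<open>\<delta> > 0\<close> in simp)
    also have "\<dots> = N s"
    proof -
      obtain T where "T \<in> \<T>" using False by blast
      then have "0 \<le> N s" using N_ge[of T s] norm_ge_zero order_trans by blast
      then show ?thesis by simp
    qed
    finally show False
      using s(2)[OF \<open>y \<in> C\<close>] by simp
  qed
  have "T s = s" if T: "T \<in> \<T>" for T
  proof (rule unique)
    show "T s \<in> C"
      using C(4) T s(1) by blast
    show "N (T s) \<le> N s"
      by (rule N_le) (use N_ge[OF comp[OF _ T], of _ s] in simp)
  qed
  with s(1) show ?thesis
    by blast
qed (use C(3) in blast)

lemma bounded_bilinear_matrix_mul: "bounded_bilinear ((**) :: real^'n^'m \<Rightarrow> real^'k^'n \<Rightarrow> real^'k^'m)"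
  by (subst bilinear_conv_bounded_bilinear[symmetric])
    (simp add: bilinear_def linear_matrix_mul_left linear_matrix_mul_right)

lemma linear_transpose: "linear (transpose :: real^'n^'m \<Rightarrow> real^'m^'n)"
  by (rule linearI) (simp_all add: transpose_def vec_eq_iff)

text \<open>Fixed points of the action on symmetric matrices include 0, so the convex set must avoid
  it. It is the closed convex hull of the orbit of the identity, on which the trace stays above a
  positive constant.\<close>

lemma bounded_imp_fixes_dual_conic:
  assumes \<Gamma>: "subgroup \<Gamma> SL3" and bdd: "bounded \<Gamma>"
  shows "fixes_dual_conic \<Gamma>"
proof -
  note inv1 = det_matrix_inv_1[OF SL3_subgroup_det[OF \<Gamma>]]
  have det: "\<forall>g\<in>\<Gamma>. det g = 1"
    using SL3_subgroup_det[OF \<Gamma>] by blast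
  obtain M where M: "\<And>g. g \<in> \<Gamma> \<Longrightarrow> norm g \<le> M" "M > 0"
    using bdd unfolding bounded_pos by blast
  obtain K1 where K1: "K1 > 0" "\<And>(A :: real^3^3) (B :: real^3^3). norm (A ** B) \<le> norm A * norm B * K1"
    using bounded_bilinear.pos_bounded[OF bounded_bilinear_matrix_mul] by blast
  obtain K2 where K2: "K2 > 0" "\<And>A :: real^3^3. norm (transpose A) \<le> norm A * K2"
    using bounded_linear.pos_bounded linear_transpose linear_conv_bounded_linear by blast
  define T where "T g S = g ** S ** transpose g" for g S :: "real^3^3"
  define K where "K = M * K1 * (M * K2) * K1"
  have bound: "norm (T g S) \<le> K * norm S" if "g \<in> \<Gamma>" for g S
  proof -
    have "norm (g ** S) \<le> M * norm S * K1"
      using K1(2)[of g S] mult_right_mono[OF M(1)[OF that], of "norm S * K1"] K1(1)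
      by (simp add: mult.assoc)
    moreover have "norm (transpose g) \<le> M * K2"
      by (rule order_trans[OF K2(2)[of g] mult_right_mono[OF M(1)[OF that] less_imp_le[OF K2(1)]]])
    ultimately have "norm (g ** S) * norm (transpose g) * K1 \<le> M * norm S * K1 * (M * K2) * K1"
      using K1(1) M(2) K2(1) by (intro mult_right_mono mult_mono) auto
    then show ?thesis
      unfolding T_def K_def using K1(2)[of "g ** S" "transpose g"] by (simp add: mult_ac)
  qed
  have linT: "linear (T g)" for g
    unfolding T_def by (rule linear_congruence)
  have comp: "T g (T h S) = T (g ** h) S" for g h S
    by (simp add: T_def matrix_transpose_mul matrix_mul_assoc)
  have T1: "T (mat 1) S = S" for S
    by (simp add: T_def transpose_mat)
  define C where "C = closure (convex hull ((\<lambda>g. T g (mat 1)) ` \<Gamma>))"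
  have "\<exists>S\<in>C. \<forall>T\<in>T ` \<Gamma>. T S = S"
  proof (rule bounded_linear_group_fixed_point)
    have "bounded ((\<lambda>g. T g (mat 1)) ` \<Gamma>)"
      using bound[of _ "mat 1"] by (auto simp: bounded_iff)
    then show "compact C"
      unfolding C_def by (simp add: bounded_convex_hull)
    show "convex C"
      unfolding C_def by (simp add: convex_closure)
    show "C \<noteq> {}"
      unfolding C_def using SL3_subgroup_one[OF \<Gamma>] by (auto simp: closure_eq_empty)
    show "t x \<in> C" if t: "t \<in> T ` \<Gamma>" and "x \<in> C" for t x
    proof -
      obtain g where g: "g \<in> \<Gamma>" "t = T g"
        using t by blast
      have "t ` (convex hull ((\<lambda>g. T g (mat 1)) ` \<Gamma>)) = convex hull (t ` (\<lambda>g. T g (mat 1)) ` \<Gamma>)"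
        unfolding g using linT convex_hull_linear_image by metis
      also have "\<dots> \<subseteq> convex hull ((\<lambda>g. T g (mat 1)) ` \<Gamma>)"
        using SL3_subgroup_mult[OF \<Gamma> g(1)] by (intro hull_mono) (auto simp: g comp)
      finally have sub: "t ` (convex hull ((\<lambda>g. T g (mat 1)) ` \<Gamma>)) \<subseteq> C"
        unfolding C_def using closure_subset by blast
      have "t ` C \<subseteq> closure (t ` (convex hull ((\<lambda>g. T g (mat 1)) ` \<Gamma>)))"
        unfolding C_def g using linT linear_conv_bounded_linear
        by (intro continuous_image_closure_subset[OF linear_continuous_on[where s = UNIV]]) auto
      also have "\<dots> \<subseteq> C"
        by (rule closure_minimal[OF sub]) (simp add: C_def)
      finally have "t ` C \<subseteq> C" .
      then show ?thesis
        using that by blast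
    qed
    show "\<exists>S\<in>T ` \<Gamma>. (\<forall>x. S (t x) = x) \<and> (\<forall>x. t (S x) = x)" if t: "t \<in> T ` \<Gamma>" for t
    proof -
      obtain g where g: "g \<in> \<Gamma>" "t = T g"
        using t by blast
      then show ?thesis
        using SL3_subgroup_inv[OF \<Gamma> g(1)] by (intro bexI[of _ "T (matrix_inv g)"]) (simp_all add: comp inv1 T1)
    qed
    show "s \<circ> t \<in> T ` \<Gamma>" if "s \<in> T ` \<Gamma>" "t \<in> T ` \<Gamma>" for s t
      using that SL3_subgroup_mult[OF \<Gamma>] by (force simp: o_def comp)
  qed (use bound linT in auto)
  then obtain S where S: "S \<in> C" "\<And>g. g \<in> \<Gamma> \<Longrightarrow> T g S = S"
    by blast
  \<comment> \<open>From 1 = g g^-1 the norm of \<open>g\<close> is at least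
    \<open>norm (mat 1) / (M * K1)\<close>, and the trace of g g^T is the square of that norm. The
    inner product with \<open>mat 1\<close> is the trace.\<close>
  define c where "c = (norm (mat 1 :: real^3^3) / (M * K1))\<^sup>2"
  have "norm (mat 1 :: real^3^3) > 0"
    by (simp add: vec_eq_iff mat_def)
  then have "c > 0"
    using M(2) K1(1) by (simp add: c_def)
  have "c \<le> mat 1 \<bullet> T g (mat 1)" if "g \<in> \<Gamma>" for g
  proof -
    have "norm (mat 1 :: real^3^3) \<le> norm g * norm (matrix_inv g) * K1"
      using K1(2)[of g "matrix_inv g"] inv1[OF that] by simp
    also have "\<dots> \<le> norm g * M * K1"
      using M(1)[OF SL3_subgroup_inv[OF \<Gamma> that]] K1(1) by (intro mult_right_mono mult_left_mono) auto
    finally have "norm (mat 1 :: real^3^3) / (M * K1) \<le> norm g"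
      using M(2) K1(1) by (simp add: divide_le_eq mult.assoc)
    then have "c \<le> (norm g)\<^sup>2"
      unfolding c_def using M(2) K1(1) by (intro power_mono) auto
    also have "(norm g)\<^sup>2 = mat 1 \<bullet> T g (mat 1)"
      by (simp add: power2_norm_eq_inner T_def inner_vec_def sum_3 matrix_mult_entry_3 mat_entry transpose_entry)
    finally show ?thesis .
  qed
  then have "(\<lambda>g. T g (mat 1)) ` \<Gamma> \<subseteq> {S. transpose S = S} \<inter> {S. mat 1 \<bullet> S \<ge> c}"
    by (auto simp: T_def matrix_transpose_mul transpose_mat)
  moreover have sub: "subspace {S :: real^3^3. transpose S = S}"
    using linear_transpose[where 'n = 3 and 'm = 3] by (auto simp: subspace_def linear_0 linear_add linear_cmul)
  ultimately have "C \<subseteq> {S. transpose S = S} \<inter> {S. mat 1 \<bullet> S \<ge> c}"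
    unfolding C_def
    by (intro closure_minimal hull_minimal convex_Int subspace_imp_convex[OF sub] convex_halfspace_ge
        closed_Int closed_subspace[OF sub] closed_halfspace_ge)
  then have "transpose S = S" "S \<noteq> 0"
    using S(1) \<open>c > 0\<close> by auto
  moreover have "\<forall>g\<in>\<Gamma>. g ** S ** transpose g \<in> span {S}"
    using S(2) span_base[of S "{S}"] by (simp add: T_def)
  ultimately show ?thesis
    unfolding fixes_dual_conic_iff[OF det] by blast
qed

section \<open>Nil ideals and degenerate trace forms\<close>

lemma cayley_hamilton_3:
  fixes A :: "real^3^3"
  shows "A ** A ** A = trace A *\<^sub>R (A ** A) - principal_minors A *\<^sub>R A + det A *\<^sub>R mat 1"
  by (rule mat3_eqI) (simp_all add: matrix_mult_entry_3 mat_entry trace_3 principal_minors_def det_3 algebra_simps)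

lemma trace_scaleR: "trace (c *\<^sub>R A) = c * trace (A :: real^'n^'n)"
  by (simp add: trace_def sum_distrib_left)

text \<open>Newton's identities: vanishing power sums up to degree 3 make all lower coefficients of
  the characteristic polynomial vanish, and Cayley-Hamilton finishes.\<close>

lemma traceless_powers_imp_nilpotent:
  fixes A :: "real^3^3"
  assumes "trace A = 0" "trace (A ** A) = 0" "trace (A ** A ** A) = 0"
  shows "A ** A ** A = 0"
proof -
  have "2 * principal_minors A = (trace A)\<^sup>2 - trace (A ** A)"
    by (simp add: principal_minors_def trace_3 matrix_mult_entry_3 power2_eq_square algebra_simps)
  then have pm: "principal_minors A = 0"
    using assms by simp
  have "trace (A ** A ** A) = trace (det A *\<^sub>R mat 1 :: real^3^3)"
    by (subst cayley_hamilton_3) (simp add: assms(1) pm)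
  then have "det A = 0"
    using assms(3) by (simp add: trace_scaleR trace_I)
  then show ?thesis
    by (subst cayley_hamilton_3) (simp add: assms(1) pm)
qed

lemma span_matrix_mul_closed:
  fixes \<Gamma> :: "(real^'n^'n) set"
  assumes mult: "\<And>g h. g \<in> \<Gamma> \<Longrightarrow> h \<in> \<Gamma> \<Longrightarrow> g ** h \<in> \<Gamma>" and "x \<in> span \<Gamma>" "y \<in> span \<Gamma>"
  shows "x ** y \<in> span \<Gamma>"
proof -
  have left: "g ** y \<in> span \<Gamma>" if g: "g \<in> \<Gamma>" for g
  proof -
    have "(**) g ` span \<Gamma> = span ((**) g ` \<Gamma>)"
      by (rule span_linear_image[OF linear_matrix_mul_left, symmetric])
    also have "\<dots> \<subseteq> span \<Gamma>"
      using mult[OF g] by (intro span_mono) auto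
    finally show ?thesis
      using assms(3) by blast
  qed
  have "(\<lambda>x. x ** y) ` span \<Gamma> = span ((\<lambda>x. x ** y) ` \<Gamma>)"
    by (rule span_linear_image[OF linear_matrix_mul_right, symmetric])
  also have "\<dots> \<subseteq> span \<Gamma>"
    using left by (intro span_minimal) auto
  finally show ?thesis
    using assms(2) by blast
qed

text \<open>A nonzero \<open>x\<close> of minimal rank in the nil ideal \<open>J\<close> satisfies \<open>x b x = 0\<close> for all \<open>b\<close> in the
  algebra, since \<open>x b\<close> is nilpotent and hence not injective on the range of \<open>x\<close>.\<close>

lemma nil_ideal_imp_square_zero:
  fixes J R :: "(real^'n^'n) set"
  assumes J: "\<And>x b. x \<in> J \<Longrightarrow> b \<in> R \<Longrightarrow> x ** b \<in> J" "\<And>x y. x \<in> J \<Longrightarrow> y \<in> J \<Longrightarrow> x ** y \<in> J"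
    and nil: "\<And>x. x \<in> J \<Longrightarrow> x ** x ** x = 0"
    and a: "a \<in> J" "a \<noteq> 0"
  obtains x where "x \<in> J" "x \<noteq> 0" "\<And>b. b \<in> R \<Longrightarrow> x ** b ** x = 0"
proof -
  define rk where "rk x = dim (range (\<lambda>v. x *v v))" for x :: "real^'n^'n"
  obtain x where x: "x \<in> J" "x \<noteq> 0" and min: "\<And>y. y \<in> J \<Longrightarrow> y \<noteq> 0 \<Longrightarrow> rk x \<le> rk y"
    using ex_has_least_nat[of "\<lambda>x. x \<in> J \<and> x \<noteq> 0" a rk] a by blast
  have "x ** b ** x = 0" if b: "b \<in> R" for b
  proof (rule ccontr)
    assume ne: "x ** b ** x \<noteq> 0"
    define y where "y = x ** b"
    have yJ: "y \<in> J"
      unfolding y_def using J(1) x(1) b .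
    have sub: "range (\<lambda>v. (y ** x) *v v) \<subseteq> range (\<lambda>v. x *v v)"
      unfolding y_def by (auto simp: matrix_vector_mul_assoc[symmetric])
    have subsp: "subspace (range (\<lambda>v. A *v v))" for A :: "real^'n^'n"
      by (intro linear_subspace_image matrix_vector_mul_linear subspace_UNIV)
    have "rk x \<le> rk (y ** x)"
      using min[OF J(2)[OF yJ x(1)]] ne by (simp add: y_def)
    then have eq: "range (\<lambda>v. (y ** x) *v v) = range (\<lambda>v. x *v v)"
      using sub subsp unfolding rk_def by (metis subspace_dim_equal)
    \<comment> \<open>By minimality of the rank, \<open>y\<close> maps the range of \<open>x\<close>
      onto itself. Going back three steps meets the nilpotency y^3 = 0.\<close>
    have step: "\<exists>w. x *v v = y *v (x *v w)" for v
      using eq by (metis (no_types, lifting) image_iff matrix_vector_mul_assoc rangeI)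
    have "x *v v = 0" for v
    proof -
      obtain w1 where w1: "x *v v = y *v (x *v w1)" using step by blast
      obtain w2 where w2: "x *v w1 = y *v (x *v w2)" using step by blast
      obtain w3 where w3: "x *v w2 = y *v (x *v w3)" using step by blast
      have "x *v v = (y ** y ** y) *v (x *v w3)"
        unfolding w1 w2 w3 by (simp add: matrix_vector_mul_assoc matrix_mul_assoc)
      then show ?thesis
        using nil[OF yJ] by simp
    qed
    then show False
      using x(2) by (metis matrix_eq matrix_vector_mult_0)
  qed
  with x that show thesis
    by blast
qed

text \<open>For elements of growing norm, a limit \<open>a\<close> of the normalised matrices is
  nonzero, but trace(a b) = 0 for all b in \<Gamma> since the traces of the products stay bounded.
  So \<open>J\<close>, the radical of the trace form on the algebra \<open>R\<close>, is nonzero. By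
  Newton's identities it is nil, hence contains x \<noteq> 0 with x R x = 0.\<close>

lemma unbounded_bounded_traces_imp_elementary:
  assumes \<Gamma>: "subgroup \<Gamma> SL3" and unbdd: "\<not> bounded \<Gamma>" and tr: "\<And>g. g \<in> \<Gamma> \<Longrightarrow> \<bar>trace g\<bar> \<le> 3"
  shows "elementary \<Gamma>"
proof -
  note mult = SL3_subgroup_mult[OF \<Gamma>]
  define R where "R = span \<Gamma>"
  define J where "J = {x \<in> R. \<forall>b\<in>R. trace (x ** b) = 0}"
  have R_mult: "x ** y \<in> R" if "x \<in> R" "y \<in> R" for x y
    using that mult span_matrix_mul_closed unfolding R_def by blast
  have "\<exists>g\<in>\<Gamma>. norm g > real n" for n
    using unbdd unfolding bounded_iff by (meson not_le)
  then obtain G where G: "\<And>n. G n \<in> \<Gamma>" "\<And>n. norm (G n) > real n"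
    by metis
  define A where "A n = G n /\<^sub>R norm (G n)" for n
  have pos: "norm (G n) > 0" for n
    using G(2)[of n] of_nat_0_le_iff[of n] by linarith
  have "A n \<in> sphere 0 1" for n
    using pos[of n] by (simp add: A_def)
  then obtain a r where a: "a \<in> sphere 0 1" "strict_mono r" "(A \<circ> r) \<longlonglongrightarrow> a"
    using compact_sphere[of "0 :: real^3^3" 1] unfolding compact_def by metis
  have "A n \<in> R" for n
    unfolding A_def R_def using G(1) by (intro span_scale span_base)
  then have aR: "a \<in> R"
    using closed_sequentially[OF closed_subspace[of R] _ a(3)] by (auto simp: R_def)
  have lin: "linear (\<lambda>x. trace (x ** b))" for b :: "real^3^3"
    by (rule linearI) (simp_all add: matrix_distribs trace_add trace_scaleR)
  have tr_a: "trace (a ** b) = 0" if b: "b \<in> \<Gamma>" for b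
  proof -
    have "(\<lambda>n. trace ((A \<circ> r) n ** b)) \<longlonglongrightarrow> trace (a ** b)"
      by (rule bounded_linear.tendsto[OF _ a(3)]) (use lin linear_conv_bounded_linear in blast)
    moreover have "(\<lambda>n. trace ((A \<circ> r) n ** b)) \<longlonglongrightarrow> 0"
    proof (rule Lim_null_comparison)
      have "norm (trace (A (r n) ** b)) \<le> 3 * inverse (real n)" if "n > 0" for n
      proof -
        have "norm (G (r n)) > real n"
          using G(2)[of "r n"] seq_suble[OF a(2), of n] by (meson le_less_trans of_nat_le_iff)
        then have le: "inverse (norm (G (r n))) \<le> inverse (real n)"
          using \<open>n > 0\<close> by (simp add: le_imp_inverse_le)
        have "norm (trace (A (r n) ** b)) = inverse (norm (G (r n))) * \<bar>trace (G (r n) ** b)\<bar>"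
          by (simp add: A_def matrix_distribs trace_scaleR abs_mult)
        also have "\<dots> \<le> inverse (real n) * 3"
          using le tr[OF mult[OF G(1)[of "r n"] b]] by (intro mult_mono) auto
        finally show ?thesis by simp
      qed
      then show "\<forall>\<^sub>F n in sequentially. norm (trace ((A \<circ> r) n ** b)) \<le> 3 * inverse (real n)"
        unfolding eventually_sequentially o_def by (intro exI[of _ 1]) auto
      show "(\<lambda>n. 3 * inverse (real n)) \<longlonglongrightarrow> 0"
        by (rule tendsto_mult_right_zero[OF lim_inverse_n])
    qed
    ultimately show ?thesis
      using LIMSEQ_unique by blast
  qed
  have "linear (\<lambda>b. trace (a ** b))"
    by (rule linearI) (simp_all add: matrix_distribs trace_add trace_scaleR)
  then have "trace (a ** b) = 0" if "b \<in> R" for b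
    using linear_eq_0_on_span[of "\<lambda>b. trace (a ** b)" \<Gamma>] tr_a that unfolding R_def by blast
  then have aJ: "a \<in> J"
    using aR by (simp add: J_def)
  have J_right: "x ** b \<in> J" if "x \<in> J" "b \<in> R" for x b
    using that R_mult by (auto simp: J_def simp flip: matrix_mul_assoc)
  have J_sub: "J \<subseteq> R"
    by (auto simp: J_def)
  have "x ** x ** x = 0" if x: "x \<in> J" for x
  proof (rule traceless_powers_imp_nilpotent)
    have one: "mat 1 \<in> R"
      unfolding R_def using SL3_subgroup_one[OF \<Gamma>] by (rule span_base)
    then show "trace x = 0"
      using x one unfolding J_def by (metis (mono_tags, lifting) matrix_mul_rid mem_Collect_eq)
    have "x \<in> R" "x ** x \<in> R"
      using x R_mult J_sub by auto
    then show "trace (x ** x) = 0" "trace (x ** x ** x) = 0"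
      using x by (auto simp: J_def simp flip: matrix_mul_assoc)
  qed
  moreover have "a \<noteq> 0"
    using a(1) by auto
  ultimately obtain x where x: "x \<in> J" "x \<noteq> 0" "\<And>b. b \<in> R \<Longrightarrow> x ** b ** x = 0"
    using nil_ideal_imp_square_zero[of J R a] J_right J_sub aJ by blast
  then obtain w where w: "x *v w \<noteq> 0"
    by (metis matrix_eq matrix_vector_mult_0)
  \<comment> \<open>The submodule generated by \<open>x *v w\<close>. It is annihilated by
    \<open>x\<close> because x R x = 0, hence proper.\<close>
  define V where "V = (\<lambda>b. b *v (x *v w)) ` R"
  show ?thesis
  proof (rule invariant_subspace_imp_elementary[OF \<Gamma>])
    show "finite_index_subgroup \<Gamma> (SL3\<lparr>carrier := \<Gamma>\<rparr>)"
      using finite_index_subgroup_self[OF group_restrict_SL3[OF \<Gamma>]] by simp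
    have "linear (\<lambda>b. b *v (x *v w))"
      by (rule linearI) (simp_all add: matrix_vector_mult_add_rdistrib scaleR_matrix_vector_assoc)
    then show "subspace V"
      unfolding V_def R_def by (intro linear_subspace_image subspace_span)
    have "mat 1 *v (x *v w) \<in> V"
      unfolding V_def R_def using SL3_subgroup_one[OF \<Gamma>] by (intro imageI span_base)
    then show "V \<noteq> {0}"
      using w by auto
    have "x *v v = 0" if v: "v \<in> V" for v
    proof -
      obtain b where b: "b \<in> R" "v = b *v (x *v w)"
        using v unfolding V_def by blast
      then have "x *v v = (x ** b ** x) *v w"
        by (simp add: matrix_vector_mul_assoc matrix_mul_assoc)
      then show ?thesis
        using x(3)[OF b(1)] by simp
    qed
    then show "V \<noteq> UNIV"
      using w by blast
    have "g *v v \<in> V" if "g \<in> \<Gamma>" "v \<in> V" for g v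
    proof -
      obtain b where b: "b \<in> R" "v = b *v (x *v w)"
        using \<open>v \<in> V\<close> unfolding V_def by blast
      have "g ** b \<in> R"
        using R_mult[OF _ b(1)] that(1) by (simp add: R_def span_base)
      moreover have "g *v v = (g ** b) *v (x *v w)"
        by (simp add: b(2) matrix_vector_mul_assoc matrix_mul_assoc)
      ultimately show ?thesis
        unfolding V_def by blast
    qed
    then show "(\<forall>g\<in>\<Gamma>. \<forall>x\<in>V. g *v x \<in> V) \<or> (\<forall>g\<in>\<Gamma>. \<forall>x\<in>V. transpose g *v x \<in> V)"
      by blast
  qed
qed

lemma non_elementary_imp_hyperbolic:
  assumes \<Gamma>: "subgroup \<Gamma> SL3" and "non_elementary \<Gamma>"
  obtains g where "g \<in> \<Gamma>" "\<bar>trace g\<bar> > 3"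
proof -
  have "finite_index_subgroup \<Gamma> (SL3\<lparr>carrier := \<Gamma>\<rparr>)"
    using finite_index_subgroup_self[OF group_restrict_SL3[OF \<Gamma>]] by simp
  then have "\<not> bounded \<Gamma>"
    using assms bounded_imp_fixes_dual_conic unfolding elementary_def by blast
  then show thesis
    using unbounded_bounded_traces_imp_elementary[OF \<Gamma>] assms(2) that by (meson not_le)
qed

section \<open>Irreducible Lie algebras containing a diagonal matrix\<close>

text \<open>The projection onto an eigenspace of ad D is a polynomial in ad D, by Lagrange
  interpolation. The induction multiplies its factors one eigenvalue at a time.\<close>

lemma weight_component_mem:
  fixes L :: "(real^'n^'n) set" and d :: "'n \<Rightarrow> real"
  assumes L: "subspace L" and ad: "\<And>X. X \<in> L \<Longrightarrow> (\<chi> i j. (d i - d j) * X $ i $ j) \<in> L"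
    and X: "X \<in> L"
  shows "(\<chi> i j. if d i - d j = w then X $ i $ j else 0) \<in> L"
proof -
  have "\<exists>Y\<in>L. \<forall>i j. (d i - d j = w \<longrightarrow> Y$i$j = X$i$j) \<and> (d i - d j \<in> F \<longrightarrow> Y$i$j = 0)"
    if "finite F" "w \<notin> F" for F
    using that
  proof (induction F rule: finite_induct)
    case empty
    then show ?case using X by auto
  next
    case (insert f F)
    then obtain Y where Y: "Y \<in> L" "\<And>i j. d i - d j = w \<Longrightarrow> Y$i$j = X$i$j" "\<And>i j. d i - d j \<in> F \<Longrightarrow> Y$i$j = 0"
      by auto
    \<comment> \<open>The interpolation factor (ad D - f) / (w - f): identity on weight w, zero on
      weight f.\<close>
    define Z where "Z = (1 / (w - f)) *\<^sub>R ((\<chi> i j. (d i - d j) * Y $ i $ j) - f *\<^sub>R Y)"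
    have "Z \<in> L"
      unfolding Z_def using L ad[OF Y(1)] Y(1) by (intro subspace_scale subspace_diff)
    moreover have entry: "Z $ i $ j = (d i - d j - f) * Y $ i $ j / (w - f)" for i j
      by (simp add: Z_def left_diff_distrib)
    have "Z$i$j = X$i$j" if "d i - d j = w" for i j
      using insert.prems that Y(2)[OF that] unfolding entry by auto
    moreover have "Z$i$j = 0" if "d i - d j \<in> insert f F" for i j
      using that Y(3) unfolding entry by auto
    ultimately show ?case
      by blast
  qed
  from this[of "(\<lambda>(i, j). d i - d j) ` UNIV - {w}"]
  obtain Y where Y: "Y \<in> L" "\<And>i j. d i - d j = w \<Longrightarrow> Y$i$j = X$i$j"
    "\<And>i j. d i - d j \<in> (\<lambda>(i, j). d i - d j) ` UNIV - {w} \<Longrightarrow> Y$i$j = 0"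
    by auto
  have "d i - d j \<in> (\<lambda>(i, j). d i - d j) ` UNIV" for i j
    by (rule image_eqI[of _ _ "(i, j)"]) simp_all
  then have "Y = (\<chi> i j. if d i - d j = w then X $ i $ j else 0)"
    using Y(2,3) by (auto simp: vec_eq_iff)
  with Y(1) show ?thesis
    by simp
qed

lemma matrix_vector_mult_entry_3: "((A::real^3^3) *v v) $ i = A$i$1 * v$1 + A$i$2 * v$2 + A$i$3 * v$3"
  by (simp add: matrix_vector_mult_def sum_3)

lemma matrix_unit_3:
  "matrix_unit 1 2 = mat3 0 1 0 0 0 0 0 0 0" "matrix_unit 1 3 = mat3 0 0 1 0 0 0 0 0 0"
  "matrix_unit 2 1 = mat3 0 0 0 1 0 0 0 0 0" "matrix_unit 2 3 = mat3 0 0 0 0 0 1 0 0 0"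
  "matrix_unit 3 1 = mat3 0 0 0 0 0 0 1 0 0" "matrix_unit 3 2 = mat3 0 0 0 0 0 0 0 1 0"
  by (rule mat3_eqI; simp add: matrix_unit_def)+

lemma mat3_scale_add:
  "r *\<^sub>R mat3 a b c d e f g h i = mat3 (r*a) (r*b) (r*c) (r*d) (r*e) (r*f) (r*g) (r*h) (r*i)"
  "mat3 a b c d e f g h i + mat3 a' b' c' d' e' f' g' h' i' =
    mat3 (a+a') (b+b') (c+c') (d+d') (e+e') (f+f') (g+g') (h+h') (i+i')"
  "mat3 a b c d e f g h i - mat3 a' b' c' d' e' f' g' h' i' =
    mat3 (a-a') (b-b') (c-c') (d-d') (e-e') (f-f') (g-g') (h-h') (i-i')"
  "transpose (mat3 a b c d e f g h i) = mat3 a d g b e h c f i"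
  by (rule mat3_eqI; simp add: transpose_entry)+

lemma mat3_mult:
  "mat3 a b c d e f g h i ** mat3 a' b' c' d' e' f' g' h' i' =
    mat3 (a*a' + b*d' + c*g') (a*b' + b*e' + c*h') (a*c' + b*f' + c*i')
      (d*a' + e*d' + f*g') (d*b' + e*e' + f*h') (d*c' + e*f' + f*i')
      (g*a' + h*d' + i*g') (g*b' + h*e' + i*h') (g*c' + h*f' + i*i')"
  by (rule mat3_eqI; simp add: matrix_mult_entry_3)

lemmas mat3_simps = mat3_scale_add mat3_mult

text \<open>In dimension 3 irreducibility means no invariant line and no invariant plane. Phrasing
  the latter as a line in the dual makes the axioms symmetric under transposition, so each argument
  about columns also serves for rows.\<close>

locale irreducible_lie_algebra =
  fixes L :: "(real^3^3) set"
  assumes subspace: "subspace L"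
    and bracket: "\<And>X Y. X \<in> L \<Longrightarrow> Y \<in> L \<Longrightarrow> X ** Y - Y ** X \<in> L"
    and traceless: "\<And>X. X \<in> L \<Longrightarrow> trace X = 0"
    and no_eigenvector: "\<And>v. v \<noteq> 0 \<Longrightarrow> \<exists>X\<in>L. \<forall>c. X *v v \<noteq> c *\<^sub>R v"
    and no_coeigenvector: "\<And>v. v \<noteq> 0 \<Longrightarrow> \<exists>X\<in>L. \<forall>c. transpose X *v v \<noteq> c *\<^sub>R v"
begin

lemma irreducible_lie_algebra_transpose: "irreducible_lie_algebra (transpose ` L)"
proof
  show "subspace (transpose ` L)"
    by (rule linear_subspace_image[OF linear_transpose subspace])
  show "X ** Y - Y ** X \<in> transpose ` L" if XY: "X \<in> transpose ` L" "Y \<in> transpose ` L" for X Y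
  proof -
    obtain A B where AB: "A \<in> L" "B \<in> L" "X = transpose A" "Y = transpose B"
      using XY by blast
    then have "X ** Y - Y ** X = transpose (B ** A - A ** B)"
      by (simp add: linear_diff[OF linear_transpose] matrix_transpose_mul)
    then show ?thesis
      using bracket[OF AB(2,1)] by blast
  qed
  show "trace X = 0" if "X \<in> transpose ` L" for X
    using that traceless by (auto simp: trace_3 transpose_entry)
qed (use no_eigenvector no_coeigenvector in \<open>simp_all only: bex_simps transpose_transpose\<close>)

lemma irreducible_lie_algebra_conjugate:
  assumes PQ: "P ** Q = mat 1" "Q ** P = mat 1"
  shows "irreducible_lie_algebra {X. P ** X ** Q \<in> L}"
proof
  have lin: "linear (\<lambda>X. P ** X ** Q)"
    by (rule linear_congruence)
  show "subspace {X. P ** X ** Q \<in> L}"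
    using linear_subspace_vimage[OF lin subspace] by (simp add: vimage_def)
  show "X ** Y - Y ** X \<in> {X. P ** X ** Q \<in> L}"
    if "X \<in> {X. P ** X ** Q \<in> L}" "Y \<in> {X. P ** X ** Q \<in> L}" for X Y
  proof -
    have *: "P ** A ** Q ** (P ** B ** Q) = P ** (A ** B) ** Q" for A B
      by (metis PQ(2) matrix_mul_assoc matrix_mul_rid)
    show ?thesis
      using bracket[of "P ** X ** Q" "P ** Y ** Q"] that unfolding * by (simp add: matrix_distribs)
  qed
  show "trace X = 0" if "X \<in> {X. P ** X ** Q \<in> L}" for X
  proof -
    have "trace X = trace (Q ** (P ** X))"
      by (simp add: matrix_mul_assoc PQ)
    also have "\<dots> = trace (P ** X ** Q)"
      by (rule trace_mul_sym)
    finally show ?thesis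
      using traceless that by simp
  qed
  have mem: "Q ** Y ** P \<in> {X. P ** X ** Q \<in> L}" if "Y \<in> L" for Y
  proof -
    have "P ** (Q ** Y ** P) ** Q = (P ** Q) ** Y ** (P ** Q)"
      by (simp add: matrix_mul_assoc)
    then show ?thesis
      using that PQ by simp
  qed
  show "\<exists>X\<in>{X. P ** X ** Q \<in> L}. \<forall>c. X *v v \<noteq> c *\<^sub>R v" if "v \<noteq> 0" for v
  proof -
    have "Q *v (P *v v) = v"
      by (simp add: matrix_vector_mul_assoc PQ)
    then have "P *v v \<noteq> 0"
      using \<open>v \<noteq> 0\<close> by (metis matrix_vector_mult_0_right)
    then obtain Y where Y: "Y \<in> L" "\<And>c. Y *v (P *v v) \<noteq> c *\<^sub>R (P *v v)"
      using no_eigenvector by blast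
    have "(Q ** Y ** P) *v v \<noteq> c *\<^sub>R v" for c
    proof
      assume "(Q ** Y ** P) *v v = c *\<^sub>R v"
      then have "P *v ((Q ** Y ** P) *v v) = c *\<^sub>R (P *v v)"
        by (simp add: matrix_vector_mult_scaleR)
      moreover have "P *v ((Q ** Y ** P) *v v) = Y *v (P *v v)"
        unfolding matrix_vector_mul_assoc matrix_mul_assoc PQ(1) by simp
      ultimately show False
        using Y(2) by simp
    qed
    with mem[OF Y(1)] show ?thesis
      by blast
  qed
  show "\<exists>X\<in>{X. P ** X ** Q \<in> L}. \<forall>c. transpose X *v v \<noteq> c *\<^sub>R v" if "v \<noteq> 0" for v
  proof -
    have PQ': "transpose Q ** transpose P = mat 1" "transpose P ** transpose Q = mat 1"
      using PQ by (simp_all flip: matrix_transpose_mul)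
    have "transpose P *v (transpose Q *v v) = v"
      unfolding matrix_vector_mul_assoc PQ' by simp
    then have "transpose Q *v v \<noteq> 0"
      using \<open>v \<noteq> 0\<close> by (metis matrix_vector_mult_0_right)
    then obtain Y where Y: "Y \<in> L" "\<And>c. transpose Y *v (transpose Q *v v) \<noteq> c *\<^sub>R (transpose Q *v v)"
      using no_coeigenvector by blast
    have eq: "transpose (Q ** Y ** P) = transpose P ** transpose Y ** transpose Q"
      by (simp only: matrix_transpose_mul matrix_mul_assoc)
    have "transpose (Q ** Y ** P) *v v \<noteq> c *\<^sub>R v" for c
    proof
      assume "transpose (Q ** Y ** P) *v v = c *\<^sub>R v"
      then have "transpose Q *v ((transpose P ** transpose Y ** transpose Q) *v v) = c *\<^sub>R (transpose Q *v v)"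
        by (simp only: eq matrix_vector_mult_scaleR)
      moreover have "transpose Q *v ((transpose P ** transpose Y ** transpose Q) *v v) = transpose Y *v (transpose Q *v v)"
        unfolding matrix_vector_mul_assoc matrix_mul_assoc PQ' by simp
      ultimately show False
        using Y(2) by metis
    qed
    with mem[OF Y(1)] show ?thesis
      by blast
  qed
qed

lemma scale: "X \<in> L \<Longrightarrow> c *\<^sub>R X \<in> L"
  and add: "X \<in> L \<Longrightarrow> Y \<in> L \<Longrightarrow> X + Y \<in> L"
  and diff: "X \<in> L \<Longrightarrow> Y \<in> L \<Longrightarrow> X - Y \<in> L"
  using subspace by (auto intro: subspace_scale subspace_add subspace_diff)

lemma scale_cancel: "c *\<^sub>R X \<in> L \<Longrightarrow> c \<noteq> 0 \<Longrightarrow> X \<in> L"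
  using scale[of "c *\<^sub>R X" "inverse c"] by simp

lemma diagonal_weight_component:
  assumes D: "diag3 (d 1) (d 2) (d 3) \<in> L" and X: "X \<in> L"
  shows "(\<chi> i j. if d i - d j = w then X $ i $ j else 0) \<in> L"
proof (rule weight_component_mem[OF subspace _ X])
  fix Y assume "Y \<in> L"
  have "diag3 (d 1) (d 2) (d 3) ** Y - Y ** diag3 (d 1) (d 2) (d 3) = (\<chi> i j. (d i - d j) * Y $ i $ j)"
    by (rule mat3_eqI) (simp_all add: matrix_mult_entry_3 algebra_simps)
  then show "(\<chi> i j. (d i - d j) * Y $ i $ j) \<in> L"
    using bracket[OF D \<open>Y \<in> L\<close>] by simp
qed

text \<open>The first basis vector is not a common eigenvector. The same remark for the other basis
  vectors, and for the transposed algebra, gives the column and row facts that follow.\<close>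

lemma column_1:
  obtains X where "X \<in> L" "X$2$1 \<noteq> 0 \<or> X$3$1 \<noteq> 0"
proof -
  obtain X where X: "X \<in> L" "\<And>c. X *v axis 1 1 \<noteq> c *\<^sub>R axis 1 1"
    using no_eigenvector[of "axis 1 1"] by (auto simp: axis_eq_0_iff)
  then show thesis
    using that[of X] X(2)[of "X$1$1"]
    by (auto simp: vec_eq_iff forall_3 matrix_vector_mult_entry_3 axis_def)
qed

lemma column_2:
  obtains X where "X \<in> L" "X$1$2 \<noteq> 0 \<or> X$3$2 \<noteq> 0"
proof -
  obtain X where X: "X \<in> L" "\<And>c. X *v axis 2 1 \<noteq> c *\<^sub>R axis 2 1"
    using no_eigenvector[of "axis 2 1"] by (auto simp: axis_eq_0_iff)
  then show thesis
    using that[of X] X(2)[of "X$2$2"]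
    by (auto simp: vec_eq_iff forall_3 matrix_vector_mult_entry_3 axis_def)
qed

lemma column_3:
  obtains X where "X \<in> L" "X$1$3 \<noteq> 0 \<or> X$2$3 \<noteq> 0"
proof -
  obtain X where X: "X \<in> L" "\<And>c. X *v axis 3 1 \<noteq> c *\<^sub>R axis 3 1"
    using no_eigenvector[of "axis 3 1"] by (auto simp: axis_eq_0_iff)
  then show thesis
    using that[of X] X(2)[of "X$3$3"]
    by (auto simp: vec_eq_iff forall_3 matrix_vector_mult_entry_3 axis_def)
qed

lemma row_1: obtains X where "X \<in> L" "X$1$2 \<noteq> 0 \<or> X$1$3 \<noteq> 0"
  using irreducible_lie_algebra.column_1[OF irreducible_lie_algebra_transpose]
  by (metis (no_types, lifting) imageE transpose_entry)

lemma row_2: obtains X where "X \<in> L" "X$2$1 \<noteq> 0 \<or> X$2$3 \<noteq> 0"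
  using irreducible_lie_algebra.column_2[OF irreducible_lie_algebra_transpose]
  by (metis (no_types, lifting) imageE transpose_entry)

lemma row_3: obtains X where "X \<in> L" "X$3$1 \<noteq> 0 \<or> X$3$2 \<noteq> 0"
  using irreducible_lie_algebra.column_3[OF irreducible_lie_algebra_transpose]
  by (metis (no_types, lifting) imageE transpose_entry)

lemma all_matrix_units_iff:
  "(\<forall>i j. i \<noteq> j \<longrightarrow> matrix_unit i j \<in> L) \<longleftrightarrow>
    matrix_unit 1 2 \<in> L \<and> matrix_unit 1 3 \<in> L \<and> matrix_unit 2 1 \<in> L \<and>
    matrix_unit 2 3 \<in> L \<and> matrix_unit 3 1 \<in> L \<and> matrix_unit 3 2 \<in> L"
  by (auto simp: forall_3)

lemma matrix_unit_trans:
  assumes "matrix_unit i j \<in> L" "matrix_unit j k \<in> L" "i \<noteq> k"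
  shows "matrix_unit i k \<in> L"
  using bracket[OF assms(1,2)] assms(3) by (simp add: matrix_unit_mult)

text \<open>Consider the directed graph on three vertices with an edge from i to j whenever
  \<open>matrix_unit i j\<close> lies in \<open>L\<close>. Brackets make it transitive, and
  irreducibility gives each vertex an incoming and an outgoing edge. So initial and final strong
  components have at least two vertices each; on three vertices they meet, and the graph is
  complete.\<close>

lemma graph_imp_all_matrix_units:
  assumes H: "\<And>X i j. X \<in> L \<Longrightarrow> i \<noteq> j \<Longrightarrow> X $ i $ j \<noteq> 0 \<Longrightarrow> matrix_unit i j \<in> L"
  shows "\<forall>i j. i \<noteq> j \<longrightarrow> matrix_unit i j \<in> L"
proof -
  have "matrix_unit 2 1 \<in> L \<or> matrix_unit 3 1 \<in> L"
    by (rule column_1) (use H in force)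
  moreover have "matrix_unit 1 2 \<in> L \<or> matrix_unit 3 2 \<in> L"
    by (rule column_2) (use H in force)
  moreover have "matrix_unit 1 3 \<in> L \<or> matrix_unit 2 3 \<in> L"
    by (rule column_3) (use H in force)
  moreover have "matrix_unit 1 2 \<in> L \<or> matrix_unit 1 3 \<in> L"
    by (rule row_1) (use H in force)
  moreover have "matrix_unit 2 1 \<in> L \<or> matrix_unit 2 3 \<in> L"
    by (rule row_2) (use H in force)
  moreover have "matrix_unit 3 1 \<in> L \<or> matrix_unit 3 2 \<in> L"
    by (rule row_3) (use H in force)
  moreover note matrix_unit_trans[of 1 2 3] matrix_unit_trans[of 1 3 2] matrix_unit_trans[of 2 1 3]
    matrix_unit_trans[of 2 3 1] matrix_unit_trans[of 3 1 2] matrix_unit_trans[of 3 2 1]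
  ultimately show ?thesis
    unfolding all_matrix_units_iff by (simp, argo)
qed

lemma rank_one_type_components:
  assumes D: "diag3 a b b \<in> L" "a \<noteq> b" and X: "X \<in> L"
  shows "mat3 0 0 0 (X$2$1) 0 0 (X$3$1) 0 0 \<in> L"
    and "mat3 (X$1$1) 0 0 0 (X$2$2) (X$2$3) 0 (X$3$2) (X$3$3) \<in> L"
proof -
  define d :: "3 \<Rightarrow> real" where "d i = (if i = 1 then a else b)" for i
  have d: "diag3 (d 1) (d 2) (d 3) \<in> L"
    using D by (simp add: d_def)
  have "(\<chi> i j. if d i - d j = b - a then X $ i $ j else 0) = mat3 0 0 0 (X$2$1) 0 0 (X$3$1) 0 0"
    using D(2) by (intro mat3_eqI) (auto simp: d_def)
  then show "mat3 0 0 0 (X$2$1) 0 0 (X$3$1) 0 0 \<in> L"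
    using diagonal_weight_component[OF d X, of "b - a"] by simp
  have "(\<chi> i j. if d i - d j = 0 then X $ i $ j else 0) = mat3 (X$1$1) 0 0 0 (X$2$2) (X$2$3) 0 (X$3$2) (X$3$3)"
    using D(2) by (intro mat3_eqI) (auto simp: d_def)
  then show "mat3 (X$1$1) 0 0 0 (X$2$2) (X$2$3) 0 (X$3$2) (X$3$3) \<in> L"
    using diagonal_weight_component[OF d X, of 0] by simp
qed

text \<open>The lower parts (X21, X31) of first columns form a nonzero space stable under the 2x2
  blocks of elements of \<open>L\<close>. If it were only a line through (p, q), the plane spanned
  by the first basis vector and (0, p, q) would be invariant.\<close>

lemma rank_one_type_lower:
  assumes D: "diag3 a b b \<in> L" "a \<noteq> b"
  shows "matrix_unit 2 1 \<in> L \<and> matrix_unit 3 1 \<in> L"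
proof -
  define B where "B p q = mat3 0 0 0 p 0 0 q 0 0" for p q
  have BX: "B (X$2$1) (X$3$1) \<in> L" if "X \<in> L" for X
    unfolding B_def using rank_one_type_components(1)[OF D that] .
  obtain X0 where X0: "X0 \<in> L" "X0$2$1 \<noteq> 0 \<or> X0$3$1 \<noteq> 0"
    using column_1 .
  define p q where "p = X0$2$1" and "q = X0$3$1"
  have pq: "B p q \<in> L" "p \<noteq> 0 \<or> q \<noteq> 0"
    using BX[OF X0(1)] X0(2) by (simp_all add: p_def q_def)
  have "\<exists>p' q'. B p' q' \<in> L \<and> p * q' \<noteq> p' * q"
  proof (rule ccontr)
    assume "\<not> ?thesis"
    then have par: "p * q' = p' * q" if "B p' q' \<in> L" for p' q'
      using that by blast
    \<comment> \<open>The normal of the plane spanned by the first basis vector and (0, p,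
      q).\<close>
    define \<nu> :: "real^3" where "\<nu> = vector [0, - q, p]"
    have "\<nu> \<noteq> 0"
      using pq(2) by (auto simp: \<nu>_def vec_eq_iff forall_3)
    then obtain X where X: "X \<in> L" "\<And>c. transpose X *v \<nu> \<noteq> c *\<^sub>R \<nu>"
      using no_coeigenvector by blast
    have col: "p * X$3$1 = X$2$1 * q"
      using par[OF BX[OF X(1)]] .
    let ?Z = "mat3 (X$1$1) 0 0 0 (X$2$2) (X$2$3) 0 (X$3$2) (X$3$3)"
    have "?Z ** B p q - B p q ** ?Z =
        B (X$2$2 * p + X$2$3 * q - p * X$1$1) (X$3$2 * p + X$3$3 * q - q * X$1$1)"
      by (simp add: B_def mat3_simps)
    then have "B (X$2$2 * p + X$2$3 * q - p * X$1$1) (X$3$2 * p + X$3$3 * q - q * X$1$1) \<in> L"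
      using bracket[OF rank_one_type_components(2)[OF D X(1)] pq(1)] by simp
    then have key: "p * (X$3$2 * p + X$3$3 * q - q * X$1$1) = (X$2$2 * p + X$2$3 * q - p * X$1$1) * q"
      by (rule par)
    define s t where "s = p * X$3$2 - q * X$2$2" and "t = p * X$3$3 - q * X$2$3"
    have st: "s * p + t * q = 0"
      using key unfolding s_def t_def by algebra
    define n where "n = p * p + q * q"
    have "n \<noteq> 0"
      using pq(2) by (simp add: n_def sum_squares_eq_zero_iff)
    \<comment> \<open>(s, t) is orthogonal to (p, q), hence a multiple of (-q, p); \<open>c\<close>
      is the coefficient of the projection.\<close>
    define c where "c = (t * p - s * q) / n"
    have cn: "n * c = t * p - s * q"
      using \<open>n \<noteq> 0\<close> by (simp add: c_def)
    have "n * s = n * (c * (- q))" "n * t = n * (c * p)"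
      using cn st unfolding n_def by algebra+
    then have "s = c * (- q)" "t = c * p"
      using \<open>n \<noteq> 0\<close> mult_left_cancel by blast+
    then have "transpose X *v \<nu> = c *\<^sub>R \<nu>"
      using col by (simp add: vec_eq_iff forall_3 matrix_vector_mult_entry_3 \<nu>_def transpose_entry s_def t_def algebra_simps
          del: transpose_matrix_vector)
    then show False
      using X(2) by blast
  qed
  then obtain p' q' where pq': "B p' q' \<in> L" "p * q' \<noteq> p' * q"
    by blast
  define \<Delta> where "\<Delta> = p * q' - p' * q"
  have "\<Delta> \<noteq> 0"
    using pq' by (simp add: \<Delta>_def)
  have lin: "r *\<^sub>R B p q + s *\<^sub>R B p' q' \<in> L" for r s
    using scale add pq pq' by blast
  have "B 1 0 \<in> L"
    using lin[of "q' / \<Delta>" "- q / \<Delta>"] \<open>\<Delta> \<noteq> 0\<close>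
    by (simp add: B_def mat3_simps \<Delta>_def mult.commute flip: diff_divide_distrib)
  moreover have "B 0 1 \<in> L"
    using lin[of "- p' / \<Delta>" "p / \<Delta>"] \<open>\<Delta> \<noteq> 0\<close>
    by (simp add: B_def mat3_simps \<Delta>_def mult.commute flip: diff_divide_distrib)
  ultimately show ?thesis
    by (simp add: B_def matrix_unit_3)
qed

lemma transpose_matrix_unit: "transpose (matrix_unit i j) = matrix_unit j i"
  by (auto simp: vec_eq_iff transpose_def matrix_unit_def)

lemma rank_one_type_all_matrix_units:
  assumes D: "diag3 a b b \<in> L" "a \<noteq> b"
  shows "\<forall>i j. i \<noteq> j \<longrightarrow> matrix_unit i j \<in> L"
proof -
  interpret T: irreducible_lie_algebra "transpose ` L"
    by (rule irreducible_lie_algebra_transpose)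
  have "transpose (diag3 a b b) \<in> transpose ` L"
    using D(1) by (rule imageI)
  then have "diag3 a b b \<in> transpose ` L"
    by (simp add: mat3_simps)
  from T.rank_one_type_lower[OF this D(2)]
  have "matrix_unit 1 2 \<in> L" "matrix_unit 1 3 \<in> L"
    by (metis imageE transpose_transpose transpose_matrix_unit)+
  moreover have "matrix_unit 2 1 \<in> L" "matrix_unit 3 1 \<in> L"
    using rank_one_type_lower[OF D] by auto
  ultimately show ?thesis
    unfolding all_matrix_units_iff using matrix_unit_trans[of 2 1 3] matrix_unit_trans[of 3 1 2] by simp
qed

text \<open>The inequalities say that each weight d i - d j with i \<noteq> j occurs at exactly one
  matrix position, so weight components are multiples of single matrix units.\<close>

lemma generic_all_matrix_units:
  assumes D: "diag3 x y z \<in> L" and distinct: "x \<noteq> y" "y \<noteq> z" "x \<noteq> z"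
    and generic: "2 * x \<noteq> y + z" "2 * y \<noteq> x + z" "2 * z \<noteq> x + y"
  shows "\<forall>i j. i \<noteq> j \<longrightarrow> matrix_unit i j \<in> L"
proof (rule graph_imp_all_matrix_units)
  fix X i j assume X: "X \<in> L" and ij: "i \<noteq> j" "X $ i $ j \<noteq> 0"
  define d :: "3 \<Rightarrow> real" where "d i = (if i = 1 then x else if i = 2 then y else z)" for i
  have d: "diag3 (d 1) (d 2) (d 3) \<in> L"
    using D by (simp add: d_def)
  have "(\<chi> k l. if d k - d l = d i - d j then X $ k $ l else 0) = X$i$j *\<^sub>R matrix_unit i j"
    using exhaust_3[of i] exhaust_3[of j] ij distinct generic
    by (intro mat3_eqI) (auto simp: d_def matrix_unit_def)
  then have "X$i$j *\<^sub>R matrix_unit i j \<in> L"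
    using diagonal_weight_component[OF d X, of "d i - d j"] by simp
  then show "matrix_unit i j \<in> L"
    by (rule scale_cancel) (rule ij)
qed

text \<open>The equation is infinitesimal invariance of the form: \<open>L\<close> lies in its
  orthogonal Lie algebra. The uniqueness clause makes the line of \<open>Q\<close> canonical, hence
  invariant under everything that normalises \<open>L\<close>.\<close>

definition preserves_unique_conic :: bool where
  "preserves_unique_conic \<longleftrightarrow> (\<exists>Q. Q \<noteq> 0 \<and> transpose Q = Q \<and> (\<forall>X\<in>L. transpose X ** Q + Q ** X = 0) \<and>
     (\<forall>S. transpose S = S \<longrightarrow> (\<forall>X\<in>L. transpose X ** S + S ** X = 0) \<longrightarrow> S \<in> span {Q}))"

text \<open>Here the weights 1 and -1 occur at two positions each, so their components
  \<open>P\<close> and \<open>N\<close> need not split; this leaves room for the irreducible copy of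
  sl(2), which is the orthogonal algebra of a conic. If \<open>L\<close> lacks some unit, the
  pairings between \<open>P\<close> and \<open>N\<close> leave only this possibility.\<close>

lemma arithmetic_type:
  assumes D: "diag3 1 0 (-1) \<in> L"
  shows "(\<forall>i j. i \<noteq> j \<longrightarrow> matrix_unit i j \<in> L) \<or> preserves_unique_conic"
proof (rule disjCI)
  assume not_conic: "\<not> preserves_unique_conic"
  show "\<forall>i j. i \<noteq> j \<longrightarrow> matrix_unit i j \<in> L"
  proof (rule ccontr)
    assume not_all: "\<not> ?thesis"
    define P N where "P p q = mat3 0 p 0 0 0 q 0 0 0" and "N r s = mat3 0 0 0 r 0 0 0 s 0" for p q r s
    define d :: "3 \<Rightarrow> real" where "d i = (if i = 1 then 1 else if i = 2 then 0 else -1)" for i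
    have d: "diag3 (d 1) (d 2) (d 3) \<in> L"
      using D by (simp add: d_def)
    note comp = diagonal_weight_component[OF d]
    have PX: "P (X$1$2) (X$2$3) \<in> L" if "X \<in> L" for X
    proof -
      have "(\<chi> i j. if d i - d j = 1 then X $ i $ j else 0) = P (X$1$2) (X$2$3)"
        by (intro mat3_eqI) (auto simp: d_def P_def)
      then show ?thesis using comp[OF that, of 1] by simp
    qed
    have NX: "N (X$2$1) (X$3$2) \<in> L" if "X \<in> L" for X
    proof -
      have "(\<chi> i j. if d i - d j = -1 then X $ i $ j else 0) = N (X$2$1) (X$3$2)"
        by (intro mat3_eqI) (auto simp: d_def N_def)
      then show ?thesis using comp[OF that, of "-1"] by simp
    qed
    have X13: "matrix_unit 1 3 \<in> L" if "X \<in> L" "X$1$3 \<noteq> 0" for X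
    proof -
      have "(\<chi> i j. if d i - d j = 2 then X $ i $ j else 0) = X$1$3 *\<^sub>R matrix_unit 1 3"
        by (intro mat3_eqI) (auto simp: d_def matrix_unit_def)
      then have "X$1$3 *\<^sub>R matrix_unit 1 3 \<in> L"
        using comp[OF that(1), of 2] by simp
      then show ?thesis
        by (rule scale_cancel) (rule that(2))
    qed
    have X31: "matrix_unit 3 1 \<in> L" if "X \<in> L" "X$3$1 \<noteq> 0" for X
    proof -
      have "(\<chi> i j. if d i - d j = -2 then X $ i $ j else 0) = X$3$1 *\<^sub>R matrix_unit 3 1"
        by (intro mat3_eqI) (auto simp: d_def matrix_unit_def)
      then have "X$3$1 *\<^sub>R matrix_unit 3 1 \<in> L"
        using comp[OF that(1), of "-2"] by simp
      then show ?thesis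
        by (rule scale_cancel) (rule that(2))
    qed
    have diagX: "diag3 (X$1$1) (X$2$2) (X$3$3) \<in> L" if "X \<in> L" for X
    proof -
      have "(\<chi> i j. if d i - d j = 0 then X $ i $ j else 0) = diag3 (X$1$1) (X$2$2) (X$3$3)"
        by (intro mat3_eqI) (auto simp: d_def)
      then show ?thesis using comp[OF that, of 0] by simp
    qed
    \<comment> \<open>A diagonal element outside the arithmetic pattern would have different weights
      on the two entries of \<open>P\<close> and of \<open>N\<close>, splitting them into matrix
      units.\<close>
    have arith: "x - y = y - z" if Z: "diag3 x y z \<in> L" for x y z
    proof (rule ccontr)
      assume ne: "x - y \<noteq> y - z"
      define w where "w = x - y - (y - z)"
      have "w \<noteq> 0" using ne by (simp add: w_def)
      have Pw: "P (w * p) 0 \<in> L" "P 0 (- w * q) \<in> L" if "P p q \<in> L" for p q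
      proof -
        have "diag3 x y z ** P p q - P p q ** diag3 x y z \<in> L"
          using bracket[OF Z that] .
        moreover have "diag3 x y z ** P p q - P p q ** diag3 x y z - (y - z) *\<^sub>R P p q = P (w * p) 0"
          "diag3 x y z ** P p q - P p q ** diag3 x y z - (x - y) *\<^sub>R P p q = P 0 (- w * q)"
          by (simp_all add: P_def mat3_simps w_def algebra_simps)
        ultimately show "P (w * p) 0 \<in> L" "P 0 (- w * q) \<in> L"
          using diff[OF _ scale[OF that]] by metis+
      qed
      have Nw: "N (- w * r) 0 \<in> L" "N 0 (w * s) \<in> L" if "N r s \<in> L" for r s
      proof -
        have "diag3 x y z ** N r s - N r s ** diag3 x y z \<in> L"
          using bracket[OF Z that] .
        moreover have "diag3 x y z ** N r s - N r s ** diag3 x y z - (z - y) *\<^sub>R N r s = N (- w * r) 0"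
          "diag3 x y z ** N r s - N r s ** diag3 x y z - (y - x) *\<^sub>R N r s = N 0 (w * s)"
          by (simp_all add: N_def mat3_simps w_def algebra_simps)
        ultimately show "N (- w * r) 0 \<in> L" "N 0 (w * s) \<in> L"
          using diff[OF _ scale[OF that]] by metis+
      qed
      have PN: "P c 0 = c *\<^sub>R matrix_unit 1 2" "P 0 c = c *\<^sub>R matrix_unit 2 3"
        "N c 0 = c *\<^sub>R matrix_unit 2 1" "N 0 c = c *\<^sub>R matrix_unit 3 2" for c
        by (simp_all add: P_def N_def matrix_unit_3 mat3_simps)
      have "\<forall>i j. i \<noteq> j \<longrightarrow> matrix_unit i j \<in> L"
      proof (rule graph_imp_all_matrix_units)
        fix X i j assume X: "X \<in> L" and ij: "i \<noteq> j" "X $ i $ j \<noteq> 0"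
        note PXw = Pw[OF PX[OF X], unfolded PN] and NXw = Nw[OF NX[OF X], unfolded PN]
        show "matrix_unit i j \<in> L"
          using ij \<open>w \<noteq> 0\<close> X13[OF X] X31[OF X] scale_cancel[OF PXw(1)] scale_cancel[OF PXw(2)] scale_cancel[OF NXw(1)] scale_cancel[OF NXw(2)]
            exhaust_3[of i] exhaust_3[of j] by auto
      qed
      with not_all show False by blast
    qed
    \<comment> \<open>The bracket of \<open>P\<close> with \<open>N\<close> is diagonal, so the
      arithmetic pattern constrains it.\<close>
    have star: "p * r = q * s" if "P p q \<in> L" "N r s \<in> L" for p q r s
    proof -
      have "P p q ** N r s - N r s ** P p q = diag3 (p * r) (q * s - p * r) (- (q * s))"
        by (simp add: P_def N_def mat3_simps algebra_simps)
      then have "diag3 (p * r) (q * s - p * r) (- (q * s)) \<in> L"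
        using bracket[OF that] by simp
      from arith[OF this] show ?thesis by simp
    qed
    have not_13: "matrix_unit 1 3 \<notin> L"
    proof
      assume E: "matrix_unit 1 3 \<in> L"
      \<comment> \<open>Bracketing with the unit at (1,3) moves \<open>N\<close> into
        \<open>P\<close>. Pairing the result with the original gives rs = 0, after which too many
        entries vanish in column 2 or row 2.\<close>
      have NP: "P s (- r) \<in> L" if "N r s \<in> L" for r s
        using bracket[OF E that] by (simp add: matrix_unit_3 P_def N_def mat3_simps)
      have rs: "r * s = 0" if "N r s \<in> L" for r s
        using star[OF NP[OF that] that] by simp
      consider r s where "N r s \<in> L" "r \<noteq> 0" | r s where "N r s \<in> L" "s \<noteq> 0"
        | "\<And>r s. N r s \<in> L \<Longrightarrow> r = 0 \<and> s = 0"
        by blast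
      then show False
      proof cases
        case (1 r s)
        then have "N r 0 \<in> L" "P 0 (- r) \<in> L"
          using rs[OF 1(1)] NP[OF 1(1)] by auto
        then have "X$1$2 = 0 \<and> X$3$2 = 0" if "X \<in> L" for X
          using star[OF PX[OF that], of r 0] star[OF _ NX[OF that], of 0 "- r"] 1(2) by auto
        then show False
          using column_2 by metis
      next
        case (2 r s)
        then have "N 0 s \<in> L" "P s 0 \<in> L"
          using rs[OF 2(1)] NP[OF 2(1)] by auto
        then have "X$2$1 = 0 \<and> X$2$3 = 0" if "X \<in> L" for X
          using star[OF PX[OF that], of 0 s] star[OF _ NX[OF that], of s 0] 2(2) by auto
        then show False
          using row_2 by metis
      next
        \<comment> \<open>With no weight -1 component at all, column 1 forces the unit at (3,1). It
          moves \<open>P\<close> into \<open>N\<close>, so \<open>P\<close> must lack its first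
          entry, contradicting column 2.\<close>
        case 3
        have N0: "X$2$1 = 0" "X$3$2 = 0" if "X \<in> L" for X
          using 3[OF NX[OF that]] by auto
        obtain X where "X \<in> L" "X$3$1 \<noteq> 0"
          using column_1 N0 by metis
        then have E': "matrix_unit 3 1 \<in> L"
          by (rule X31)
        have "N (- q) p \<in> L" if "P p q \<in> L" for p q
          using bracket[OF E' that] by (simp add: matrix_unit_3 P_def N_def mat3_simps)
        then have "X$1$2 = 0" if "X \<in> L" for X
          using 3 PX[OF that] by blast
        then show False
          using column_2 N0 by metis
      qed
    qed
    have not_31: "matrix_unit 3 1 \<notin> L"
    proof
      assume E: "matrix_unit 3 1 \<in> L"
      obtain X where X: "X \<in> L" "X$2$3 \<noteq> 0"
        using column_3 X13 not_13 by metis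
      define p q where "p = X$1$2" and "q = X$2$3"
      have P: "P p q \<in> L" "q \<noteq> 0"
        using PX[OF X(1)] X(2) by (simp_all add: p_def q_def)
      have N: "N (- q) p \<in> L"
        using bracket[OF E P(1)] by (simp add: matrix_unit_3 P_def N_def mat3_simps)
      have "p = 0"
        using star[OF P(1) N] P(2) by simp
      then have "Y$1$2 = 0 \<and> Y$3$2 = 0" if "Y \<in> L" for Y
        using star[OF PX[OF that] N] star[OF P(1) NX[OF that]] P(2) by auto
      then show False
        using column_2 by metis
    qed
    have zero: "X$1$3 = 0" "X$3$1 = 0" if "X \<in> L" for X
      using X13 X31 not_13 not_31 that by blast+
    obtain X1 where X1: "X1 \<in> L" "X1$1$2 \<noteq> 0"
      using row_1 zero by metis
    obtain X2 where X2: "X2 \<in> L" "X2$2$1 \<noteq> 0"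
      using column_1 zero by metis
    define p q r s where "p = X1$1$2" and "q = X1$2$3" and "r = X2$2$1" and "s = X2$3$2"
    have PN: "P p q \<in> L" "N r s \<in> L" and pr: "p * r = q * s" "p \<noteq> 0" "r \<noteq> 0"
      using PX[OF X1(1)] NX[OF X2(1)] star X1(2) X2(2) by (auto simp: p_def q_def r_def s_def)
    then have "q \<noteq> 0" "s \<noteq> 0"
      by auto
    \<comment> \<open>The form 2q x1 x3 - p x2^2, the solution of the invariance equation for
      \<open>P p q\<close> up to scaling among forms invariant under the diagonal element.\<close>
    define Q where "Q = mat3 0 0 q 0 (-p) 0 q 0 0"
    have "transpose X ** Q + Q ** X = 0" if X: "X \<in> L" for X
    proof -
      have "X$1$1 - X$2$2 = X$2$2 - X$3$3"
        using arith[OF diagX[OF X]] .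
      then have tr: "X$2$2 = 0" "X$3$3 = - X$1$1"
        using traceless[OF X] by (simp_all add: trace_3)
      have "X$1$2 * r = X$2$3 * s" "p * X$2$1 = q * X$3$2"
        using star[OF PX[OF X] PN(2)] star[OF PN(1) NX[OF X]] by auto
      moreover have "s * (X$1$2 * q) = s * (X$2$3 * p)"
        using calculation(1) pr(1) by algebra
      ultimately have "X$1$2 * q = X$2$3 * p" "p * X$2$1 = q * X$3$2"
        using \<open>s \<noteq> 0\<close> by simp_all
      then show ?thesis
        by (intro mat3_eqI) (simp_all add: Q_def entries_3 zero[OF X] tr mult.commute)
    qed
    moreover have "S \<in> span {Q}"
      if S: "transpose S = S" "\<forall>X\<in>L. transpose X ** S + S ** X = 0" for S
    proof -
      have sym: "S$j$i = S$i$j" for i j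
        using S(1) by (metis transpose_entry)
      have entry: "(transpose X ** S + S ** X) $ i $ j = 0" if "X \<in> L" for X i j
        using S(2) that by simp
      \<comment> \<open>Invariance under the diagonal element leaves only entries of total weight 0,
        those at (1,3), (3,1) and (2,2); then \<open>P p q\<close> ties (2,2) to (1,3).\<close>
      have S0: "S$1$1 = 0" "S$3$3 = 0" "S$1$2 = 0" "S$2$3 = 0"
        using entry[OF D, of 1 1] entry[OF D, of 3 3] entry[OF D, of 1 2] entry[OF D, of 2 3]
        by (simp_all add: matrix_mult_entry_3 transpose_entry)
      have "S$2$2 * q + S$1$3 * p = 0"
        using entry[OF PN(1), of 2 3] by (simp add: matrix_mult_entry_3 transpose_entry P_def algebra_simps)
      then have "S = (S$1$3 / q) *\<^sub>R Q"
        using S0 sym[of 1 2] sym[of 1 3] sym[of 2 3] \<open>q \<noteq> 0\<close>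
        by (intro mat3_eqI) (auto simp: Q_def field_simps)
      then show ?thesis
        by (auto simp: mem_span_singleton)
    qed
    moreover have "Q \<noteq> 0" "transpose Q = Q"
      using \<open>q \<noteq> 0\<close> by (auto simp: Q_def mat3_simps vec_eq_iff forall_3)
    ultimately have preserves_unique_conic
      unfolding preserves_unique_conic_def by blast
    with not_conic show False
      by blast
  qed
qed

end

section \<open>Reduction of the classification to normalised diagonal elements\<close>

context irreducible_lie_algebra
begin

definition classified :: bool where
  "classified \<longleftrightarrow> (\<forall>i j. i \<noteq> j \<longrightarrow> matrix_unit i j \<in> L) \<or> preserves_unique_conic"

text \<open>Containing the matrix units depends on the basis, but containing all traceless matrices
  does not. This is how the first alternative survives conjugation.\<close>

lemma traceless_mem:
  assumes units: "\<forall>i j. i \<noteq> j \<longrightarrow> matrix_unit i j \<in> L" and tr: "trace M = 0"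
  shows "M \<in> L"
proof -
  have u: "matrix_unit i j \<in> L" if "i \<noteq> j" for i j
    using units that by blast
  have D1: "diag3 1 (-1) 0 \<in> L"
    using bracket[OF u[of 1 2] u[of 2 1]] by (simp add: matrix_unit_3 mat3_simps)
  have D2: "diag3 0 1 (-1) \<in> L"
    using bracket[OF u[of 2 3] u[of 3 2]] by (simp add: matrix_unit_3 mat3_simps)
  have "M = (M$1$1 *\<^sub>R diag3 1 (-1) 0 + (M$1$1 + M$2$2) *\<^sub>R diag3 0 1 (-1)) +
      (M$1$2 *\<^sub>R matrix_unit 1 2 + M$1$3 *\<^sub>R matrix_unit 1 3) +
      (M$2$1 *\<^sub>R matrix_unit 2 1 + M$2$3 *\<^sub>R matrix_unit 2 3) +
      (M$3$1 *\<^sub>R matrix_unit 3 1 + M$3$2 *\<^sub>R matrix_unit 3 2)"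
    using tr by (intro mat3_eqI) (simp_all add: matrix_unit_3 trace_3)
  moreover have "\<dots> \<in> L"
    by (intro add scale D1 D2 u) simp_all
  ultimately show ?thesis
    by simp
qed

lemma classified_conjugate:
  assumes PQ: "P ** Q = mat 1" "Q ** P = mat 1"
    and cl: "irreducible_lie_algebra.classified {X. P ** X ** Q \<in> L}"
  shows classified
proof -
  interpret C: irreducible_lie_algebra "{X. P ** X ** Q \<in> L}"
    by (rule irreducible_lie_algebra_conjugate[OF PQ])
  have unconj: "P ** (Q ** Y ** P) ** Q = Y" for Y
  proof -
    have "P ** (Q ** Y ** P) ** Q = (P ** Q) ** Y ** (P ** Q)"
      by (simp add: matrix_mul_assoc)
    then show ?thesis
      using PQ by simp
  qed
  from cl[unfolded C.classified_def] show ?thesis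
  proof
    assume units: "\<forall>i j. i \<noteq> j \<longrightarrow> matrix_unit i j \<in> {X. P ** X ** Q \<in> L}"
    have "matrix_unit k l \<in> L" if "k \<noteq> l" for k l
    proof -
      have "trace (Q ** matrix_unit k l ** P) = trace (P ** (Q ** matrix_unit k l))"
        by (rule trace_mul_sym)
      also have "\<dots> = trace (matrix_unit k l :: real^3^3)"
        by (simp add: matrix_mul_assoc PQ)
      also have "\<dots> = 0"
        using that by (auto simp: trace_3 matrix_unit_def)
      finally have "trace (Q ** matrix_unit k l ** P) = 0" .
      from C.traceless_mem[OF units this] show ?thesis
        unfolding mem_Collect_eq unconj .
    qed
    then show classified
      unfolding classified_def by blast
  next
    assume "C.preserves_unique_conic"
    then obtain S where S: "S \<noteq> 0" "transpose S = S"
      and inv: "\<And>X. P ** X ** Q \<in> L \<Longrightarrow> transpose X ** S + S ** X = 0"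
      and uniq: "\<And>T. transpose T = T \<Longrightarrow> (\<And>X. P ** X ** Q \<in> L \<Longrightarrow> transpose X ** T + T ** X = 0) \<Longrightarrow> T \<in> span {S}"
      unfolding C.preserves_unique_conic_def by blast
    have PQ': "transpose Q ** transpose P = mat 1" "transpose P ** transpose Q = mat 1"
      using PQ by (simp_all flip: matrix_transpose_mul)
    define S' where "S' = transpose Q ** S ** Q"
    have SS': "transpose P ** S' ** P = S"
    proof -
      have "transpose P ** S' ** P = (transpose P ** transpose Q) ** S ** (Q ** P)"
        by (simp add: S'_def matrix_mul_assoc)
      then show ?thesis
        using PQ PQ' by simp
    qed
    have "preserves_unique_conic"
      unfolding preserves_unique_conic_def
    proof (intro exI conjI allI impI ballI)
      show "S' \<noteq> 0"
        using SS' S(1) by auto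
      show "transpose S' = S'"
        by (simp add: S'_def matrix_transpose_mul S(2) matrix_mul_assoc)
      show "transpose Y ** S' + S' ** Y = 0" if Y: "Y \<in> L" for Y
      proof -
        define X where "X = Q ** Y ** P"
        have XY: "transpose Q ** transpose X = transpose Y ** transpose Q" "X ** Q = Q ** Y"
        proof -
          have "X ** Q = Q ** Y ** (P ** Q)"
            by (simp add: X_def matrix_mul_assoc)
          then show "X ** Q = Q ** Y"
            by (simp add: PQ)
          then show "transpose Q ** transpose X = transpose Y ** transpose Q"
            by (simp flip: matrix_transpose_mul)
        qed
        have "transpose Y ** S' + S' ** Y = transpose Q ** transpose X ** S ** Q + transpose Q ** S ** (X ** Q)"
          by (simp only: S'_def XY matrix_mul_assoc)
        also have "\<dots> = transpose Q ** (transpose X ** S + S ** X) ** Q"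
          by (simp add: matrix_distribs matrix_mul_assoc)
        also have "\<dots> = 0"
          using inv[of X] Y unconj by (simp add: X_def)
        finally show ?thesis .
      qed
      show "T \<in> span {S'}" if T: "transpose T = T" "\<forall>X\<in>L. transpose X ** T + T ** X = 0" for T
      proof -
        have "transpose P ** T ** P \<in> span {S}"
        proof (rule uniq)
          show "transpose (transpose P ** T ** P) = transpose P ** T ** P"
            by (simp add: matrix_transpose_mul T(1) matrix_mul_assoc)
          fix X assume X: "P ** X ** Q \<in> L"
          define Y where "Y = P ** X ** Q"
          have XY: "transpose X ** transpose P = transpose P ** transpose Y" "P ** X = Y ** P"
          proof -
            have "Y ** P = P ** X ** (Q ** P)"
              by (simp add: Y_def matrix_mul_assoc)
            then show "P ** X = Y ** P"
              by (simp add: PQ)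
            then show "transpose X ** transpose P = transpose P ** transpose Y"
              by (simp flip: matrix_transpose_mul)
          qed
          have "transpose X ** (transpose P ** T ** P) + transpose P ** T ** P ** X
              = transpose X ** transpose P ** T ** P + transpose P ** T ** (P ** X)"
            by (simp only: matrix_mul_assoc)
          also have "\<dots> = transpose P ** (transpose Y ** T + T ** Y) ** P"
            by (simp add: XY matrix_distribs matrix_mul_assoc)
          also have "\<dots> = 0"
            using T(2) X by (simp add: Y_def)
          finally show "transpose X ** (transpose P ** T ** P) + transpose P ** T ** P ** X = 0" .
        qed
        then obtain c where c: "transpose P ** T ** P = c *\<^sub>R S"
          by (auto simp: mem_span_singleton)
        have "T = transpose Q ** (c *\<^sub>R S) ** Q"
          by (rule congruence_cancel[OF PQ'(1) PQ(1) c])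
        then have "T = c *\<^sub>R S'"
          by (simp add: S'_def matrix_distribs)
        then show ?thesis
          by (auto simp: mem_span_singleton)
      qed
    qed
    then show classified
      unfolding classified_def by blast
  qed
qed

lemma classified_diagonal_ordered:
  assumes D: "diag3 x y z \<in> L" and "(y = z \<and> x \<noteq> y) \<or> (2 * y = x + z \<and> x \<noteq> z) \<or>
    (x \<noteq> y \<and> y \<noteq> z \<and> x \<noteq> z \<and> 2 * x \<noteq> y + z \<and> 2 * y \<noteq> x + z \<and> 2 * z \<noteq> x + y)"
  shows classified
  using assms(2)
proof (elim disjE conjE)
  assume "y = z" "x \<noteq> y"
  then show ?thesis
    using rank_one_type_all_matrix_units[of x y] D unfolding classified_def by blast
next
  assume mid: "2 * y = x + z" "x \<noteq> z"
  have "x + y + z = 0"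
    using traceless[OF D] by (simp add: trace_3)
  then have eq: "y = 0" "z = - x"
    using mid(1) by simp_all
  have "x *\<^sub>R diag3 1 0 (-1) \<in> L"
    using D by (simp add: eq mat3_simps)
  then have "diag3 1 0 (-1) \<in> L"
    by (rule scale_cancel) (use mid eq in auto)
  then show ?thesis
    unfolding classified_def by (rule arithmetic_type)
next
  assume "x \<noteq> y" "y \<noteq> z" "x \<noteq> z" "2 * x \<noteq> y + z" "2 * y \<noteq> x + z" "2 * z \<noteq> x + y"
  then show ?thesis
    using generic_all_matrix_units[OF D] unfolding classified_def by blast
qed

text \<open>Up to exchanging two coordinates, a nonscalar diagonal matrix has a repeated entry in
  the last two places, an arithmetic progression, or generic entries. The permutation matrices are
  involutions, so each serves as its own inverse.\<close>

lemma classified_diagonal: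
  assumes D: "diag3 x y z \<in> L" and ne: "\<not> (x = y \<and> y = z)"
  shows classified
proof -
  have permuted: classified
    if W: "W ** W = mat 1" "W ** diag3 a b c ** W = diag3 x y z"
      and ord: "(b = c \<and> a \<noteq> b) \<or> (2 * b = a + c \<and> a \<noteq> c) \<or>
        (a \<noteq> b \<and> b \<noteq> c \<and> a \<noteq> c \<and> 2 * a \<noteq> b + c \<and> 2 * b \<noteq> a + c \<and> 2 * c \<noteq> a + b)" for W a b c
  proof (rule classified_conjugate[OF W(1) W(1)])
    interpret C: irreducible_lie_algebra "{X. W ** X ** W \<in> L}"
      by (rule irreducible_lie_algebra_conjugate[OF W(1) W(1)])
    show C.classified
      by (rule C.classified_diagonal_ordered[OF _ ord]) (simp add: W D)
  qed
  define W12 W13 W23 where "W12 = mat3 0 1 0 1 0 0 0 0 1" and "W13 = mat3 0 0 1 0 1 0 1 0 0"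
    and "W23 = mat3 1 0 0 0 0 1 0 1 0"
  have sq: "W12 ** W12 = mat 1" "W13 ** W13 = mat 1" "W23 ** W23 = mat 1"
    by (rule mat3_eqI; simp add: W12_def W13_def W23_def entries_3)+
  have conj: "W12 ** diag3 y x z ** W12 = diag3 x y z" "W13 ** diag3 z y x ** W13 = diag3 x y z"
    "W23 ** diag3 x z y ** W23 = diag3 x y z"
    by (simp_all add: W12_def W13_def W23_def mat3_mult)
  consider "y = z" "x \<noteq> y" | "x = y" "z \<noteq> y" | "x = z" "y \<noteq> x" | "2 * y = x + z" "x \<noteq> z"
    | "2 * x = y + z" "y \<noteq> z" | "2 * z = x + y" "x \<noteq> y"
    | "x \<noteq> y \<and> y \<noteq> z \<and> x \<noteq> z \<and> 2 * x \<noteq> y + z \<and> 2 * y \<noteq> x + z \<and> 2 * z \<noteq> x + y"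
    using ne by metis
  then show ?thesis
  proof cases
    case 1 then show ?thesis using classified_diagonal_ordered[OF D] by blast
  next
    case 2 then show ?thesis using permuted[OF sq(2) conj(2)] by blast
  next
    case 3 then show ?thesis using permuted[OF sq(1) conj(1)] by blast
  next
    case 4 then show ?thesis using classified_diagonal_ordered[OF D] by blast
  next
    case 5 then show ?thesis using permuted[OF sq(1) conj(1)] by blast
  next
    case 6 then show ?thesis using permuted[OF sq(3) conj(3)] by blast
  next
    case 7 then show ?thesis using classified_diagonal_ordered[OF D] by blast
  qed
qed

lemma classification:
  assumes PQ: "P ** Q = mat 1" "Q ** P = mat 1"
    and D: "P ** diag3 x y z ** Q \<in> L" and ne: "\<not> (x = y \<and> y = z)"
  shows classified
proof (rule classified_conjugate[OF PQ])
  interpret C: irreducible_lie_algebra "{X. P ** X ** Q \<in> L}"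
    by (rule irreducible_lie_algebra_conjugate[OF PQ])
  show C.classified
    by (rule C.classified_diagonal[OF _ ne]) (simp add: D)
qed

end

section \<open>Density of non-elementary groups\<close>

lemma lie_algebra_of_SL3_traceless:
  fixes \<Gamma> :: "(real^3^3) set"
  assumes det: "\<And>g. g \<in> \<Gamma> \<Longrightarrow> det g = 1" and X: "X \<in> lie_algebra_of \<Gamma>"
  shows "trace X = 0"
proof -
  let ?f = "\<lambda>A :: real^3^3. det A - 1"
  have entry: "real_polynomial_function (\<lambda>A :: real^3^3. A $ i $ j)" for i j
    by (intro real_polynomial_function.intros bounded_linear_compose[OF bounded_linear_vec_nth bounded_linear_vec_nth])
  have pf: "real_polynomial_function ?f"
    unfolding det_3
    by (intro real_polynomial_function.intros(2-4) real_polynomial_function_diff entry)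
  then have "?f \<in> vanishing_polynomials \<Gamma>"
    using det by (simp add: vanishing_polynomials_def)
  then have zero: "frechet_derivative ?f (at (mat 1)) X = 0"
    using X by (auto simp: lie_algebra_of_def mat_deriv_one)
  have path: "((\<lambda>t. mat 1 + t *\<^sub>R X) has_derivative (\<lambda>s. s *\<^sub>R X)) (at 0)"
    by (auto intro!: derivative_eq_intros)
  have "((\<lambda>t. ?f (mat 1 + t *\<^sub>R X)) has_derivative
      (\<lambda>s. frechet_derivative ?f (at (mat 1 + 0 *\<^sub>R X)) (s *\<^sub>R X))) (at 0)"
    by (rule has_derivative_compose[OF path polynomial_has_derivative[OF pf]])
  moreover have "((\<lambda>t. ?f (mat 1 + t *\<^sub>R X)) has_derivative (\<lambda>s. s * trace X)) (at 0)"
  proof -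
    \<comment> \<open>The linear term of the determinant at 1 is the trace.\<close>
    have "?f (mat 1 + t *\<^sub>R X) = trace X * t + principal_minors X * t\<^sup>2 + det X * t ^ 3" for t
      by (simp add: det_3 mat_entry trace_3 principal_minors_def power2_eq_square power3_eq_cube algebra_simps)
    then show ?thesis
      by (simp only:) (auto intro!: derivative_eq_intros)
  qed
  ultimately have "(\<lambda>s. frechet_derivative ?f (at (mat 1 + 0 *\<^sub>R X)) (s *\<^sub>R X)) = (\<lambda>s. s * trace X)"
    by (rule has_derivative_unique)
  from fun_cong[OF this, of 1] show ?thesis
    using zero by simp
qed

lemma non_elementary_vanishing_polynomials:
  assumes \<Gamma>: "subgroup \<Gamma> SL3" and ne: "non_elementary \<Gamma>"
    and f: "f \<in> vanishing_polynomials \<Gamma>" and A: "det A = 1"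
  shows "f A = 0"
proof -
  note mult = SL3_subgroup_mult[OF \<Gamma>] and one = SL3_subgroup_one[OF \<Gamma>] and det = SL3_subgroup_det[OF \<Gamma>]
  note inv1 = det_matrix_inv_1[OF det]
  define L where "L = lie_algebra_of \<Gamma>"
  have conj: "g ** X ** matrix_inv g \<in> L" if "g \<in> \<Gamma>" "X \<in> L" for g X
    unfolding L_def by (rule lie_algebra_of_conjugate[OF mult])
      (use that inv1 SL3_subgroup_inv[OF \<Gamma>] in \<open>auto simp: L_def\<close>)
  obtain g where "g \<in> \<Gamma>" "\<bar>trace g\<bar> > 3"
    using non_elementary_imp_hyperbolic[OF \<Gamma> ne] .
  then obtain P Q x y z where PQ: "P ** Q = mat 1" "Q ** P = mat 1" and xyz: "\<not> (x = y \<and> y = z)"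
    and D: "P ** diag3 x y z ** Q \<in> L"
    using hyperbolic_imp_diagonalizable_in_lie_algebra[OF mult one det] unfolding L_def by metis
  have D_ne: "P ** diag3 x y z ** Q \<noteq> mat c" for c
  proof
    assume "P ** diag3 x y z ** Q = mat c"
    from congruence_cancel[OF PQ(2) PQ(2) this] have "diag3 x y z = Q ** mat c ** P" .
    also have "mat c = c *\<^sub>R (mat 1 :: real^3^3)"
      by (simp add: vec_eq_iff mat_def)
    also have "Q ** (c *\<^sub>R mat 1) ** P = c *\<^sub>R mat 1"
      by (simp add: matrix_distribs PQ)
    finally have eq: "diag3 x y z = c *\<^sub>R mat 1" .
    have "x = c" "y = c" "z = c"
      using arg_cong[OF eq, of "\<lambda>M. M$1$1"] arg_cong[OF eq, of "\<lambda>M. M$2$2"] arg_cong[OF eq, of "\<lambda>M. M$3$3"]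
      by (simp_all add: mat_entry)
    then show False
      using xyz by simp
  qed
  interpret irreducible_lie_algebra L
  proof
    show "subspace L"
      unfolding L_def by (rule subspace_lie_algebra_of)
    show "X ** Y - Y ** X \<in> L" if "X \<in> L" "Y \<in> L" for X Y
      using lie_algebra_of_commutator[OF mult one] that unfolding L_def by blast
    show "trace X = 0" if "X \<in> L" for X
      using lie_algebra_of_SL3_traceless[OF det] that unfolding L_def by blast
  qed (use non_elementary_no_common_eigenvector[OF \<Gamma> ne conj D D_ne] in blast)+
  from classification[OF PQ D xyz, unfolded classified_def] show ?thesis
  proof
    assume "\<forall>i j. i \<noteq> j \<longrightarrow> matrix_unit i j \<in> L"
    then show ?thesis
      using vanishing_polynomials_SL3[OF mult one _ f A] unfolding L_def by blast
  next
    assume preserves_unique_conic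
    then obtain S where S: "S \<noteq> 0" "transpose S = S" and inv: "\<And>X. X \<in> L \<Longrightarrow> transpose X ** S + S ** X = 0"
      and uniq: "\<And>T. transpose T = T \<Longrightarrow> (\<And>X. X \<in> L \<Longrightarrow> transpose X ** T + T ** X = 0) \<Longrightarrow> T \<in> span {S}"
      unfolding preserves_unique_conic_def by blast
    \<comment> \<open>Conjugation by \<open>g\<close> preserves \<open>L\<close>, so the form pulled
      back by \<open>g\<close> is again infinitesimally invariant, and uniqueness puts it on the
      line of \<open>S\<close>.\<close>
    have "transpose g ** S ** g \<in> span {S}" if g: "g \<in> \<Gamma>" for g
    proof (rule uniq)
      show "transpose (transpose g ** S ** g) = transpose g ** S ** g"
        by (simp add: matrix_transpose_mul S(2) matrix_mul_assoc)
      fix X assume X: "X \<in> L"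
      define Y where "Y = g ** X ** matrix_inv g"
      have Yg: "g ** X = Y ** g"
      proof -
        have "Y ** g = g ** X ** (matrix_inv g ** g)"
          by (simp add: Y_def matrix_mul_assoc)
        then show ?thesis
          using inv1[OF g] by simp
      qed
      then have Yg': "transpose X ** transpose g = transpose g ** transpose Y"
        by (simp flip: matrix_transpose_mul)
      have "transpose X ** (transpose g ** S ** g) + transpose g ** S ** g ** X
          = transpose X ** transpose g ** S ** g + transpose g ** S ** (g ** X)"
        by (simp only: matrix_mul_assoc)
      also have "\<dots> = transpose g ** (transpose Y ** S + S ** Y) ** g"
        by (simp add: Yg Yg' matrix_distribs matrix_mul_assoc)
      also have "\<dots> = 0"
        using inv[OF conj[OF g X]] by (simp add: Y_def)
      finally show "transpose X ** (transpose g ** S ** g) + transpose g ** S ** g ** X = 0" .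
    qed
    moreover have "\<forall>g\<in>\<Gamma>. det g = 1"
      using det by blast
    ultimately have "fixes_conic \<Gamma>"
      using fixes_conic_iff[of \<Gamma>] S by blast
    then have "elementary \<Gamma>"
      unfolding elementary_def
      using finite_index_subgroup_self[OF group_restrict_SL3[OF \<Gamma>]] by auto
    with ne show ?thesis
      by blast
  qed
qed

section \<open>Stabilisers of conics\<close>

text \<open>A closed set contains \<Gamma> iff all its defining polynomials vanish on \<Gamma>, so
  the closure is cut out by the whole vanishing ideal.\<close>

lemma zariski_dense_SL3_iff:
  assumes "\<Gamma> \<subseteq> carrier SL3"
  shows "zariski_dense_SL3 \<Gamma> \<longleftrightarrow> (\<forall>f\<in>vanishing_polynomials \<Gamma>. \<forall>A. det A = 1 \<longrightarrow> f A = 0)"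
proof -
  have opens: "openin (subtopology zariski_topology (carrier SL3)) T \<longleftrightarrow>
      (\<exists>P. (\<forall>p\<in>P. real_polynomial_function p) \<and> T = - zero_locus P \<inter> carrier SL3)" for T
    unfolding openin_subtopology openin_zariski by blast
  have top: "topspace (subtopology zariski_topology (carrier SL3)) = carrier SL3"
    by simp
  have sub: "subtopology zariski_topology (carrier SL3) closure_of \<Gamma> \<subseteq> carrier SL3"
    using closure_of_subset_topspace[of "subtopology zariski_topology (carrier SL3)" \<Gamma>] unfolding top .
  have closure: "A \<in> subtopology zariski_topology (carrier SL3) closure_of \<Gamma> \<longleftrightarrow>
      (\<forall>f\<in>vanishing_polynomials \<Gamma>. f A = 0)" if A: "A \<in> carrier SL3" for A
  proof
    assume cl: "A \<in> subtopology zariski_topology (carrier SL3) closure_of \<Gamma>"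
    show "\<forall>f\<in>vanishing_polynomials \<Gamma>. f A = 0"
    proof (intro ballI, rule ccontr)
      fix f assume f: "f \<in> vanishing_polynomials \<Gamma>" "f A \<noteq> 0"
      let ?T = "- zero_locus {f} \<inter> carrier SL3"
      have "openin (subtopology zariski_topology (carrier SL3)) ?T"
        using f(1) unfolding opens vanishing_polynomials_def by blast
      moreover have "A \<in> ?T"
        using f A by (simp add: zero_locus_def)
      ultimately have "\<exists>g. g \<in> \<Gamma> \<and> g \<in> ?T"
        using cl[unfolded in_closure_of, THEN conjunct2, THEN spec, of ?T] by simp
      then obtain g where "g \<in> \<Gamma>" "g \<in> ?T"
        by blast
      then show False
        using f(1) by (simp add: zero_locus_def vanishing_polynomials_def)
    qed
  next
    assume zero: "\<forall>f\<in>vanishing_polynomials \<Gamma>. f A = 0"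
    show "A \<in> subtopology zariski_topology (carrier SL3) closure_of \<Gamma>"
      unfolding in_closure_of top
    proof (intro conjI allI impI A)
      fix T assume T: "A \<in> T \<and> openin (subtopology zariski_topology (carrier SL3)) T"
      then obtain P where P: "\<forall>p\<in>P. real_polynomial_function p" "T = - zero_locus P \<inter> carrier SL3"
        unfolding opens by blast
      then obtain p where p: "p \<in> P" "p A \<noteq> 0"
        using T by (auto simp: zero_locus_def)
      then have "p \<notin> vanishing_polynomials \<Gamma>"
        using zero by blast
      then obtain g where g: "g \<in> \<Gamma>" "p g \<noteq> 0"
        using P(1) p(1) by (auto simp: vanishing_polynomials_def)
      then have "g \<in> T"
        using P(2) p(1) subsetD[OF assms g(1)] by (auto simp: zero_locus_def)
      with g(1) show "\<exists>g. g \<in> \<Gamma> \<and> g \<in> T"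
        by blast
    qed
  qed
  show ?thesis
    unfolding zariski_dense_SL3_def using sub closure by auto
qed

text \<open>The transvection alters only row and column i. If c \<noteq> 1, the unaltered entries of
  row j must vanish; if c = 1, the increments in row i, which are multiples of row j, must vanish.
  Either way the entry at (j, i) follows from the others.\<close>

lemma transvection_fixes_symmetric_line:
  fixes S :: "real^'n^'n"
  assumes S: "transpose S = S" and "i \<noteq> j" "t \<noteq> 0"
    and fixed: "transvection i j t ** S ** transpose (transvection i j t) = c *\<^sub>R S"
  shows "S $ j $ k = 0"
proof -
  have sym: "S $ b $ a = S $ a $ b" for a b
    using S by (metis transpose_entry)
  have tr: "transpose (transvection i j t) = transvection j i t"
    by (auto simp: transvection_def matrix_unit_def transpose_def mat_def vec_eq_iff)
  have entry: "S $ a $ b + (if a = i then t * S $ j $ b else 0)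
      + (if b = i then t * (S $ a $ j + (if a = i then t * S $ j $ j else 0)) else 0) = c * S $ a $ b" for a b
    using arg_cong[OF fixed, of "\<lambda>M. M $ a $ b"]
    by (simp add: tr mult_transvection_entry transvection_mult_entry cong: if_cong)
  show ?thesis
  proof (cases "c = 1")
    case True
    have jk: "S $ j $ k = 0" if "k \<noteq> i" for k
      using entry[of i k] that True \<open>t \<noteq> 0\<close> by simp
    moreover have "S $ j $ i = 0"
      using entry[of i i] jk[of j] True \<open>t \<noteq> 0\<close> \<open>i \<noteq> j\<close> sym[of i j] by simp
    ultimately show ?thesis
      by metis
  next
    case False
    have jk: "S $ j $ k = 0" if "k \<noteq> i" for k
      using entry[of j k] that False \<open>i \<noteq> j\<close> by simp
    moreover have "S $ j $ i = 0"
      using entry[of j i] jk[of j] False \<open>i \<noteq> j\<close> by simp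
    ultimately show ?thesis
      by metis
  qed
qed

lemma finite_index_coset_cover:
  assumes \<Gamma>: "subgroup \<Gamma> SL3" and \<Delta>: "finite_index_subgroup \<Delta> (SL3\<lparr>carrier := \<Gamma>\<rparr>)"
  obtains F where "finite F" "F \<subseteq> \<Gamma>" "\<forall>h\<in>\<Gamma>. \<exists>g\<in>F. h ** matrix_inv g \<in> \<Delta>"
proof -
  let ?G = "SL3\<lparr>carrier := \<Gamma>\<rparr>"
  have fin: "finite (rcosets\<^bsub>?G\<^esub> \<Delta>)" and sub: "subgroup \<Delta> ?G"
    using \<Delta> by (auto simp: finite_index_subgroup_def)
  define F where "F = (\<lambda>R. SOME g. g \<in> \<Gamma> \<and> R = \<Delta> #>\<^bsub>?G\<^esub> g) ` (rcosets\<^bsub>?G\<^esub> \<Delta>)"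
  have some: "(SOME g. g \<in> \<Gamma> \<and> R = \<Delta> #>\<^bsub>?G\<^esub> g) \<in> \<Gamma> \<and> R = \<Delta> #>\<^bsub>?G\<^esub> (SOME g. g \<in> \<Gamma> \<and> R = \<Delta> #>\<^bsub>?G\<^esub> g)"
    if "R \<in> rcosets\<^bsub>?G\<^esub> \<Delta>" for R
    by (rule someI_ex) (use that in \<open>auto simp: RCOSETS_def\<close>)
  show thesis
  proof
    show "finite F"
      unfolding F_def using fin by blast
    show "F \<subseteq> \<Gamma>"
      unfolding F_def using some by blast
    show "\<forall>h\<in>\<Gamma>. \<exists>g\<in>F. h ** matrix_inv g \<in> \<Delta>"
    proof
      fix h assume h: "h \<in> \<Gamma>"
      then have R: "\<Delta> #>\<^bsub>?G\<^esub> h \<in> rcosets\<^bsub>?G\<^esub> \<Delta>"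
        by (auto simp: RCOSETS_def)
      then obtain g where g: "g \<in> F" "g \<in> \<Gamma>" "\<Delta> #>\<^bsub>?G\<^esub> h = \<Delta> #>\<^bsub>?G\<^esub> g"
        using some[OF R] unfolding F_def by blast
      have "mat 1 \<in> \<Delta>"
        using subgroup.one_closed[OF sub] by simp
      then have "h \<in> \<Delta> #>\<^bsub>?G\<^esub> h"
        unfolding r_coset_def by force
      then obtain d where d: "d \<in> \<Delta>" "h = d ** g"
        unfolding g(3) by (auto simp: r_coset_def)
      have "h ** matrix_inv g = d ** (g ** matrix_inv g)"
        by (simp add: d matrix_mul_assoc)
      then have "h ** matrix_inv g \<in> \<Delta>"
        using det_matrix_inv_1(1)[OF SL3_subgroup_det[OF \<Gamma> g(2)]] d(1) by simp
      with g(1) show "\<exists>g\<in>F. h ** matrix_inv g \<in> \<Delta>"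
        by blast
    qed
  qed
qed

text \<open>By the equality case of the Cauchy--Schwarz inequality, \<open>\<tau> h \<in> span {S}\<close> is a single
  polynomial equation in \<open>h\<close>.\<close>

lemma dense_imp_transvection_stabilizes:
  fixes \<tau> :: "real^3^3 \<Rightarrow> real^3^3"
  assumes \<Gamma>: "subgroup \<Gamma> SL3" and dense: "zariski_dense_SL3 \<Gamma>"
    and \<Delta>: "finite_index_subgroup \<Delta> (SL3\<lparr>carrier := \<Gamma>\<rparr>)"
    and poly: "\<And>i j. real_polynomial_function (\<lambda>h. \<tau> h $ i $ j)"
    and stab: "\<And>h. h \<in> \<Delta> \<Longrightarrow> \<tau> h \<in> span {S}" and "S \<noteq> 0" and "i \<noteq> j"
  obtains b t where "det b = 1" "t \<noteq> 0" "\<tau> b \<in> span {S}" "\<tau> (transvection i j t ** b) \<in> span {S}"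
proof -
  \<comment> \<open>The Gram determinant of \<open>\<tau> h\<close> and \<open>S\<close>.\<close>
  define \<phi> where "\<phi> h = (\<tau> h \<bullet> \<tau> h) * (S \<bullet> S) - (\<tau> h \<bullet> S)\<^sup>2" for h
  have \<phi>_iff: "\<phi> h = 0 \<longleftrightarrow> \<tau> h \<in> span {S}" for h
  proof
    assume "\<phi> h = 0"
    then have "(\<tau> h \<bullet> S)\<^sup>2 = (norm (\<tau> h) * norm S)\<^sup>2"
      by (simp add: \<phi>_def power_mult_distrib power2_norm_eq_inner)
    then have "\<bar>\<tau> h \<bullet> S\<bar> = norm (\<tau> h) * norm S"
      using power2_eq_imp_eq[of "\<bar>\<tau> h \<bullet> S\<bar>" "norm (\<tau> h) * norm S"] by simp
    then have "collinear {0, \<tau> h, S}"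
      by (simp add: norm_cauchy_schwarz_equal)
    then show "\<tau> h \<in> span {S}"
      using \<open>S \<noteq> 0\<close> by (subst (asm) insert_commute[of "\<tau> h"]) (auto simp: collinear_lemma mem_span_singleton)
  next
    assume "\<tau> h \<in> span {S}"
    then show "\<phi> h = 0"
      by (auto simp: \<phi>_def mem_span_singleton power2_eq_square)
  qed
  have inner_poly: "real_polynomial_function (\<lambda>h. A h \<bullet> B h)"
    if "\<And>i j. real_polynomial_function (\<lambda>h. A h $ i $ j)" "\<And>i j. real_polynomial_function (\<lambda>h. B h $ i $ j)"
    for A B :: "real^3^3 \<Rightarrow> real^3^3"
    unfolding inner_vec_def inner_real_def sum_3
    by (intro real_polynomial_function.intros(3,4) that)
  have \<phi>_poly: "real_polynomial_function \<phi>"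
    unfolding \<phi>_def power2_eq_square
    by (intro real_polynomial_function_diff real_polynomial_function.intros(4) inner_poly poly
        real_polynomial_function.intros(2))
  obtain F where F: "finite F" "F \<subseteq> \<Gamma>" "\<forall>h\<in>\<Gamma>. \<exists>g\<in>F. h ** matrix_inv g \<in> \<Delta>"
    using finite_index_coset_cover[OF \<Gamma> \<Delta>] .
  \<comment> \<open>Each factor is the stabiliser equation moved to one coset of \<Delta>, so the
    product vanishes on all of \<Gamma> and, by density, on SL(3,R).\<close>
  define f where "f A = (\<Prod>g\<in>F. \<phi> (A ** matrix_inv g))" for A
  have "real_polynomial_function f"
    unfolding f_def
    by (intro real_polynomial_function_prod F real_polynomial_function_compose_linear[OF \<phi>_poly]
        bounded_linear_matrix_mul)
  moreover have "f h = 0" if "h \<in> \<Gamma>" for h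
    using bspec[OF F(3) that] F(1) stab \<phi>_iff by (auto simp: f_def prod_zero_iff)
  ultimately have "f \<in> vanishing_polynomials \<Gamma>"
    by (simp add: vanishing_polynomials_def)
  then have "f A = 0" if "det A = 1" for A
    using dense that zariski_dense_SL3_iff[OF subgroup.subset[OF \<Gamma>]] by blast
  then have "\<exists>g\<in>F. \<tau> (transvection i j (real n) ** matrix_inv g) \<in> span {S}" for n
    using det_transvection[OF \<open>i \<noteq> j\<close>] F(1) \<phi>_iff by (auto simp: f_def prod_zero_iff)
  then obtain G where G: "\<And>n. G n \<in> F" "\<And>n. \<tau> (transvection i j (real n) ** matrix_inv (G n)) \<in> span {S}"
    by metis
  have "\<not> inj G"
    using finite_subset[OF _ F(1), of "range G"] G(1) by (auto dest: finite_imageD)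
  then obtain m n where mn: "G m = G n" "m \<noteq> n"
    by (auto simp: inj_def)
  \<comment> \<open>Two of the infinitely many transvections use the same coset representative; they
    differ by the transvection with nonzero parameter n - m.\<close>
  define b where "b = transvection i j (real m) ** matrix_inv (G m)"
  have "det b = 1"
    unfolding b_def using F(2) G(1) det_matrix_inv_1(3)[OF SL3_subgroup_det[OF \<Gamma>]] det_transvection[OF \<open>i \<noteq> j\<close>]
    by (auto simp: det_mul)
  moreover have "transvection i j (real n - real m) ** b = transvection i j (real n) ** matrix_inv (G n)"
    by (simp add: b_def matrix_mul_assoc transvection_add[OF \<open>i \<noteq> j\<close>] mn)
  ultimately show thesis
    using that[of b "real n - real m"] mn G(2)[of m] G(2)[of n] by (simp add: b_def)
qed

lemma dense_imp_non_elementary: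
  assumes \<Gamma>: "subgroup \<Gamma> SL3" and dense: "zariski_dense_SL3 \<Gamma>"
  shows "non_elementary \<Gamma>"
proof
  assume "elementary \<Gamma>"
  then obtain \<Delta> where \<Delta>: "finite_index_subgroup \<Delta> (SL3\<lparr>carrier := \<Gamma>\<rparr>)"
    and conic: "fixes_conic \<Delta> \<or> fixes_dual_conic \<Delta>"
    unfolding elementary_def by blast
  have det: "\<forall>g\<in>\<Delta>. det g = 1"
    using SL3_subgroup_det[OF finite_index_subgroup_SL3(1)[OF \<Gamma> \<Delta>]] by blast
  have entry: "real_polynomial_function (\<lambda>A :: real^3^3. A $ i $ j)" for i j
    by (intro real_polynomial_function.intros bounded_linear_compose[OF bounded_linear_vec_nth bounded_linear_vec_nth])
  \<comment> \<open>The stabiliser of a line is a group: if it contains \<open>b\<close> and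
    \<open>u ** b\<close>, it contains \<open>u\<close>.\<close>
  have line: "u ** S ** transpose u \<in> span {S}"
    if b: "det b = 1" and S: "S \<noteq> 0" "b ** S ** transpose b \<in> span {S}"
      "u ** b ** S ** transpose (u ** b) \<in> span {S}" for u b S :: "real^3^3"
  proof -
    obtain c c' where c: "b ** S ** transpose b = c *\<^sub>R S" "u ** b ** S ** transpose (u ** b) = c' *\<^sub>R S"
      using S by (auto simp: mem_span_singleton)
    have "S = matrix_inv b ** (c *\<^sub>R S) ** transpose (matrix_inv b)"
      by (rule congruence_cancel[OF det_matrix_inv_1(2)[OF b] transpose_matrix_inv_1(2)[OF b] c(1)])
    then have "c \<noteq> 0"
      using S(1) by auto
    have "u ** b ** S ** transpose (u ** b) = u ** (b ** S ** transpose b) ** transpose u"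
      by (simp add: matrix_transpose_mul matrix_mul_assoc)
    then have eq: "c *\<^sub>R (u ** S ** transpose u) = c' *\<^sub>R S"
      unfolding c by (simp add: matrix_distribs)
    have "u ** S ** transpose u = inverse c *\<^sub>R (c *\<^sub>R (u ** S ** transpose u))"
      using \<open>c \<noteq> 0\<close> by simp
    also have "\<dots> = (inverse c * c') *\<^sub>R S"
      unfolding eq by simp
    finally have "u ** S ** transpose u = (inverse c * c') *\<^sub>R S" .
    then show ?thesis
      by (auto simp: mem_span_singleton)
  qed
  have line': "transpose u ** S ** u \<in> span {S}"
    if b: "det b = 1" and S: "S \<noteq> 0" "transpose b ** S ** b \<in> span {S}"
      "transpose (u ** b) ** S ** (u ** b) \<in> span {S}" for u b S :: "real^3^3"
  proof -
    obtain c c' where c: "transpose b ** S ** b = c *\<^sub>R S" "transpose (u ** b) ** S ** (u ** b) = c' *\<^sub>R S"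
      using S by (auto simp: mem_span_singleton)
    define R where "R = transpose (matrix_inv b) ** S ** matrix_inv b"
    have "S = transpose (matrix_inv b) ** (c *\<^sub>R S) ** matrix_inv b"
      by (rule congruence_cancel[OF transpose_matrix_inv_1(1)[OF b] det_matrix_inv_1(1)[OF b] c(1)])
    then have cR: "S = c *\<^sub>R R"
      by (simp add: R_def matrix_distribs)
    then have "c \<noteq> 0"
      using S(1) by auto
    have "transpose b ** (transpose u ** S ** u) ** b = c' *\<^sub>R S"
      using c(2) by (simp add: matrix_transpose_mul matrix_mul_assoc)
    then have "transpose u ** S ** u = transpose (matrix_inv b) ** (c' *\<^sub>R S) ** matrix_inv b"
      by (rule congruence_cancel[OF transpose_matrix_inv_1(1)[OF b] det_matrix_inv_1(1)[OF b]])
    then have "transpose u ** S ** u = c' *\<^sub>R R"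
      by (simp add: R_def matrix_distribs)
    also have "R = inverse c *\<^sub>R S"
      by (subst cR) (use \<open>c \<noteq> 0\<close> in simp)
    finally show ?thesis
      by (auto simp: mem_span_singleton)
  qed
  have ex_neq: "\<exists>i. i \<noteq> j" for j :: 3
    by (rule exI[of _ "if j = 1 then 2 else 1"]) auto
  have tr_u: "transpose (transvection i j t) = transvection j i t" for i j :: 3 and t
    by (auto simp: transvection_def matrix_unit_def transpose_def mat_def vec_eq_iff)
  from conic show False
  proof
    assume "fixes_dual_conic \<Delta>"
    then obtain S where S: "S \<noteq> 0" "transpose S = S" "\<And>g. g \<in> \<Delta> \<Longrightarrow> g ** S ** transpose g \<in> span {S}"
      unfolding fixes_dual_conic_iff[OF det] by blast
    have "S $ j $ k = 0" for j k
    proof -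
      obtain i where "i \<noteq> j"
        using ex_neq[of j] by blast
      have "real_polynomial_function (\<lambda>h :: real^3^3. (h ** S ** transpose h) $ a $ b)" for a b
        unfolding entries_3 by (intro real_polynomial_function.intros(2-4) entry)
      then obtain b t where bt: "det b = 1" "t \<noteq> 0" "b ** S ** transpose b \<in> span {S}"
        "transvection i j t ** b ** S ** transpose (transvection i j t ** b) \<in> span {S}"
        using dense_imp_transvection_stabilizes[OF \<Gamma> dense \<Delta>, of "\<lambda>h. h ** S ** transpose h" S i j] S \<open>i \<noteq> j\<close>
        by blast
      then show ?thesis
        using line[OF bt(1) S(1) bt(3,4)] transvection_fixes_symmetric_line[OF S(2) \<open>i \<noteq> j\<close> bt(2)]
        by (auto simp: mem_span_singleton)
    qed
    then show False
      using S(1) by (simp add: vec_eq_iff)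
  next
    assume "fixes_conic \<Delta>"
    then obtain S where S: "S \<noteq> 0" "transpose S = S" "\<And>g. g \<in> \<Delta> \<Longrightarrow> transpose g ** S ** g \<in> span {S}"
      unfolding fixes_conic_iff[OF det] by blast
    have "S $ j $ k = 0" for j k
    proof -
      obtain i where "i \<noteq> j"
        using ex_neq[of j] by blast
      have "real_polynomial_function (\<lambda>h :: real^3^3. (transpose h ** S ** h) $ a $ b)" for a b
        unfolding entries_3 by (intro real_polynomial_function.intros(2-4) entry)
      \<comment> \<open>The indices are exchanged because the action on forms involves the
        transpose, which turns this transvection into the one from i to j.\<close>
      then obtain b t where bt: "det b = 1" "t \<noteq> 0" "transpose b ** S ** b \<in> span {S}"
        "transpose (transvection j i t ** b) ** S ** (transvection j i t ** b) \<in> span {S}"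
        using dense_imp_transvection_stabilizes[OF \<Gamma> dense \<Delta>, of "\<lambda>h. transpose h ** S ** h" S j i] S \<open>i \<noteq> j\<close>
        by blast
      from line'[OF bt(1) S(1) bt(3,4)]
      have "transvection i j t ** S ** transpose (transvection i j t) \<in> span {S}"
        by (simp add: tr_u)
      then show ?thesis
        using transvection_fixes_symmetric_line[OF S(2) \<open>i \<noteq> j\<close> bt(2)]
        by (auto simp: mem_span_singleton)
    qed
    then show False
      using S(1) by (simp add: vec_eq_iff)
  qed
qed

theorem theoremB2:
  fixes \<Gamma> :: "(real^3^3) set"
  assumes "subgroup \<Gamma> SL3"
  shows "non_elementary \<Gamma> \<longleftrightarrow> zariski_dense_SL3 \<Gamma>"
  using dense_imp_non_elementary[OF assms] non_elementary_vanishing_polynomials[OF assms]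
    zariski_dense_SL3_iff[OF subgroup.subset[OF assms]] by blast

end
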